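(* Let $A$ be any C$^*$-algebra with stable rank $\mathrm{sr}(A)=1$. Then $\mathrm{sr}(\mathrm{C}([0,1],A))=1$ if $A$ has no $\mathrm{K}_1$-obstructions, and $\mathrm{sr}(\mathrm{C}([0,1],A))=2$ otherwise.
   Context: A C$^*$-algebra $A$ has no $\mathrm{K}_1$-obstructions if $\mathrm{sr}(A)=1$ and $\mathrm{K}_1(B)=0$ for every hereditary C$^*$-subalgebra $B$ of $A$ (equivalently, $\mathrm{sr}(A)=1$ and $\mathrm{K}_1(I)=0$ for every closed two-sided ideal $I$ of $A$). *)

theory Defs
  imports "HOL-Analysis.Analysis" "HOL-Library.Extended_Nat" "HOL-Library.Function_Algebras"
begin

class cstar_algebra = real_normed_algebra + banach +
  fixes cscale :: "complex \<Rightarrow> 'a \<Rightarrow> 'a"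
    and cstar :: "'a \<Rightarrow> 'a"
  assumes cscale_of_real: "cscale (complex_of_real r) x = scaleR r x"
    and cscale_assoc: "cscale a (cscale b x) = cscale (a * b) x"
    and cscale_add_left: "cscale (a + b) x = cscale a x + cscale b x"
    and cscale_add_right: "cscale a (x + y) = cscale a x + cscale a y"
    and cscale_mult_left: "cscale a x * y = cscale a (x * y)"
    and cscale_mult_right: "x * cscale a y = cscale a (x * y)"
    and norm_cscale: "norm (cscale a x) = cmod a * norm x"
    and cstar_cstar: "cstar (cstar x) = x"
    and cstar_add: "cstar (x + y) = cstar x + cstar y"
    and cstar_cscale: "cstar (cscale a x) = cscale (cnj a) (cstar x)"
    and cstar_mult: "cstar (x * y) = cstar y * cstar x"
    and cstar_identity: "norm (cstar x * x) = (norm x)\<^sup>2"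

text \<open>Elements of the unitization are pairs (a, lambda), read as a + lambda 1.
The algebra is given by a carrier S inside a ring type, a complex scalar
multiplication sc and a metric d on S.\<close>

definition uni_mult :: "(complex \<Rightarrow> 'b::ring \<Rightarrow> 'b) \<Rightarrow> 'b \<times> complex \<Rightarrow> 'b \<times> complex \<Rightarrow> 'b \<times> complex" where
  "uni_mult sc x y = (fst x * fst y + sc (snd y) (fst x) + sc (snd x) (fst y), snd x * snd y)"

definition Lg :: "(complex \<Rightarrow> 'b::ring \<Rightarrow> 'b) \<Rightarrow> 'b set \<Rightarrow> nat \<Rightarrow> (nat \<Rightarrow> 'b \<times> complex) set" where
  "Lg sc S n = {x. (\<forall>i<n. fst (x i) \<in> S) \<and>
     (\<exists>y. (\<forall>i<n. fst (y i) \<in> S) \<and> (\<Sum>i<n. uni_mult sc (y i) (x i)) = (0, 1))}"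

definition Lg_dense :: "(complex \<Rightarrow> 'b::ring \<Rightarrow> 'b) \<Rightarrow> 'b set \<Rightarrow> ('b \<Rightarrow> 'b \<Rightarrow> real) \<Rightarrow> nat \<Rightarrow> bool" where
  "Lg_dense sc S d n = (\<forall>x. (\<forall>i<n. fst (x i) \<in> S) \<longrightarrow>
     (\<forall>e>0. \<exists>z\<in>Lg sc S n. \<forall>i<n. d (fst (x i)) (fst (z i)) + cmod (snd (x i) - snd (z i)) < e))"

definition stable_rank :: "(complex \<Rightarrow> 'b::ring \<Rightarrow> 'b) \<Rightarrow> 'b set \<Rightarrow> ('b \<Rightarrow> 'b \<Rightarrow> real) \<Rightarrow> enat" where
  "stable_rank sc S d = (if \<exists>n\<ge>1. Lg_dense sc S d n
      then enat (LEAST n. 1 \<le> n \<and> Lg_dense sc S d n) else \<infinity>)"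

definition sr :: "'a::cstar_algebra itself \<Rightarrow> enat" where
  "sr _ = stable_rank (cscale :: complex \<Rightarrow> 'a \<Rightarrow> 'a) UNIV dist"

text \<open>Continuous functions [0,1] -> A, represented extensionally (0 outside [0,1]),
with pointwise operations and the supremum metric.\<close>

definition C01 :: "(real \<Rightarrow> 'a::cstar_algebra) set" where
  "C01 = {f. continuous_on {0..1} f \<and> (\<forall>t. t \<notin> {0..1} \<longrightarrow> f t = 0)}"

definition C01_scale :: "complex \<Rightarrow> (real \<Rightarrow> 'a::cstar_algebra) \<Rightarrow> real \<Rightarrow> 'a" where
  "C01_scale c f = (\<lambda>t. cscale c (f t))"

definition C01_dist :: "(real \<Rightarrow> 'a::cstar_algebra) \<Rightarrow> (real \<Rightarrow> 'a) \<Rightarrow> real" where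
  "C01_dist f g = (SUP t\<in>{0..1}. dist (f t) (g t))"

definition sr_C01 :: "'a::cstar_algebra itself \<Rightarrow> enat" where
  "sr_C01 _ = stable_rank (C01_scale :: complex \<Rightarrow> (real \<Rightarrow> 'a) \<Rightarrow> real \<Rightarrow> 'a) C01 C01_dist"

definition positive :: "'a::cstar_algebra \<Rightarrow> bool" where
  "positive a = (\<exists>x. a = cstar x * x)"

definition cstar_subalgebra :: "'a::cstar_algebra set \<Rightarrow> bool" where
  "cstar_subalgebra B = (closed B \<and> 0 \<in> B \<and>
     (\<forall>x\<in>B. \<forall>y\<in>B. x + y \<in> B \<and> x * y \<in> B) \<and>
     (\<forall>c. \<forall>x\<in>B. cscale c x \<in> B) \<and> (\<forall>x\<in>B. cstar x \<in> B))"

definition hereditary :: "'a::cstar_algebra set \<Rightarrow> bool" where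
  "hereditary B = (cstar_subalgebra B \<and>
     (\<forall>a b. b \<in> B \<and> positive a \<and> positive (b - a) \<longrightarrow> a \<in> B))"

definition uni_star :: "'a::cstar_algebra \<times> complex \<Rightarrow> 'a \<times> complex" where
  "uni_star x = (cstar (fst x), cnj (snd x))"

definition mat_mult :: "nat \<Rightarrow> (nat \<Rightarrow> nat \<Rightarrow> 'a::cstar_algebra \<times> complex) \<Rightarrow> (nat \<Rightarrow> nat \<Rightarrow> 'a \<times> complex) \<Rightarrow> nat \<Rightarrow> nat \<Rightarrow> 'a \<times> complex" where
  "mat_mult m M N = (\<lambda>i j. if i < m \<and> j < m then (\<Sum>l<m. uni_mult cscale (M i l) (N l j)) else 0)"

definition mat_star :: "nat \<Rightarrow> (nat \<Rightarrow> nat \<Rightarrow> 'a::cstar_algebra \<times> complex) \<Rightarrow> nat \<Rightarrow> nat \<Rightarrow> 'a \<times> complex" where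
  "mat_star m M = (\<lambda>i j. if i < m \<and> j < m then uni_star (M j i) else 0)"

definition mat_one :: "nat \<Rightarrow> nat \<Rightarrow> nat \<Rightarrow> 'a::cstar_algebra \<times> complex" where
  "mat_one m = (\<lambda>i j. if i < m \<and> i = j then (0, 1) else 0)"

definition is_mat :: "'a::cstar_algebra set \<Rightarrow> nat \<Rightarrow> (nat \<Rightarrow> nat \<Rightarrow> 'a \<times> complex) \<Rightarrow> bool" where
  "is_mat B m M = (\<forall>i j. (i < m \<and> j < m \<longrightarrow> fst (M i j) \<in> B) \<and> (\<not> (i < m \<and> j < m) \<longrightarrow> M i j = 0))"

definition unitary_mat :: "'a::cstar_algebra set \<Rightarrow> nat \<Rightarrow> (nat \<Rightarrow> nat \<Rightarrow> 'a \<times> complex) \<Rightarrow> bool" where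
  "unitary_mat B m U = (is_mat B m U \<and> mat_mult m (mat_star m U) U = mat_one m
      \<and> mat_mult m U (mat_star m U) = mat_one m)"

definition mat_diag_one :: "nat \<Rightarrow> nat \<Rightarrow> (nat \<Rightarrow> nat \<Rightarrow> 'a::cstar_algebra \<times> complex) \<Rightarrow> nat \<Rightarrow> nat \<Rightarrow> 'a \<times> complex" where
  "mat_diag_one n k U = (\<lambda>i j. if i < n \<and> j < n then U i j
       else if n \<le> i \<and> i < n + k \<and> i = j then (0, 1) else 0)"

text \<open>K_1(B) = 0: every unitary u in M_n(B~) becomes, after adding 1_k, homotopic
to the identity within the unitaries of M_(n+k)(B~) (entrywise topology, which
agrees with the norm topology on matrices).\<close>
definition K1_trivial :: "'a::cstar_algebra set \<Rightarrow> bool" where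
  "K1_trivial B = (\<forall>n U. unitary_mat B n U \<longrightarrow>
     (\<exists>k \<gamma>. (\<forall>t::real\<in>{0..1}. unitary_mat B (n + k) (\<gamma> t)) \<and>
        (\<forall>i j. continuous_on {0..1} (\<lambda>t. \<gamma> t i j)) \<and>
        \<gamma> 0 = mat_diag_one n k U \<and> \<gamma> 1 = mat_one (n + k)))"

definition no_K1_obstructions :: "'a::cstar_algebra itself \<Rightarrow> bool" where
  "no_K1_obstructions T = (sr T = 1 \<and>
     (\<forall>B::'a set. hereditary B \<longrightarrow> K1_trivial B))"

end

theory Submission
  imports Defs
begin

text \<open>
Since sr(A) = 1, invertible elements are dense in the unitization of A. A pair of paths can then be
approximated by step-like paths in which only one component moves at a time while the other is constant and
invertible, whence sr(C([0,1],A)) is at most 2.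

Suppose that sr(C([0,1],A)) = 1 and let B be hereditary. The straight path from 1 + b to 1 is approximated
by a path of invertible elements in the unitization of A, and Jacobson's trick (1 + xy is invertible iff
1 + yx is) moves it into the unitization of B. So the invertible elements of the unitization of B are
connected; row reduction carries this over to matrices and Gram-Schmidt to unitary matrices, and K_1(B) = 0.

Conversely, let K_1(B) = 0 for every hereditary B. Cancelling one row and column at a time by Schur
complements shows that a unitary of the unitization of B that is stably homotopic to 1 is connected to 1; here
one needs that the group of components of the invertible elements is commutative, which follows from
stable rank one. Two invertible elements that are close to each other differ, after polar decomposition,
by a unitary that is nearly 1 outside a small hereditary subalgebra, so they are joined by a short path of
invertible elements. Joining approximations of the values of a path at the points of a fine partition in this
way shows sr(C([0,1],A)) = 1.
\<close>

section \<open>Invertible elements of Banach algebras\<close>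

text \<open>The obstacle is that nearby invertible elements can have inverses of arbitrarily large
  norm, so the segment between them may meet singular elements, and a path that merely exists need
  not be short. With p = u h and q = v k, only the unitary u^-1 v is deformed, inside the
  unitization of the annihilator B of the part of h above a threshold r. There x - 1 kills that
  part, so (x - 1) h has norm at most r times that of x - 1, which is at most 2 for unitary x. The
  path is long itself but short after multiplication by h, and r depends on e alone. As h varies
  with p, so does B, which is why K_1 of all hereditary subalgebras enters. A second constraint:
  elements of the unitization of C([0,1],A) are paths in the unitization of A with constant scalar
  part, so scalar parts are rescaled again and again, usually to 1. Positive elements are treated by
  norm conditions and the power series of sqrt(1 - y), which converges on the whole closed unit
  ball. Its uniform continuity makes thresholds independent of p and q.\<close>

definition invs :: "'u::ring_1 set" where
  "invs = {x. \<exists>y. x * y = 1 \<and> y * x = 1}"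

definition uinv :: "'u::ring_1 \<Rightarrow> 'u" where
  "uinv x = (THE y. x * y = 1 \<and> y * x = 1)"

lemma uinv_unique:
  fixes x :: "'u::ring_1"
  assumes "x * y = 1" "y * x = 1"
  shows "uinv x = y"
  unfolding uinv_def
proof (rule the_equality)
  fix z assume "x * z = 1 \<and> z * x = 1"
  then have "z = (y * x) * z" using assms by simp
  also have "\<dots> = y" using \<open>x * z = 1 \<and> z * x = 1\<close> by (simp add: mult.assoc)
  finally show "z = y" .
qed (use assms in simp)

lemma invsI: "x * y = 1 \<Longrightarrow> y * x = 1 \<Longrightarrow> x \<in> invs"
  by (auto simp: invs_def)

lemma uinv_right [simp]: "x \<in> invs \<Longrightarrow> x * uinv x = 1"
  and uinv_left [simp]: "x \<in> invs \<Longrightarrow> uinv x * x = 1"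
proof -
  assume "x \<in> invs"
  then obtain y where "x * y = 1" "y * x = 1" by (auto simp: invs_def)
  then show "x * uinv x = 1" "uinv x * x = 1" by (simp_all add: uinv_unique)
qed

lemma uinv_right_assoc [simp]: "x \<in> invs \<Longrightarrow> x * (uinv x * z) = z"
  and uinv_left_assoc [simp]: "x \<in> invs \<Longrightarrow> uinv x * (x * z) = z"
  by (simp_all add: mult.assoc[symmetric])

lemma one_in_invs [simp]: "1 \<in> invs"
  by (rule invsI[of _ 1]) auto

lemma uinv_one [simp]: "uinv 1 = 1"
  by (rule uinv_unique) auto

lemma uinv_in_invs [simp]: "x \<in> invs \<Longrightarrow> uinv x \<in> invs"
  by (rule invsI[of _ x]) auto

lemma invs_mult: "x \<in> invs \<Longrightarrow> y \<in> invs \<Longrightarrow> x * y \<in> invs"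
  by (rule invsI[of _ "uinv y * uinv x"]) (simp_all add: mult.assoc)

lemma invs_mult_cancel_left: 
  assumes "x \<in> invs" "x * y \<in> invs" shows "y \<in> invs"
  using invs_mult[OF uinv_in_invs[OF assms(1)] assms(2)] assms(1) by simp

lemma invs_mult_cancel_right: 
  assumes "y \<in> invs" "x * y \<in> invs" shows "x \<in> invs"
  using invs_mult[OF assms(2) uinv_in_invs[OF assms(1)]] assms(1) by (simp add: mult.assoc)

text \<open>The candidate \<open>1 - y * ?z * x\<close> comes from summing 1/(1 + yx) formally as 1
  - y(1 - xy + ...)x.\<close>

lemma jacobson_invs:
  assumes "1 + x * y \<in> invs"
  shows "1 + y * x \<in> invs"
proof (rule invsI)
  let ?z = "uinv (1 + x * y)"
  have 1: "?z + x * (y * ?z) = 1" "?z + ?z * (x * y) = 1"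
    using uinv_right[OF assms] uinv_left[OF assms] by (simp_all add: algebra_simps)
  have "(1 + y * x) * (1 - y * ?z * x) = 1 + y * x - y * (?z + x * (y * ?z)) * x"
    by (simp add: algebra_simps)
  then show "(1 + y * x) * (1 - y * ?z * x) = 1" by (simp add: 1)
  have "(1 - y * ?z * x) * (1 + y * x) = 1 + y * x - y * (?z + ?z * (x * y)) * x"
    by (simp add: algebra_simps)
  then show "(1 - y * ?z * x) * (1 + y * x) = 1" by (simp add: 1)
qed

section \<open>Neumann series and perturbation of inverses\<close>

lemma norm_mult3_ineq:
  fixes a b c :: "'u::real_normed_algebra"
  shows "norm (a * b * c) \<le> norm a * norm b * norm c"
  by (rule order_trans[OF norm_mult_ineq mult_right_mono[OF norm_mult_ineq]]) simp

lemma neumann_invs: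
  fixes x :: "'u::{real_normed_algebra_1,banach}"
  assumes "norm (1 - x) < 1"
  shows "x \<in> invs" "norm (uinv x) \<le> 1 / (1 - norm (1 - x))"
proof -
  define y where "y = 1 - x"
  have ny: "norm y < 1" using assms by (simp add: y_def)
  have s: "summable (\<lambda>n. y ^ n)" by (rule complete_algebra_summable_geometric[OF ny])
  define z where "z = (\<Sum>n. y ^ n)"
  have sz: "(\<lambda>n. y ^ n) sums z" using s by (simp add: z_def summable_sums)
  have "(\<lambda>n. y ^ Suc n) sums (z - 1)" using sz by (subst sums_Suc_iff) simp
  moreover have "(\<lambda>n. y ^ Suc n) sums (y * z)" using sums_mult[OF sz, of y] by simp
  moreover have "(\<lambda>n. y ^ Suc n) sums (z * y)" using sums_mult2[OF sz, of y] by (simp add: power_commutes)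
  ultimately have "y * z = z - 1" "z * y = z - 1" by (blast intro: sums_unique2)+
  then have *: "x * z = 1" "z * x = 1" by (simp_all add: y_def algebra_simps)
  then show "x \<in> invs" by (rule invsI)
  have "uinv x = z" using * by (rule uinv_unique)
  moreover have "norm z \<le> (\<Sum>n. norm y ^ n)"
  proof -
    have g: "summable (\<lambda>n. norm y ^ n)" using ny by (simp add: summable_geometric)
    have n: "summable (\<lambda>n. norm (y ^ n))"
      by (rule summable_comparison_test'[OF g, of 0]) (simp add: norm_power_ineq)
    show ?thesis
      unfolding z_def by (rule order_trans[OF summable_norm[OF n] suminf_le[OF norm_power_ineq n g]])
  qed
  ultimately show "norm (uinv x) \<le> 1 / (1 - norm (1 - x))"
    using ny by (simp add: suminf_geometric y_def)
qed

text \<open>Writing y = x (x^-1 y) reduces this to the Neumann series at x^-1 y. The admissible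
  radius 1 / norm (x^-1) shrinks to 0 near singular elements.\<close>

lemma perturb_invs:
  fixes x :: "'u::{real_normed_algebra_1,banach}"
  assumes "x \<in> invs" "norm (x - y) * norm (uinv x) < 1"
  shows "y \<in> invs" "norm (uinv y) \<le> norm (uinv x) / (1 - norm (x - y) * norm (uinv x))"
proof -
  have "1 - uinv x * y = uinv x * (x - y)" using assms(1) by (simp add: algebra_simps)
  then have le: "norm (1 - uinv x * y) \<le> norm (x - y) * norm (uinv x)"
    by (metis norm_mult_ineq mult.commute)
  note n = neumann_invs[OF le_less_trans[OF le assms(2)]]
  show y: "y \<in> invs" by (rule invs_mult_cancel_left[OF uinv_in_invs[OF assms(1)] n(1)])
  have "uinv y = uinv (uinv x * y) * uinv x"
  proof (rule uinv_unique)
    let ?w = "uinv (uinv x * y)"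
    show "?w * uinv x * y = 1" using uinv_left[OF n(1)] by (simp add: mult.assoc)
    have "y * ?w = x * ((uinv x * y) * ?w)" using assms(1) by (simp add: mult.assoc)
    then show "y * (?w * uinv x) = 1" using n(1) assms(1) by (simp add: mult.assoc[symmetric])
  qed
  then have "norm (uinv y) \<le> norm (uinv (uinv x * y)) * norm (uinv x)" by (simp add: norm_mult_ineq)
  also have "\<dots> \<le> 1 / (1 - norm (x - y) * norm (uinv x)) * norm (uinv x)"
  proof (rule mult_right_mono)
    have "1 / (1 - norm (1 - uinv x * y)) \<le> 1 / (1 - norm (x - y) * norm (uinv x))"
      by (rule divide_left_mono) (use le assms(2) in auto)
    with n(2) show "norm (uinv (uinv x * y)) \<le> 1 / (1 - norm (x - y) * norm (uinv x))" by linarith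
  qed simp
  finally show "norm (uinv y) \<le> norm (uinv x) / (1 - norm (x - y) * norm (uinv x))" by simp
qed

lemma open_invs: "open (invs :: 'u::{real_normed_algebra_1,banach} set)"
  unfolding open_dist
proof safe
  fix x :: 'u assume x: "x \<in> invs"
  have "y \<in> invs" if "dist y x < 1 / (norm (uinv x) + 1)" for y
  proof (rule perturb_invs(1)[OF x])
    have "norm (x - y) * (norm (uinv x) + 1) < 1"
      using that by (simp add: dist_norm norm_minus_commute field_simps add_pos_nonneg)
    then show "norm (x - y) * norm (uinv x) < 1"
      by (smt (verit) mult_left_mono norm_ge_zero)
  qed
  then show "\<exists>e>0. \<forall>y. dist y x < e \<longrightarrow> y \<in> invs"
    by (intro exI[of _ "1 / (norm (uinv x) + 1)"]) (auto simp: add_nonneg_pos)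
qed

lemma continuous_on_uinv_invs: "continuous_on invs (uinv :: 'u::{real_normed_algebra_1,banach} \<Rightarrow> 'u)"
  unfolding continuous_on_iff
proof safe
  fix x :: 'u and e :: real assume x: "x \<in> invs" and e: "0 < e"
  define K where "K = norm (uinv x) + 1"
  have K: "K > 0" "norm (uinv x) \<le> K" by (simp_all add: K_def add_nonneg_pos)
  \<comment> \<open>The first bound keeps \<open>norm (uinv y)\<close> below 2K; with y^-1 - x^-1 =
    y^-1 (x - y) x^-1 the second leaves an error of at most e/2.\<close>
  define d where "d = min (1 / (2 * K)) (e / (4 * K * K))"
  have d: "d > 0" using K e by (simp add: d_def)
  have "dist (uinv y) (uinv x) < e" if y: "y \<in> invs" and "dist y x < d" for y
  proof -
    have xy: "norm (x - y) < d" using that by (simp add: dist_norm norm_minus_commute)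
    have "norm (x - y) * norm (uinv x) \<le> norm (x - y) * K" using K by (intro mult_left_mono) auto
    also have "\<dots> \<le> 1 / 2" using xy K by (simp add: d_def field_simps)
    finally have h: "norm (x - y) * norm (uinv x) \<le> 1/2" .
    have "norm (uinv y) \<le> norm (uinv x) / (1 - norm (x - y) * norm (uinv x))"
      by (rule perturb_invs(2)[OF x]) (use h in linarith)
    also have "\<dots> \<le> norm (uinv x) / (1/2)" by (rule divide_left_mono) (use h in auto)
    finally have ny: "norm (uinv y) \<le> 2 * K" using K by simp
    have "uinv y - uinv x = uinv y * (x - y) * uinv x"
      using x y by (simp add: algebra_simps)
    then have "norm (uinv y - uinv x) \<le> norm (uinv y) * norm (x - y) * norm (uinv x)"
      by (simp add: norm_mult3_ineq)
    also have "\<dots> \<le> (2 * K) * norm (x - y) * K"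
      using ny K by (intro mult_mono) auto
    also have "\<dots> \<le> (2 * K) * (e / (4 * K * K)) * K"
      using xy K by (intro mult_right_mono mult_left_mono) (auto simp: d_def)
    also have "\<dots> < e" using K e by (simp add: field_simps)
    finally show ?thesis by (simp add: dist_norm)
  qed
  then show "\<exists>d>0. \<forall>x'\<in>invs. dist x' x < d \<longrightarrow> dist (uinv x') (uinv x) < e" using d by blast
qed

lemma continuous_on_uinv [continuous_intros]:
  fixes f :: "'a::topological_space \<Rightarrow> 'u::{real_normed_algebra_1,banach}"
  assumes "continuous_on S f" "\<And>x. x \<in> S \<Longrightarrow> f x \<in> invs"
  shows "continuous_on S (\<lambda>x. uinv (f x))"
  using continuous_on_compose2[OF continuous_on_uinv_invs assms(1)] assms(2) by blast

section \<open>The square root series\<close>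

text \<open>Taylor coefficients of sqrt(1 - y) at 0: first 1, then only nonpositive numbers.\<close>

definition sqrt_coeff :: "nat \<Rightarrow> real" where
  "sqrt_coeff n = ((1/2) gchoose n) * (-1) ^ n"

text \<open>The factor is nonnegative as soon as n >= a, which fixes all later signs. It is used for
  a = 1/2 and a = -1/2.\<close>

lemma gbinomial_signed_Suc:
  fixes a :: real
  shows "(a gchoose Suc n) * (-1) ^ Suc n = (real n - a) / (real n + 1) * ((a gchoose n) * (-1) ^ n)"
proof -
  have "(real n + 1) * (a gchoose Suc n) = (a - real n) * (a gchoose n)"
    using gbinomial_mult_1[of a n] by (simp add: algebra_simps)
  then have "a gchoose Suc n = (a - real n) * (a gchoose n) / (real n + 1)"
    by (simp add: eq_divide_eq add_nonneg_eq_0_iff mult.commute)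
  then have "(a gchoose Suc n) * (-1) ^ Suc n = (a - real n) * (a gchoose n) / (real n + 1) * (-1) ^ Suc n"
    by simp
  also have "\<dots> = (real n - a) / (real n + 1) * ((a gchoose n) * (-1) ^ n)"
    by (simp add: minus_divide_left algebra_simps)
  finally show ?thesis .
qed

lemma sqrt_coeff_nonpos: "sqrt_coeff (Suc n) \<le> 0"
proof (induction n)
  case (Suc n)
  have "sqrt_coeff (Suc (Suc n)) = (real (Suc n) - 1/2) / (real (Suc n) + 1) * sqrt_coeff (Suc n)"
    unfolding sqrt_coeff_def by (rule gbinomial_signed_Suc)
  moreover have "(real (Suc n) - 1/2) / (real (Suc n) + 1) \<ge> 0" by simp
  ultimately show ?case using Suc by (metis mult_nonneg_nonpos)
qed (simp add: sqrt_coeff_def)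

text \<open>Partial sums of the coefficients are the signed binomial coefficients of -1/2, hence
  nonnegative. As only the zeroth coefficient, 1, is positive, the sum of absolute values is 2 minus
  such a partial sum.\<close>

lemma sum_abs_sqrt_coeff_le: "(\<Sum>k<m. \<bar>sqrt_coeff k\<bar>) \<le> 2"
proof -
  have pos: "(-1 / 2 gchoose n) * (-1) ^ n \<ge> (0::real)" for n
  proof (induction n)
    case (Suc n)
    then show ?case by (subst gbinomial_signed_Suc) simp
  qed simp
  have "(\<Sum>k\<le>m. sqrt_coeff k) = (-1) ^ m * ((1/2 - 1 :: real) gchoose m)"
    unfolding sqrt_coeff_def by (rule gbinomial_sum_lower_neg)
  then have ge: "(\<Sum>k\<le>m. sqrt_coeff k) \<ge> 0" using pos[of m] by (simp add: mult.commute)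
  have abs: "\<bar>sqrt_coeff k\<bar> = (if k = 0 then 2 else 0) - sqrt_coeff k" for k
    using sqrt_coeff_nonpos[of "k - 1"] by (cases k) (auto simp: sqrt_coeff_def)
  have "(\<Sum>k<m. \<bar>sqrt_coeff k\<bar>) \<le> (\<Sum>k\<le>m. \<bar>sqrt_coeff k\<bar>)"
    by (rule sum_mono2) auto
  also have "\<dots> = (\<Sum>k\<le>m. (if k = 0 then 2 else 0)) - (\<Sum>k\<le>m. sqrt_coeff k)"
    unfolding abs by (rule sum_subtractf)
  also have "\<dots> \<le> 2" using ge by (simp add: sum.delta)
  finally show ?thesis .
qed

lemma summable_sqrt_coeff: "summable (\<lambda>n. \<bar>sqrt_coeff n\<bar>)"
  by (rule summableI_nonneg_bounded[where x = 2]) (auto intro: sum_abs_sqrt_coeff_le)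

text \<open>Vandermonde's identity for 1/2 + 1/2 = 1: the square of the series has the coefficients
  of 1 - y.\<close>

lemma sqrt_coeff_convolution:
  "(\<Sum>i\<le>k. sqrt_coeff i * sqrt_coeff (k - i)) = (if k = 0 then 1 else if k = 1 then -1 else 0)"
proof -
  have "(\<Sum>i\<le>k. sqrt_coeff i * sqrt_coeff (k - i)) =
      (\<Sum>i\<in>{0..k}. (1/2 gchoose i) * (1/2 gchoose (k - i))) * (-1) ^ k"
    unfolding sum_distrib_right sqrt_coeff_def
    by (rule sum.cong) (auto simp: power_add[symmetric] mult_ac)
  also have "\<dots> = ((1::real) gchoose k) * (-1) ^ k"
    by (subst gbinomial_Vandermonde) simp
  also have "\<dots> = (if k = 0 then 1 else if k = 1 then -1 else 0)"
    using binomial_gbinomial[of 1 k, where ?'a = real] by (cases k; cases "k - 1") (auto simp: binomial_eq_0)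
  finally show ?thesis .
qed

text \<open>Meant for the closed unit ball. The boundary matters: if a is positive but not
  invertible and c >= norm a, then 1 - a/c has norm exactly 1.\<close>

definition sqrt1m :: "'u::{real_normed_algebra_1,banach} \<Rightarrow> 'u" where
  "sqrt1m y = (\<Sum>n. sqrt_coeff n *\<^sub>R y ^ n)"

lemma norm_power_le1: "norm (y::'u::real_normed_algebra_1) \<le> 1 \<Longrightarrow> norm (y ^ n) \<le> 1"
  by (rule order_trans[OF norm_power_ineq]) (simp add: power_le_one)

lemma norm_sqrt1m_term:
  fixes y :: "'u::real_normed_algebra_1"
  shows "norm y \<le> 1 \<Longrightarrow> norm (sqrt_coeff n *\<^sub>R y ^ n) \<le> \<bar>sqrt_coeff n\<bar>"
  using norm_power_le1[of y n] by (simp add: mult_left_le)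

lemma summable_sqrt1m:
  fixes y :: "'u::{real_normed_algebra_1,banach}"
  assumes "norm y \<le> 1"
  shows "summable (\<lambda>n. norm (sqrt_coeff n *\<^sub>R y ^ n))"
  by (rule summable_comparison_test'[OF summable_sqrt_coeff, of 0])
    (use norm_sqrt1m_term[OF assms] in auto)

lemma sqrt1m_sums:
  fixes y :: "'u::{real_normed_algebra_1,banach}"
  shows "norm y \<le> 1 \<Longrightarrow> (\<lambda>n. sqrt_coeff n *\<^sub>R y ^ n) sums sqrt1m y"
  unfolding sqrt1m_def by (intro summable_sums summable_norm_cancel[OF summable_sqrt1m])

text \<open>The absolute values of the coefficients from index 1 on sum to at most 1. Through
  \<open>cposI\<close> with c = 1 this makes the root itself positive.\<close>

lemma norm_one_minus_sqrt1m:
  fixes y :: "'u::{real_normed_algebra_1,banach}"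
  assumes "norm y \<le> 1"
  shows "norm (1 - sqrt1m y) \<le> 1"
proof -
  let ?a = "\<lambda>n. sqrt_coeff n *\<^sub>R y ^ n"
  note s = summable_sqrt1m[OF assms]
  have s': "summable (\<lambda>n. norm (?a (Suc n)))" using s by (subst summable_Suc_iff)
  have s'': "summable (\<lambda>n. \<bar>sqrt_coeff (Suc n)\<bar>)" using summable_sqrt_coeff by (subst summable_Suc_iff)
  have "(\<Sum>n. ?a (Suc n)) = sqrt1m y - 1"
    unfolding sqrt1m_def by (subst suminf_split_head[OF summable_norm_cancel[OF s]]) (simp add: sqrt_coeff_def)
  then have "norm (1 - sqrt1m y) = norm (\<Sum>n. ?a (Suc n))" by (simp add: norm_minus_commute)
  also have "\<dots> \<le> (\<Sum>n. norm (?a (Suc n)))" by (rule summable_norm[OF s'])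
  also have "\<dots> \<le> (\<Sum>n. \<bar>sqrt_coeff (Suc n)\<bar>)"
    by (rule suminf_le[OF norm_sqrt1m_term[OF assms] s' s''])
  also have "\<dots> = (\<Sum>n. \<bar>sqrt_coeff n\<bar>) - 1"
    by (subst suminf_split_head[OF summable_sqrt_coeff]) (simp add: sqrt_coeff_def)
  also have "\<dots> \<le> 1"
    using suminf_le_const[OF summable_sqrt_coeff sum_abs_sqrt_coeff_le] by simp
  finally show ?thesis .
qed

lemma sqrt1m_square:
  fixes y :: "'u::{real_normed_algebra_1,banach}"
  assumes "norm y \<le> 1"
  shows "sqrt1m y * sqrt1m y = 1 - y"
proof -
  let ?a = "\<lambda>n. sqrt_coeff n *\<^sub>R y ^ n"
  have "(\<lambda>k. \<Sum>i\<le>k. ?a i * ?a (k - i)) sums (sqrt1m y * sqrt1m y)"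
    unfolding sqrt1m_def by (intro Cauchy_product_sums summable_sqrt1m assms)
  moreover have "(\<Sum>i\<le>k. ?a i * ?a (k - i)) = (if k = 0 then 1 else if k = 1 then - y else 0)" for k
  proof -
    have "(\<Sum>i\<le>k. ?a i * ?a (k - i)) = (\<Sum>i\<le>k. sqrt_coeff i * sqrt_coeff (k - i)) *\<^sub>R y ^ k"
      unfolding scaleR_sum_left by (rule sum.cong) (auto simp: power_add[symmetric])
    then show ?thesis by (simp add: sqrt_coeff_convolution)
  qed
  ultimately have "(\<lambda>k. if k = 0 then 1 else if k = 1 then - y else 0) sums (sqrt1m y * sqrt1m y)" by simp
  moreover have "(\<lambda>k. if k = 0 then 1 else if k = 1 then - y else 0) sums
      (\<Sum>k\<in>{0,1::nat}. if k = 0 then 1 else if k = 1 then - y else 0)"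
    by (rule sums_finite) auto
  ultimately show ?thesis by (auto dest: sums_unique2)
qed

lemma sqrt1m_commute:
  fixes y :: "'u::{real_normed_algebra_1,banach}"
  assumes "norm y \<le> 1" "z * y = y * z"
  shows "z * sqrt1m y = sqrt1m y * z"
proof -
  have "z * y ^ n = y ^ n * z" for n
    by (induction n) (simp_all add: assms(2), metis assms(2) mult.assoc)
  then have "(\<lambda>n. z * (sqrt_coeff n *\<^sub>R y ^ n)) = (\<lambda>n. (sqrt_coeff n *\<^sub>R y ^ n) * z)" by simp
  with sums_mult[OF sqrt1m_sums[OF assms(1)], of z] sums_mult2[OF sqrt1m_sums[OF assms(1)], of z]
  show ?thesis by (auto dest: sums_unique2)
qed

lemma sqrt1m_closed:
  fixes R :: "'u::{real_normed_algebra_1,banach} set"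
  assumes "norm y \<le> 1" "closed R" "y \<in> R" "1 \<in> R" "\<And>a b. a \<in> R \<Longrightarrow> b \<in> R \<Longrightarrow> a + b \<in> R"
    "\<And>a b. a \<in> R \<Longrightarrow> b \<in> R \<Longrightarrow> a * b \<in> R" "\<And>r a. a \<in> R \<Longrightarrow> r *\<^sub>R a \<in> R"
  shows "sqrt1m y \<in> R"
proof (rule closed_sequentially[OF assms(2)])
  have z: "0 \<in> R" using assms(7)[OF assms(4), of 0] by simp
  have p: "y ^ n \<in> R" for n by (induction n) (use assms in auto)
  show "(\<Sum>n<N. sqrt_coeff n *\<^sub>R y ^ n) \<in> R" for N
    by (induction N) (use z p assms in auto)
  show "(\<lambda>N. \<Sum>n<N. sqrt_coeff n *\<^sub>R y ^ n) \<longlonglongrightarrow> sqrt1m y"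
    using sqrt1m_sums[OF assms(1)] by (simp add: sums_def)
qed

lemma norm_power_diff_le:
  fixes x y :: "'u::real_normed_algebra_1"
  assumes "norm x \<le> 1" "norm y \<le> 1"
  shows "norm (x ^ n - y ^ n) \<le> real n * norm (x - y)"
proof (induction n)
  case (Suc n)
  have "norm (x ^ Suc n - y ^ Suc n) = norm (x * (x ^ n - y ^ n) + (x - y) * y ^ n)"
    by (simp add: algebra_simps)
  also have "\<dots> \<le> norm x * norm (x ^ n - y ^ n) + norm (x - y) * norm (y ^ n)"
    by (rule order_trans[OF norm_triangle_ineq add_mono[OF norm_mult_ineq norm_mult_ineq]])
  also have "\<dots> \<le> 1 * (real n * norm (x - y)) + norm (x - y) * 1"
    by (intro add_mono mult_mono Suc norm_power_le1 assms) auto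
  finally show ?case by (simp add: algebra_simps)
qed simp

text \<open>A uniformly small tail plus a polynomial that is Lipschitz on the ball. Uniformity later
  gives one threshold for all pairs of elements of bounded norm.\<close>

lemma sqrt1m_uniformly_continuous:
  "uniformly_continuous_on (cball 0 1) (sqrt1m :: 'u::{real_normed_algebra_1,banach} \<Rightarrow> 'u)"
  unfolding uniformly_continuous_on_def
proof safe
  fix e :: real assume e: "0 < e"
  obtain N where N: "norm (\<Sum>n. \<bar>sqrt_coeff (n + N)\<bar>) < e / 4"
    using suminf_exist_split[OF _ summable_sqrt_coeff, of "e/4"] e by auto
  \<comment> \<open>A Lipschitz constant of the truncated polynomial, increased by 1 to be
    positive.\<close>
  define K where "K = (\<Sum>n<N. \<bar>sqrt_coeff n\<bar> * real n) + 1"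
  have K: "K > 0" unfolding K_def by (intro add_nonneg_pos sum_nonneg) auto
  have tail: "norm (sqrt1m y - (\<Sum>n<N. sqrt_coeff n *\<^sub>R y ^ n)) < e / 4" if "norm y \<le> 1" for y :: 'u
  proof -
    note s = summable_sqrt1m[OF that]
    have s': "summable (\<lambda>n. norm (sqrt_coeff (n + N) *\<^sub>R y ^ (n + N)))"
      using summable_iff_shift[of "\<lambda>n. norm (sqrt_coeff n *\<^sub>R y ^ n)" N] s by simp
    have s'': "summable (\<lambda>n. \<bar>sqrt_coeff (n + N)\<bar>)"
      using summable_iff_shift[of "\<lambda>n. \<bar>sqrt_coeff n\<bar>" N] summable_sqrt_coeff by simp
    have "sqrt1m y - (\<Sum>n<N. sqrt_coeff n *\<^sub>R y ^ n) = (\<Sum>n. sqrt_coeff (n + N) *\<^sub>R y ^ (n + N))"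
      unfolding sqrt1m_def by (subst suminf_split_initial_segment[OF summable_norm_cancel[OF s], of N]) simp
    also have "norm \<dots> \<le> (\<Sum>n. norm (sqrt_coeff (n + N) *\<^sub>R y ^ (n + N)))"
      by (rule summable_norm[OF s'])
    also have "\<dots> \<le> (\<Sum>n. \<bar>sqrt_coeff (n + N)\<bar>)"
      by (rule suminf_le[OF norm_sqrt1m_term[OF that] s' s''])
    finally show ?thesis using N by simp
  qed
  have "dist (sqrt1m x') (sqrt1m x) < e" if "x \<in> cball 0 1" "x' \<in> cball 0 1" "dist x' x < e / (4 * K)" for x x' :: 'u
  proof -
    have n: "norm x \<le> 1" "norm x' \<le> 1" using that by auto
    have "norm ((\<Sum>n<N. sqrt_coeff n *\<^sub>R x' ^ n) - (\<Sum>n<N. sqrt_coeff n *\<^sub>R x ^ n))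
        = norm (\<Sum>n<N. sqrt_coeff n *\<^sub>R (x' ^ n - x ^ n))"
      by (simp add: sum_subtractf[symmetric] scaleR_right_diff_distrib)
    also have "\<dots> \<le> (\<Sum>n<N. \<bar>sqrt_coeff n\<bar> * (real n * norm (x' - x)))"
      by (rule sum_norm_le) (auto intro: mult_left_mono norm_power_diff_le[OF n(2,1)])
    also have "\<dots> \<le> K * norm (x' - x)"
    proof -
      have "(\<Sum>n<N. \<bar>sqrt_coeff n\<bar> * (real n * norm (x' - x))) = (K - 1) * norm (x' - x)"
        unfolding K_def by (simp add: sum_distrib_right mult.assoc)
      then show ?thesis by (simp add: left_diff_distrib)
    qed
    also have "\<dots> < e / 4" using that K by (simp add: dist_norm field_simps)
    finally have "norm ((\<Sum>n<N. sqrt_coeff n *\<^sub>R x' ^ n) - (\<Sum>n<N. sqrt_coeff n *\<^sub>R x ^ n)) < e/4" .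
    moreover have "norm (sqrt1m x' - sqrt1m x) \<le> norm (sqrt1m x' - (\<Sum>n<N. sqrt_coeff n *\<^sub>R x' ^ n))
        + norm ((\<Sum>n<N. sqrt_coeff n *\<^sub>R x' ^ n) - (\<Sum>n<N. sqrt_coeff n *\<^sub>R x ^ n))
        + norm (sqrt1m x - (\<Sum>n<N. sqrt_coeff n *\<^sub>R x ^ n))" by norm
    ultimately show ?thesis using tail[OF n(1)] tail[OF n(2)] e unfolding dist_norm by linarith
  qed
  moreover have "e / (4 * K) > 0" using e K by simp
  ultimately show "\<exists>d>0. \<forall>x\<in>cball 0 1. \<forall>x'\<in>cball 0 1. dist x' x < d \<longrightarrow> dist (sqrt1m x') (sqrt1m x :: 'u) < e"
    by blast
qed

section \<open>Positivity in unital C*-algebras\<close>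

class cstar_algebra_1 = cstar_algebra + real_normed_algebra_1

lemma cscale_one [simp]: "cscale 1 (x::'a::cstar_algebra) = x"
  using cscale_of_real[of 1 x] by simp

lemma cscale_zero_left [simp]: "cscale 0 (x::'a::cstar_algebra) = 0"
  using cscale_of_real[of 0 x] by simp

lemma cscale_zero_right [simp]: "cscale c (0::'a::cstar_algebra) = 0"
  using cscale_add_right[of c 0 "0::'a"] by simp

lemma cscale_minus_left [simp]: "cscale (- c) (x::'a::cstar_algebra) = - cscale c x"
  using cscale_add_left[of c "- c" x] by (simp add: add_eq_0_iff)

lemma cscale_minus_right [simp]: "cscale c (- x::'a::cstar_algebra) = - cscale c x"
  using cscale_add_right[of c x "- x"] by (simp add: add_eq_0_iff)

lemma cscale_diff_right: "cscale c (x - y::'a::cstar_algebra) = cscale c x - cscale c y"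
  using cscale_add_right[of c x "- y"] by simp

lemma cscale_scaleR: "cscale c (r *\<^sub>R x::'a::cstar_algebra) = r *\<^sub>R cscale c x"
  by (metis cscale_assoc cscale_of_real mult.commute)

lemma cstar_zero [simp]: "cstar (0::'a::cstar_algebra) = 0"
  using cstar_add[of 0 "0::'a"] by simp

lemma cstar_minus [simp]: "cstar (- x::'a::cstar_algebra) = - cstar x"
  using cstar_add[of x "- x"] by (simp add: add_eq_0_iff)

lemma cstar_diff: "cstar (x - y::'a::cstar_algebra) = cstar x - cstar y"
  using cstar_add[of x "- y"] by simp

lemma cstar_scaleR [simp]: "cstar (r *\<^sub>R x::'a::cstar_algebra) = r *\<^sub>R cstar x"
  by (metis cscale_of_real cstar_cscale complex_cnj_complex_of_real)

lemma norm_cstar [simp]: "norm (cstar x::'a::cstar_algebra) = norm x"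
proof -
  have le: "norm y \<le> norm (cstar y)" for y :: 'a
  proof (cases "y = 0")
    case False
    have "norm y * norm y \<le> norm (cstar y) * norm y"
      using cstar_identity[of y] norm_mult_ineq[of "cstar y" y] by (simp add: power2_eq_square)
    then show ?thesis using False by simp
  qed simp
  show ?thesis using le[of x] le[of "cstar x"] by (simp add: cstar_cstar)
qed

lemma norm_cstar_mult: "norm (cstar x * x::'a::cstar_algebra) = norm x * norm x"
  by (simp add: cstar_identity power2_eq_square)

lemma norm_mult_cstar: "norm (x * cstar x::'a::cstar_algebra) = norm x * norm x"
  using norm_cstar_mult[of "cstar x"] by (simp add: cstar_cstar)

lemma cstar_mult_eq_0_iff [simp]: "cstar x * x = 0 \<longleftrightarrow> (x::'a::cstar_algebra) = 0"
  using norm_cstar_mult[of x] by auto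

lemma bounded_linear_cstar: "bounded_linear (cstar :: 'a::cstar_algebra \<Rightarrow> 'a)"
  by (rule bounded_linear_intro[where K = 1]) (auto simp: cstar_add)

lemma bounded_linear_cscale: "bounded_linear (cscale c :: 'a::cstar_algebra \<Rightarrow> 'a)"
  by (rule bounded_linear_intro[where K = "cmod c"]) (auto simp: cscale_add_right cscale_scaleR norm_cscale mult.commute)

lemmas continuous_on_cstar [continuous_intros] = bounded_linear.continuous_on[OF bounded_linear_cstar]

lemma cstar_one [simp]: "cstar (1::'u::cstar_algebra_1) = 1"
  by (metis cstar_cstar cstar_mult mult.right_neutral mult.left_neutral)

lemma cstar_of_real [simp]: "cstar (of_real r::'u::cstar_algebra_1) = of_real r"
  by (simp add: of_real_def)

lemma cstar_power: "cstar (x ^ n::'u::cstar_algebra_1) = cstar x ^ n"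
  by (induction n) (simp_all add: cstar_mult power_commutes)

lemma cstar_sqrt1m:
  fixes y :: "'u::cstar_algebra_1"
  assumes "norm y \<le> 1" "cstar y = y"
  shows "cstar (sqrt1m y) = sqrt1m y"
  using bounded_linear.sums[OF bounded_linear_cstar sqrt1m_sums[OF assms(1)]] sqrt1m_sums[OF assms(1)]
  by (simp add: cstar_power assms(2)) (metis sums_unique2)

lemma norm_square_sa:
  fixes x :: "'a::cstar_algebra"
  shows "cstar x = x \<Longrightarrow> norm (x * x) = norm x * norm x"
  using norm_cstar_mult[of x] by simp

text \<open>Here x + iy is normal, so its norm squared is the norm of x^2 + y^2.\<close>
lemma norm_le_norm_sum_squares:
  fixes x y :: "'a::cstar_algebra"
  assumes "cstar x = x" "cstar y = y" "x * y = y * x"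
  shows "norm x * norm x \<le> norm (x * x + y * y)"
proof -
  define u where "u = x + cscale \<i> y"
  have u: "cstar u = x - cscale \<i> y" by (simp add: u_def cstar_add cstar_cscale assms)
  have "cstar u * u = x * x + y * y"
    unfolding u unfolding u_def
    by (simp add: algebra_simps cscale_mult_left cscale_mult_right cscale_assoc cscale_diff_right assms(3))
  then have n: "norm u * norm u = norm (x * x + y * y)" using norm_cstar_mult[of u] by simp
  have "2 *\<^sub>R x = u + cstar u" unfolding u by (simp add: u_def scaleR_2)
  then have "2 * norm x \<le> norm u + norm (cstar u)"
    by (metis norm_triangle_ineq norm_scaleR abs_numeral)
  then have "norm x \<le> norm u" by simp
  then show ?thesis using n mult_mono[of "norm x" "norm u" "norm x" "norm u"] by simp
qed

text \<open>The root s of 1 - x^2 commutes with x and s^2 + x^2 = 1, so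
  \<open>norm_le_norm_sum_squares\<close> bounds s without any spectral theory.\<close>

lemma norm_one_minus_square:
  fixes x :: "'u::cstar_algebra_1"
  assumes "cstar x = x" "norm x \<le> 1"
  shows "norm (1 - x * x) \<le> 1"
proof -
  have n: "norm (x * x) \<le> 1" using assms by (simp add: norm_square_sa mult_le_one)
  define s where "s = sqrt1m (x * x)"
  have s: "s * s = 1 - x * x" "cstar s = s" "x * s = s * x"
    unfolding s_def using n by (auto simp: sqrt1m_square cstar_mult assms intro!: cstar_sqrt1m sqrt1m_commute mult.assoc[symmetric])
  have "norm s * norm s \<le> 1" using norm_le_norm_sum_squares[of s x] s assms by simp
  then show ?thesis using norm_square_sa[OF s(2)] s(1) by simp
qed

section \<open>Positive elements and their square roots\<close>

text \<open>For self-adjoint a this amounts to norm (c - a) <= c for some c, and then for every c >=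
  norm a. The norm condition suits sums, the square suits products of commuting elements. That every
  \<open>cstar x * x\<close> is of this kind is the theorem \<open>cpos_cstar_mult\<close>.\<close>

definition cpos :: "'u::cstar_algebra_1 \<Rightarrow> bool" where
  "cpos a \<longleftrightarrow> (\<exists>x. cstar x = x \<and> a = x * x)"

text \<open>The square root of a, obtained by rescaling into the unit ball; c has to satisfy norm (c
  - a) <= c. The parameter c allows one scale for several elements.\<close>

definition csq :: "real \<Rightarrow> 'u::cstar_algebra_1 \<Rightarrow> 'u" where
  "csq c a = sqrt c *\<^sub>R sqrt1m (1 - a /\<^sub>R c)"

lemma cpos_sa: "cpos a \<Longrightarrow> cstar a = a"
  by (auto simp: cpos_def cstar_mult)

lemma cpos_square: "cstar x = x \<Longrightarrow> cpos (x * x)"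
  by (auto simp: cpos_def)

lemma norm_one_minus_divide:
  fixes a :: "'u::real_normed_algebra_1"
  assumes "norm (of_real c - a) \<le> c" "c > 0"
  shows "norm (1 - a /\<^sub>R c) \<le> 1"
proof -
  have "1 - a /\<^sub>R c = (of_real c - a) /\<^sub>R c" using assms(2) by (simp add: of_real_def scaleR_right_diff_distrib)
  then have "norm (1 - a /\<^sub>R c) = norm (of_real c - a) / c" using assms(2) by (simp add: divide_inverse mult.commute)
  then show ?thesis using assms by simp
qed

context
  fixes a :: "'u::cstar_algebra_1" and c :: real
  assumes n: "norm (of_real c - a) \<le> c" and c: "c > 0"
begin

lemma csq_square: "csq c a * csq c a = a"
proof -
  let ?s = "sqrt1m (1 - a /\<^sub>R c)"
  have "csq c a * csq c a = (sqrt c * sqrt c) *\<^sub>R (?s * ?s)"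
    unfolding csq_def by (simp only: mult_scaleR_left mult_scaleR_right scaleR_scaleR)
  then show ?thesis using c by (simp add: sqrt1m_square[OF norm_one_minus_divide[OF n c]])
qed

lemma csq_commute: "z * a = a * z \<Longrightarrow> z * csq c a = csq c a * z"
  using sqrt1m_commute[OF norm_one_minus_divide[OF n c], of z] by (simp add: csq_def algebra_simps)

lemma csq_sa: "cstar a = a \<Longrightarrow> cstar (csq c a) = csq c a"
  by (simp add: csq_def cstar_sqrt1m[OF norm_one_minus_divide[OF n c]] cstar_diff)

lemma cposI_norm: "cstar a = a \<Longrightarrow> cpos a"
  unfolding cpos_def using csq_square csq_sa by metis

end

lemma cpos_0 [simp]: "cpos 0"
  unfolding cpos_def by (rule exI[of _ 0]) simp

lemma cposI:
  assumes "cstar a = a" "norm (of_real c - a) \<le> c"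
  shows "cpos a"
proof (cases "c > 0")
  case False
  then have "norm (of_real c - a) \<le> 0" "c = 0" using assms(2) norm_ge_zero[of "of_real c - a"] by linarith+
  then show ?thesis by simp
qed (use assms cposI_norm in blast)

text \<open>Dividing the root x by sqrt c gives a contraction, to which
  \<open>norm_one_minus_square\<close> applies.\<close>

lemma cpos_norm:
  assumes "cpos a" "norm a \<le> c"
  shows "norm (of_real c - a) \<le> c"
proof (cases "c > 0")
  case True
  obtain x where x: "cstar x = x" "a = x * x" using assms(1) by (auto simp: cpos_def)
  let ?y = "x /\<^sub>R sqrt c"
  have "norm x * norm x \<le> c" using assms(2) x by (simp add: norm_square_sa)
  then have "norm x \<le> sqrt c" by (simp add: real_le_rsqrt power2_eq_square)
  then have "norm ?y \<le> 1" using True by (simp add: field_simps)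
  then have "norm (1 - ?y * ?y) \<le> 1" by (intro norm_one_minus_square) (simp_all add: x)
  also have "1 - ?y * ?y = (of_real c - a) /\<^sub>R c"
  proof -
    have "inverse (sqrt c) * inverse (sqrt c) = inverse c" using True by (metis inverse_mult_distrib real_sqrt_mult_self abs_of_pos)
    then show ?thesis using True by (simp add: x(2) of_real_def scaleR_right_diff_distrib)
  qed
  also have "norm \<dots> = norm (of_real c - a) / c" using True by (simp add: divide_inverse mult.commute)
  finally show ?thesis using True by (simp add: field_simps)
next
  case False
  then have "norm a \<le> 0" "c = 0" using assms(2) norm_ge_zero[of a] by linarith+
  then show ?thesis by simp
qed

text \<open>In terms of the norm condition this is the triangle inequality, with c the sum of the
  two norms.\<close>

lemma cpos_add:
  assumes "cpos a" "cpos b" shows "cpos (a + b)"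
proof (rule cposI[where c = "norm a + norm b"])
  show "cstar (a + b) = a + b" by (simp add: cstar_add cpos_sa assms)
  have "of_real (norm a + norm b) - (a + b) = (of_real (norm a) - a) + (of_real (norm b) - b)" by simp
  then show "norm (of_real (norm a + norm b) - (a + b)) \<le> norm a + norm b"
    unfolding \<open>of_real (norm a + norm b) - (a + b) = _\<close>
    using norm_triangle_ineq[of "of_real (norm a) - a" "of_real (norm b) - b"]
      cpos_norm[OF assms(1) order_refl] cpos_norm[OF assms(2) order_refl] by linarith
qed

lemma cpos_scaleR: "cpos a \<Longrightarrow> r \<ge> 0 \<Longrightarrow> cpos (r *\<^sub>R a)"
proof -
  assume "cpos a" "r \<ge> 0"
  then obtain x where x: "cstar x = x" "a = x * x" by (auto simp: cpos_def)
  have "r *\<^sub>R a = (sqrt r *\<^sub>R x) * (sqrt r *\<^sub>R x)" using \<open>r \<ge> 0\<close> by (simp add: x(2))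
  then show ?thesis unfolding cpos_def using x by (intro exI[of _ "sqrt r *\<^sub>R x"]) simp
qed

lemma cpos_1 [simp]: "cpos 1"
  unfolding cpos_def by (rule exI[of _ 1]) simp

lemma cpos_of_real [simp]: "r \<ge> 0 \<Longrightarrow> cpos (of_real r)"
  unfolding of_real_def by (simp add: cpos_scaleR)

lemma cpos_csq:
  assumes "norm (of_real c - a) \<le> c" "c > 0" "cstar a = a"
  shows "cpos (csq c a)"
  unfolding csq_def
proof (intro cpos_scaleR cposI[where c = 1])
  note n = norm_one_minus_divide[OF assms(1,2)]
  show "cstar (sqrt1m (1 - a /\<^sub>R c)) = sqrt1m (1 - a /\<^sub>R c)"
    by (rule cstar_sqrt1m[OF n]) (simp add: cstar_diff assms)
  show "norm (of_real 1 - sqrt1m (1 - a /\<^sub>R c)) \<le> 1" by (simp add: norm_one_minus_sqrt1m n)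
qed (use assms in simp)

lemma cpos_csq_norm: 
  assumes "cpos a"
  shows "norm (of_real (norm a + 1) - a) \<le> norm a + 1" "norm a + 1 > 0"
  by (rule cpos_norm[OF assms]) (auto simp: add_nonneg_pos)

lemma cpos_commuting_roots:
  assumes "cpos a" "cpos b" "a * b = b * a"
  obtains x y where "cstar x = x" "cstar y = y" "x * y = y * x" "x * x = a" "y * y = b"
proof
  let ?x = "csq (norm a + 1) a" and ?y = "csq (norm b + 1) b"
  note A = cpos_csq_norm[OF assms(1)] and B = cpos_csq_norm[OF assms(2)]
  show "cstar ?x = ?x" "cstar ?y = ?y" "?x * ?x = a" "?y * ?y = b"
    using csq_sa[OF A] csq_sa[OF B] csq_square[OF A] csq_square[OF B] assms cpos_sa by auto
  have "b * ?x = ?x * b" by (rule csq_commute[OF A]) (use assms in simp)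
  then show "?x * ?y = ?y * ?x" by (intro csq_commute[OF B]) simp
qed

lemma cpos_mult:
  assumes "cpos a" "cpos b" "a * b = b * a"
  shows "cpos (a * b)"
proof -
  obtain x y where xy: "cstar x = x" "cstar y = y" "x * y = y * x" "x * x = a" "y * y = b"
    using cpos_commuting_roots[OF assms] .
  have "a * b = x * (x * y) * y" unfolding xy(4,5)[symmetric] by (simp only: mult.assoc)
  also have "\<dots> = (x * y) * (x * y)" by (subst (1) xy(3)) (simp only: mult.assoc)
  finally show ?thesis using cpos_square[of "x * y"] xy(1-3) by (simp add: cstar_mult)
qed

text \<open>Here b = -a commutes with a, so there are commuting roots x and y, and x^2 + y^2 = 0
  forces x = 0.\<close>

lemma cpos_add_eq_0:
  assumes "cpos a" "cpos b" "a + b = 0" shows "a = 0" "b = 0"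
proof -
  have "b = - a" using assms(3) by (simp add: eq_neg_iff_add_eq_0 add.commute)
  then obtain x y where xy: "cstar x = x" "cstar y = y" "x * y = y * x" "x * x = a" "y * y = b"
    using cpos_commuting_roots[OF assms(1,2)] by auto
  have "norm x * norm x \<le> norm (a + b)" using norm_le_norm_sum_squares[OF xy(1-3)] xy by simp
  then have "x = 0" using assms(3) by (simp add: mult_le_0_iff)
  then show "a = 0" using xy by simp
  with assms(3) show "b = 0" by simp
qed

lemma sa_cube_eq_0:
  fixes w :: "'u::cstar_algebra_1"
  assumes "cstar w = w" "w * w * w = 0" shows "w = 0"
proof -
  have "(w * w) * (w * w) = 0" using assms(2) by (simp add: mult.assoc[symmetric])
  moreover have "cstar (w * w) = w * w" by (simp add: cstar_mult assms(1))
  ultimately have "w * w = 0" using norm_square_sa[of "w * w"] by simp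
  then show ?thesis using norm_square_sa[OF assms(1)] by simp
qed

section \<open>Absolute value, positive and negative parts\<close>

definition cabs :: "'u::cstar_algebra_1 \<Rightarrow> 'u" where
  "cabs a = csq (norm (a * a) + 1) (a * a)"

lemma
  assumes "cstar a = a"
  shows cabs_square: "cabs a * cabs a = a * a"
    and cpos_cabs: "cpos (cabs a)"
    and cabs_commute: "z * a = a * z \<Longrightarrow> z * cabs a = cabs a * z"
proof -
  note A = cpos_csq_norm[OF cpos_square[OF assms]]
  show "cabs a * cabs a = a * a" "cpos (cabs a)"
    unfolding cabs_def using csq_square[OF A] cpos_csq[OF A] by (auto simp: cstar_mult assms)
  assume z: "z * a = a * z"
  then have "z * (a * a) = a * a * z" by (metis mult.assoc)
  then show "z * cabs a = cabs a * z" unfolding cabs_def by (rule csq_commute[OF A])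
qed

text \<open>With r = |a|, q = |r + a| and w = q - (r + a) one finds w^2 q + 2 w^2 r = 0, a sum of positive
  elements, so that w^3 = 2 w^2 q vanishes.\<close>
lemma cpos_cabs_plus:
  fixes a :: "'u::cstar_algebra_1"
  assumes a: "cstar a = a"
  shows "cpos (cabs a + a)"
proof -
  define r where "r = cabs a"
  define q where "q = cabs (r + a)"
  have r: "r * r = a * a" "cpos r" "a * r = r * a"
    using cabs_square[OF a] cpos_cabs[OF a] cabs_commute[OF a, of a] by (simp_all add: r_def)
  have d: "cstar (r + a) = r + a" using a cpos_sa[OF r(2)] by (simp add: cstar_add)
  have q: "q * q = (r + a) * (r + a)" "cpos q" "a * q = q * a" "r * q = q * r"
    using cabs_square[OF d] cpos_cabs[OF d] cabs_commute[OF d, of a] cabs_commute[OF d, of r] r(3)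
    by (simp_all add: q_def algebra_simps)
  define w where "w = q - (r + a)"
  have w: "cstar w = w" using d cpos_sa[OF q(2)] by (simp add: w_def cstar_diff)
  \<comment> \<open>Normal form in the commutative algebra generated by r, a, q: factors are sorted
    in this order, and squares of a and q are eliminated. \<open>rules'\<close> repeats the rules in
    front of a further factor.\<close>
  have rules: "a * r = r * a" "q * r = r * q" "q * a = a * q" "a * a = r * r" "q * q = r * r + r * a + r * a + r * r"
    using r q by (simp_all add: algebra_simps)
  have rules': "a * (r * z) = r * (a * z)" "q * (r * z) = r * (q * z)" "q * (a * z) = a * (q * z)"
     "a * (a * z) = r * (r * z)" "q * (q * z) = r * (r * z) + r * (a * z) + r * (a * z) + r * (r * z)" for z
    by (simp_all add: mult.assoc[symmetric] rules(1-4)) (simp add: mult.assoc[symmetric] rules(5) distrib_right)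
  have "w * w * q + 2 * (w * w * r) = 0"
    unfolding w_def by (simp add: algebra_simps rules rules' mult_2)
  moreover have "w * w * w = 2 * (w * w * q)"
    unfolding w_def by (simp add: algebra_simps rules rules' mult_2)
  moreover have "cpos (w * w * q)" "cpos (w * w * r)"
    by (intro cpos_mult cpos_square w q r; simp add: w_def algebra_simps rules rules')+
  ultimately have "w * w * w = 0"
    using cpos_add_eq_0(1)[of "w * w * q" "2 * (w * w * r)"] cpos_scaleR[of "w * w * r" 2]
    by (simp add: scaleR_conv_of_real)
  then have "w = 0" by (rule sa_cube_eq_0[OF w])
  then show ?thesis using q(2) by (simp add: w_def r_def)
qed

text \<open>The second part is positive by \<open>cpos_cabs_plus\<close> for -a, since |-a| = |a|.
  The last clause later lets a positive h commute with its truncations.\<close>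

lemma pos_neg_parts:
  fixes a :: "'u::cstar_algebra_1"
  assumes a: "cstar a = a"
  obtains p n where "cpos p" "cpos n" "a = p - n" "p * n = 0" "n * p = 0"
    "\<And>z. z * a = a * z \<Longrightarrow> z * p = p * z \<and> z * n = n * z"
proof
  let ?p = "(1/2) *\<^sub>R (cabs a + a)" and ?n = "(1/2) *\<^sub>R (cabs a - a)"
  have [simp]: "cabs (- a) = cabs a" by (simp add: cabs_def)
  have "cpos (cabs (- a) + - a)" by (rule cpos_cabs_plus) (simp add: a)
  then show "cpos ?p" "cpos ?n" using cpos_cabs_plus[OF a] by (simp_all add: cpos_scaleR)
  show "a = ?p - ?n" by (simp add: scaleR_right_diff_distrib scaleR_right_distrib) (simp add: scaleR_add_left[symmetric])
  have c: "a * cabs a = cabs a * a" by (rule cabs_commute[OF a refl])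
  show "?p * ?n = 0" "?n * ?p = 0" by (simp_all add: algebra_simps c cabs_square[OF a])
  fix z assume "z * a = a * z"
  then show "z * ?p = ?p * z \<and> z * ?n = ?n * z"
    using cabs_commute[OF a, of z] by (simp add: algebra_simps)
qed

lemma cpos_of_real_minus: "cstar b = b \<Longrightarrow> norm b \<le> c \<Longrightarrow> cpos (of_real c - b)"
  by (rule cposI[where c = c]) (simp_all add: cstar_diff)

lemma of_real_commute: "of_real r * (x::'u::real_algebra_1) = x * of_real r"
  by (simp add: of_real_def)

text \<open>Commuting roots of a and c - a give norm a <= |c|. If c were negative, -c, c - a and a
  would be positive elements with sum 0.\<close>

lemma cpos_norm_le:
  assumes "cpos a" "cpos (of_real c - a)"
  shows "norm a \<le> c"
proof -
  have "a * (of_real c - a) = (of_real c - a) * a" by (simp add: algebra_simps of_real_commute)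
  then obtain x y where xy: "cstar x = x" "cstar y = y" "x * y = y * x" "x * x = a" "y * y = of_real c - a"
    using cpos_commuting_roots[OF assms] by metis
  have *: "norm a \<le> norm (of_real c :: 'a)"
    using norm_le_norm_sum_squares[OF xy(1-3)] norm_square_sa[OF xy(1)] xy by simp
  have "c \<ge> 0"
  proof (rule ccontr)
    assume "\<not> c \<ge> 0"
    have "of_real (- c) + (of_real c - a) + a = 0" by simp
    moreover have "cpos (of_real c - a + a)" using cpos_add assms by blast
    moreover have "cpos (of_real (- c) :: 'a)" using \<open>\<not> c \<ge> 0\<close> by (intro cpos_of_real) simp
    ultimately have "of_real (- c) = (0::'a)" using cpos_add_eq_0(1)[of "of_real (-c) :: 'a" "of_real c - a + a"] by simp
    with \<open>\<not> c \<ge> 0\<close> show False by simp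
  qed
  with * show ?thesis by simp
qed

lemma cpos_norm_mono:
  assumes "cpos a" "cpos (b - a)"
  shows "norm a \<le> norm b"
proof (rule cpos_norm_le[OF assms(1)])
  have "cpos b" using cpos_add[OF assms] by simp
  then have "cpos (of_real (norm b) - b)" by (intro cpos_of_real_minus cpos_sa) auto
  from cpos_add[OF this assms(2)] show "cpos (of_real (norm b) - a)" by simp
qed

text \<open>Multiplying 0 <= K - z^-1 by the commuting positive element z gives 1 <= K z.\<close>

lemma cpos_invs_bounded_below:
  assumes "cpos z" "z \<in> invs"
  obtains e where "e > 0" "cpos (z - of_real e)"
proof
  define K where "K = norm (uinv z) + 1"
  have K: "K > 0" "norm (uinv z) \<le> K" by (simp_all add: K_def add_nonneg_pos)
  have sz: "cstar z = z" by (rule cpos_sa[OF assms(1)])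
  have "uinv z = cstar (uinv z)"
  proof (rule uinv_unique)
    show "z * cstar (uinv z) = 1" by (metis assms(2) sz cstar_mult cstar_one uinv_left)
    show "cstar (uinv z) * z = 1" by (metis assms(2) sz cstar_mult cstar_one uinv_right)
  qed
  then have "cpos (of_real K - uinv z)" using K by (intro cpos_of_real_minus) auto
  then have "cpos ((of_real K - uinv z) * z)"
    by (rule cpos_mult) (use assms in \<open>simp_all add: algebra_simps of_real_commute\<close>)
  then have "cpos ((1 / K) *\<^sub>R (of_real K * z - 1))"
    using K assms(2) by (intro cpos_scaleR) (simp_all add: algebra_simps)
  moreover have "(1 / K) *\<^sub>R (of_real K * z - 1) = z - of_real (1 / K)"
    using K by (simp add: of_real_def scaleR_right_diff_distrib)
  ultimately show "cpos (z - of_real (1 / K))" by simp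
  show "1 / K > 0" using K by simp
qed

lemma of_real_invs: "k \<noteq> 0 \<Longrightarrow> of_real k \<in> (invs :: 'u::real_algebra_1 set)"
  by (rule invsI[of _ "of_real (inverse k)"]) (simp_all add: of_real_mult[symmetric] del: of_real_mult of_real_inverse)

text \<open>z lies within c of the scalar c + e, and c < c + e is what the Neumann series
  needs.\<close>

lemma bounded_below_invs:
  fixes z :: "'u::cstar_algebra_1"
  assumes "e > 0" "cpos (z - of_real e)"
  shows "z \<in> invs"
proof -
  define c where "c = norm (z - of_real e)"
  have n: "norm (of_real c - (z - of_real e)) \<le> c" by (rule cpos_norm[OF assms(2)]) (simp add: c_def)
  have c: "c + e > 0" using assms(1) by (simp add: c_def add_nonneg_pos)
  have eq: "of_real c - (z - of_real e) = (c + e) *\<^sub>R 1 - z" by (simp add: of_real_def scaleR_left_distrib)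
  have "1 - z /\<^sub>R (c + e) = ((c + e) *\<^sub>R 1 - z) /\<^sub>R (c + e)"
    using c by (simp add: scaleR_right_diff_distrib)
  then have "norm (1 - z /\<^sub>R (c + e)) = norm (of_real c - (z - of_real e)) / (c + e)"
    unfolding eq using c by (simp add: divide_inverse mult.commute)
  also have "\<dots> < 1" using n assms(1) c by simp
  finally have "z /\<^sub>R (c + e) \<in> invs" by (rule neumann_invs)
  then have "of_real (c + e) * (z /\<^sub>R (c + e)) \<in> invs"
    by (rule invs_mult[rotated]) (rule of_real_invs, use c in simp)
  moreover have "of_real (c + e) * (z /\<^sub>R (c + e)) = z"
    unfolding of_real_def using c by (simp only: mult_scaleR_left mult_1_left scaleR_scaleR) simp
  ultimately show ?thesis by simp
qed

text \<open>In spectral terms, norm b belongs to the spectrum of b: an inverse would give a gap e >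
  0 and hence norm b <= norm b - e.\<close>

lemma cpos_norm_not_invs:
  fixes b :: "'u::cstar_algebra_1"
  assumes "cpos b" shows "of_real (norm b) - b \<notin> invs"
proof
  assume i: "of_real (norm b) - b \<in> invs"
  have "cpos (of_real (norm b) - b)" by (rule cpos_of_real_minus[OF cpos_sa[OF assms] order_refl])
  then obtain e where e: "e > 0" "cpos (of_real (norm b) - b - of_real e)"
    using cpos_invs_bounded_below i by blast
  then have "norm b \<le> norm b - e" by (intro cpos_norm_le assms) (simp add: algebra_simps)
  with e show False by simp
qed

text \<open>With n the negative part of \<open>cstar x * x\<close>, the element y = x n satisfies
  \<open>cstar y * y\<close> = -b for b = n^3 >= 0. Then \<open>y * cstar y\<close> turns out
  positive, so norm b plus it is invertible if b is not 0; Jacobson's trick makes norm b - b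
  invertible too, which is impossible.\<close>

theorem cpos_cstar_mult: "cpos (cstar x * (x::'u::cstar_algebra_1))"
proof -
  define a where "a = cstar x * x"
  have sa: "cstar a = a" by (simp add: a_def cstar_mult cstar_cstar)
  obtain p n where pn: "cpos p" "cpos n" "a = p - n" "p * n = 0" "n * p = 0"
    using pos_neg_parts[OF sa] by metis
  define y where "y = x * n"
  define b where "b = n * n * n"
  have b: "cpos b" unfolding b_def by (intro cpos_mult cpos_square cpos_sa pn) (simp add: mult.assoc)
  have "cstar y * y = n * a * n" by (simp add: y_def a_def cstar_mult cpos_sa[OF pn(2)] mult.assoc)
  also have "\<dots> = - b" unfolding pn(3) b_def by (simp only: right_diff_distrib pn(5)) simp
  finally have yy: "cstar y * y = - b" .
  \<comment> \<open>Up to sign, twice the real and imaginary parts of y; the sum of their squares is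
    twice \<open>cstar y * y + y * cstar y\<close>.\<close>
  define u v where "u = y + cstar y" and "v = cscale \<i> (y - cstar y)"
  have uv: "cstar u = u" "cstar v = v"
    by (simp_all add: u_def v_def cstar_add cstar_cscale cstar_diff cstar_cstar add.commute cscale_diff_right)
  have "v * v = - ((y - cstar y) * (y - cstar y))"
    by (simp add: v_def cscale_mult_left cscale_mult_right cscale_assoc)
  then have "u * u + v * v = 2 *\<^sub>R (cstar y * y + y * cstar y)"
    by (simp add: u_def algebra_simps scaleR_2)
  moreover have "cpos (u * u + v * v)" using uv by (intro cpos_add cpos_square)
  ultimately have "cpos ((1/2) *\<^sub>R (2 *\<^sub>R (cstar y * y + y * cstar y)))"
    using cpos_scaleR[of "u * u + v * v" "1/2"] by simp
  then have "cpos (cstar y * y + y * cstar y + b)" by (intro cpos_add[OF _ b]) simp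
  then have g: "cpos (y * cstar y)" by (simp add: yy)
  have "b = 0"
  proof (rule ccontr)
    assume "b \<noteq> 0"
    then have k: "norm b > 0" by simp
    have "of_real (norm b) + y * cstar y \<in> invs"
      by (rule bounded_below_invs[OF k]) (simp add: g)
    moreover have "of_real (inverse (norm b)) * (of_real (norm b) + y * cstar y) = 1 + (of_real (inverse (norm b)) * y) * cstar y"
      using k by (simp add: distrib_left of_real_mult[symmetric] mult.assoc del: of_real_mult of_real_inverse)
    moreover have "of_real (inverse (norm b)) \<in> (invs :: 'u set)" using k by (intro of_real_invs) simp
    ultimately have "1 + (of_real (inverse (norm b)) * y) * cstar y \<in> invs"
      by (metis invs_mult)
    then have "1 + cstar y * (of_real (inverse (norm b)) * y) \<in> invs" by (rule jacobson_invs)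
    then have "of_real (norm b) * (1 + cstar y * (of_real (inverse (norm b)) * y)) \<in> invs"
      using k by (intro invs_mult of_real_invs) auto
    moreover have "of_real (norm b) * (1 + cstar y * (of_real (inverse (norm b)) * y)) = of_real (norm b) + cstar y * y"
      using k by (simp add: of_real_def scaleR_right_distrib)
    ultimately show False using cpos_norm_not_invs[OF b] yy by simp
  qed
  then have "n = 0" unfolding b_def by (rule sa_cube_eq_0[OF cpos_sa[OF pn(2)]])
  then show ?thesis using pn by (simp add: a_def)
qed

lemma cpos_mult_cstar: "cpos ((x::'u::cstar_algebra_1) * cstar x)"
  using cpos_cstar_mult[of "cstar x"] by (simp add: cstar_cstar)

lemma cpos_conj:
  assumes "cpos a" shows "cpos (cstar z * a * z)"
proof -
  obtain x where x: "cstar x = x" "a = x * x" using assms by (auto simp: cpos_def)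
  then have "cstar z * a * z = cstar (x * z) * (x * z)" by (simp add: cstar_mult mult.assoc)
  then show ?thesis by (simp add: cpos_cstar_mult)
qed

lemma cpos_add_invs:
  assumes "cpos a" "a \<in> invs" "cpos b" shows "a + b \<in> invs"
proof -
  obtain e where "e > 0" "cpos (a - of_real e)" using cpos_invs_bounded_below assms by blast
  then show ?thesis using cpos_add[OF _ assms(3), of "a - of_real e"]
    by (intro bounded_below_invs[of e]) (simp_all add: algebra_simps)
qed

section \<open>The unitization\<close>

text \<open>A new type instead of the pairs of the statement, because product types already carry a
  norm of their own.\<close>

datatype 'a uni = Uni (uvec: 'a) (uscal: complex)

text \<open>The unitization acts on its ideal A by left multiplication; the operator norm of this
  action supplies the C*-norm.\<close>

definition uact :: "'a::cstar_algebra uni \<Rightarrow> 'a \<Rightarrow> 'a" where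
  "uact x b = uvec x * b + cscale (uscal x) b"

lemma bounded_linear_uact: "bounded_linear (uact x)"
  unfolding uact_def
  by (intro bounded_linear_add bounded_linear_mult_right bounded_linear_cscale)

instantiation uni :: (cstar_algebra) "{zero,one,plus,minus,uminus,times,scaleR}"
begin
definition "0 = Uni (0::'a) 0"
definition "1 = Uni (0::'a) 1"
definition "x + y = Uni (uvec x + uvec y :: 'a) (uscal x + uscal y)"
definition "x - y = Uni (uvec x - uvec y :: 'a) (uscal x - uscal y)"
definition "- x = Uni (- uvec x :: 'a) (- uscal x)"
definition "x * y = Uni (uvec x * uvec y + cscale (uscal y) (uvec x) + cscale (uscal x) (uvec y) :: 'a) (uscal x * uscal y)"
definition "scaleR r x = Uni (scaleR r (uvec x) :: 'a) (scaleR r (uscal x))"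
instance ..
end

lemma uni_sel [simp]:
  "uvec (0::'a::cstar_algebra uni) = 0" "uscal (0::'a uni) = 0" "uvec (1::'a uni) = 0" "uscal (1::'a uni) = 1"
  "uvec (x + y :: 'a uni) = uvec x + uvec y" "uscal (x + y) = uscal x + uscal y"
  "uvec (x - y) = uvec x - uvec y" "uscal (x - y) = uscal x - uscal y"
  "uvec (- x) = - uvec x" "uscal (- x) = - uscal x"
  "uvec (x * y) = uvec x * uvec y + cscale (uscal y) (uvec x) + cscale (uscal x) (uvec y)" "uscal (x * y) = uscal x * uscal y"
  "uvec (r *\<^sub>R x) = r *\<^sub>R uvec x" "uscal (r *\<^sub>R x) = r *\<^sub>R uscal x"
  by (simp_all add: zero_uni_def one_uni_def plus_uni_def minus_uni_def uminus_uni_def times_uni_def scaleR_uni_def)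

lemma cscale_scaleR_left: "cscale (r *\<^sub>R c) (x::'a::cstar_algebra) = r *\<^sub>R cscale c x"
  by (simp add: scaleR_conv_of_real cscale_assoc[symmetric] cscale_of_real)

lemma uni_eqI: "uvec x = uvec y \<Longrightarrow> uscal x = uscal y \<Longrightarrow> x = y"
  by (simp add: uni.expand)

instance uni :: (cstar_algebra) real_algebra_1
proof
  show "(0::'a uni) \<noteq> 1" by (simp add: zero_uni_def one_uni_def)
qed (rule uni_eqI; simp add: algebra_simps cscale_add_left cscale_add_right cscale_mult_left cscale_mult_right
      cscale_assoc cscale_scaleR cscale_scaleR_left)+

lemma uact_add: "uact (x + y) = (\<lambda>b. uact x b + uact y b)"
  by (auto simp: uact_def algebra_simps cscale_add_left)

lemma uact_mult: "uact (x * y) = uact x \<circ> uact y"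
  by (auto simp: uact_def algebra_simps cscale_add_right cscale_mult_left cscale_mult_right cscale_assoc)

lemma uact_scaleR: "uact (r *\<^sub>R x) = (\<lambda>b. r *\<^sub>R uact x b)"
  by (auto simp: fun_eq_iff uact_def algebra_simps scaleR_conv_of_real[where ?'a = complex] cscale_assoc[symmetric] cscale_of_real cscale_scaleR)

text \<open>Testing the operator on \<open>cstar a\<close> gives the lower bound.\<close>

lemma onorm_uact_vec: "onorm (uact (Uni a 0)) = norm (a::'a::cstar_algebra)"
proof (rule antisym)
  show "onorm (uact (Uni a 0)) \<le> norm a"
    by (rule onorm_bound) (simp_all add: uact_def norm_mult_ineq)
  have "norm a * norm a \<le> onorm (uact (Uni a 0)) * norm a"
    using onorm[OF bounded_linear_uact, of "Uni a 0" "cstar a"] norm_mult_cstar[of a] by (simp add: uact_def)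
  then show "norm a \<le> onorm (uact (Uni a 0))"
    by (cases "a = 0") (auto simp: onorm_pos_le[OF bounded_linear_uact])
qed

text \<open>If the algebra already has a unit, the operator norm alone is only a seminorm on the
  unitization; taking the maximum with the modulus of the scalar part repairs this.\<close>
instantiation uni :: (cstar_algebra) real_normed_algebra_1
begin
definition "norm (x::'a uni) = max (cmod (uscal x)) (onorm (uact x))"
definition "dist (x::'a uni) y = norm (x - y)"
definition "sgn (x::'a uni) = x /\<^sub>R norm x"
definition "(uniformity :: ('a uni \<times> 'a uni) filter) = (INF e\<in>{0 <..}. principal {(x, y). dist x y < e})"
definition "open (U :: 'a uni set) = (\<forall>x\<in>U. eventually (\<lambda>(x', y). x' = x \<longrightarrow> y \<in> U) uniformity)"

lemma cmod_scal_le: "cmod (uscal x) \<le> norm (x::'a uni)"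
  and onorm_uact_le: "onorm (uact x) \<le> norm (x::'a uni)"
  by (simp_all add: norm_uni_def)

instance
proof
  fix x y :: "'a uni" and r :: real
  show "dist x y = norm (x - y)" "sgn x = x /\<^sub>R norm x" by (simp_all add: dist_uni_def sgn_uni_def)
  show "(uniformity :: ('a uni \<times> 'a uni) filter) = (INF e\<in>{0 <..}. principal {(x, y). dist x y < e})"
    by (rule uniformity_uni_def)
  show "open U \<longleftrightarrow> (\<forall>x\<in>U. eventually (\<lambda>(x', y). x' = x \<longrightarrow> y \<in> U) uniformity)" for U :: "'a uni set"
    by (rule open_uni_def)
  show "(norm x = 0) = (x = 0)"
  proof
    assume "norm x = 0"
    then have s: "uscal x = 0" and o: "onorm (uact x) \<le> 0"
      by (simp_all add: norm_uni_def max_def split: if_splits)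
    have "uact x = uact (Uni (uvec x) 0)" using s by (simp add: uact_def fun_eq_iff)
    then have "uvec x = 0" using o onorm_uact_vec[of "uvec x"] by simp
    with s show "x = 0" by (simp add: uni_eqI)
  next
    assume "x = 0"
    then show "norm x = 0" using onorm_uact_vec[of "0::'a"] by (simp add: norm_uni_def zero_uni_def)
  qed
  show "norm (x + y) \<le> norm x + norm y"
    unfolding norm_uni_def[of "x + y"] uact_add
    using onorm_triangle[OF bounded_linear_uact bounded_linear_uact, of x y] norm_triangle_ineq[of "uscal x" "uscal y"]
      cmod_scal_le[of x] cmod_scal_le[of y] onorm_uact_le[of x] onorm_uact_le[of y]
    by (simp del: norm_triangle_ineq)
  show "norm (r *\<^sub>R x) = \<bar>r\<bar> * norm x"
    unfolding norm_uni_def uact_scaleR onorm_scaleR[OF bounded_linear_uact]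
    by (simp add: max_mult_distrib_left)
  show "norm (x * y) \<le> norm x * norm y"
    unfolding norm_uni_def[of "x * y"] uact_mult
  proof (rule max.boundedI)
    show "cmod (uscal (x * y)) \<le> norm x * norm y"
      using mult_mono[OF cmod_scal_le cmod_scal_le order_trans[OF norm_ge_zero cmod_scal_le] norm_ge_zero, of x y] by (simp add: norm_mult)
    have "onorm (uact x \<circ> uact y) \<le> onorm (uact x) * onorm (uact y)"
      by (intro onorm_compose bounded_linear_uact)
    also have "\<dots> \<le> norm x * norm y"
      by (intro mult_mono onorm_uact_le onorm_pos_le bounded_linear_uact order_trans[OF norm_ge_zero cmod_scal_le])
    finally show "onorm (uact x \<circ> uact y) \<le> norm x * norm y" .
  qed
  have "uact (1::'a uni) = (\<lambda>b. b)" by (simp add: uact_def fun_eq_iff)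
  then show "norm (1::'a uni) = 1" using onorm_id_le[where ?'a = 'a] by (simp add: norm_uni_def max_def)
qed
end

lemma norm_Uni_vec [simp]: "norm (Uni a 0) = norm (a::'a::cstar_algebra)"
  by (simp add: norm_uni_def onorm_uact_vec)

lemma norm_Uni_scal [simp]: "norm (Uni (0::'a::cstar_algebra) c) = cmod c"
proof -
  have "onorm (uact (Uni (0::'a) c)) \<le> cmod c" by (rule onorm_bound) (simp_all add: uact_def norm_cscale)
  then show ?thesis by (simp add: norm_uni_def max_def)
qed

lemma Uni_decomp: "x = Uni (uvec x) 0 + Uni (0::'a::cstar_algebra) (uscal x)"
  by (rule uni_eqI) simp_all

lemma norm_uni_le: "norm x \<le> norm (uvec x::'a::cstar_algebra) + cmod (uscal x)"
  using norm_triangle_ineq[of "Uni (uvec x) 0" "Uni (0::'a) (uscal x)"] Uni_decomp[of x] by simp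

text \<open>With \<open>norm_uni_le\<close> this compares the C*-norm with the metric used in the
  statement. The factor 2 returns in the final estimates.\<close>

lemma norm_vec_le: "norm (uvec x::'a::cstar_algebra) \<le> 2 * norm x"
proof -
  have "Uni (uvec x) 0 = x - Uni (0::'a) (uscal x)" by (rule uni_eqI) simp_all
  then have "norm (uvec x) \<le> norm x + cmod (uscal x)" by (metis norm_Uni_vec norm_Uni_scal norm_triangle_ineq4)
  then show ?thesis using cmod_scal_le[of x] by simp
qed

lemma bounded_linear_vec: "bounded_linear (uvec :: 'a::cstar_algebra uni \<Rightarrow> 'a)"
  by (rule bounded_linear_intro[where K = 2]) (simp, simp, metis norm_vec_le mult.commute)

lemma bounded_linear_scal: "bounded_linear (uscal :: 'a::cstar_algebra uni \<Rightarrow> complex)"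
  by (rule bounded_linear_intro[where K = 1]) (simp, simp, metis cmod_scal_le mult.right_neutral)

lemma bounded_linear_Uni: "bounded_linear (\<lambda>p. Uni (fst p :: 'a::cstar_algebra) (snd p))"
proof (rule bounded_linear_intro[where K = 2])
  fix p :: "'a \<times> complex"
  show "norm (Uni (fst p) (snd p)) \<le> norm p * 2"
    using norm_uni_le[of "Uni (fst p) (snd p)"] norm_fst_le[of "fst p" "snd p"] norm_snd_le[of "snd p" "fst p"] by simp
qed (simp_all add: plus_uni_def scaleR_uni_def)

lemma continuous_on_vec [continuous_intros]: "continuous_on S f \<Longrightarrow> continuous_on S (\<lambda>t. uvec (f t :: 'a::cstar_algebra uni))"
  by (rule bounded_linear.continuous_on[OF bounded_linear_vec])

lemma continuous_on_scal [continuous_intros]: "continuous_on S f \<Longrightarrow> continuous_on S (\<lambda>t. uscal (f t :: 'a::cstar_algebra uni))"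
  by (rule bounded_linear.continuous_on[OF bounded_linear_scal])

lemma continuous_on_Uni [continuous_intros]:
  "continuous_on S f \<Longrightarrow> continuous_on S g \<Longrightarrow> continuous_on S (\<lambda>t. Uni (f t :: 'a::cstar_algebra) (g t))"
  using bounded_linear.continuous_on[OF bounded_linear_Uni, of S "\<lambda>t. (f t, g t)"] by (simp add: continuous_on_Pair)

instance uni :: (cstar_algebra) banach
proof
  fix X :: "nat \<Rightarrow> 'a uni" assume "Cauchy X"
  then have "Cauchy (\<lambda>n. uvec (X n))" "Cauchy (\<lambda>n. uscal (X n))"
    by (metis bounded_linear.Cauchy bounded_linear_vec, metis bounded_linear.Cauchy bounded_linear_scal \<open>Cauchy X\<close>)
  then obtain a c where "(\<lambda>n. uvec (X n)) \<longlonglongrightarrow> a" "(\<lambda>n. uscal (X n)) \<longlonglongrightarrow> c"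
    using Cauchy_convergent unfolding convergent_def by metis
  then have "(\<lambda>n. Uni (uvec (X n)) (uscal (X n))) \<longlonglongrightarrow> Uni a c"
    using bounded_linear.tendsto[OF bounded_linear_Uni, of "\<lambda>n. (uvec (X n), uscal (X n))" "(a, c)"]
    by (simp add: tendsto_Pair)
  then show "convergent X" by (auto simp: convergent_def)
qed

instantiation uni :: (cstar_algebra) cstar_algebra_1
begin
definition "cscale c x = Uni (cscale c (uvec x) :: 'a) (c * uscal x)"
definition "cstar x = Uni (cstar (uvec x) :: 'a) (cnj (uscal x))"

lemma uni_sel_cstar [simp]:
  "uvec (cscale c (x::'a uni)) = cscale c (uvec x)" "uscal (cscale c (x::'a uni)) = c * uscal x"
  "uvec (cstar (x::'a uni)) = cstar (uvec x)" "uscal (cstar (x::'a uni)) = cnj (uscal x)"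
  by (simp_all add: cscale_uni_def cstar_uni_def)

lemma onorm_cscale_uact: "onorm (\<lambda>b. cscale c (uact (x::'a uni) b)) = cmod c * onorm (uact x)"
proof (rule antisym)
  have le: "onorm (\<lambda>b. cscale c (uact x b)) \<le> cmod c * onorm (uact x)" for c and x :: "'a uni"
    by (rule onorm_bound) (simp_all add: norm_cscale mult.assoc mult_left_mono onorm[OF bounded_linear_uact] onorm_pos_le[OF bounded_linear_uact])
  show "onorm (\<lambda>b. cscale c (uact x b)) \<le> cmod c * onorm (uact x)" by (rule le)
  have b: "bounded_linear (\<lambda>b. cscale c (uact x b))"
    by (rule bounded_linear_compose[OF bounded_linear_cscale bounded_linear_uact])
  show "cmod c * onorm (uact x) \<le> onorm (\<lambda>b. cscale c (uact x b))"
  proof (cases "c = 0")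
    case False
    have "onorm (uact x) \<le> onorm (\<lambda>b. cscale c (uact x b)) / cmod c"
    proof (rule onorm_bound)
      fix b
      have "cmod c * norm (uact x b) \<le> onorm (\<lambda>b. cscale c (uact x b)) * norm b"
        using onorm[OF b, of b] by (simp add: norm_cscale)
      then show "norm (uact x b) \<le> onorm (\<lambda>b. cscale c (uact x b)) / cmod c * norm b"
        using False by (simp add: field_simps)
    qed (simp add: onorm_pos_le[OF b])
    then show ?thesis using False by (simp add: field_simps)
  qed (use onorm_pos_le[OF b] in simp)
qed

text \<open>The C*-identity of A turns the square of norm (x b) into the norm of
  \<open>cstar b * uact (cstar x * x) b\<close>.\<close>

lemma uact_cstar_mult: "onorm (uact (x::'a uni)) * onorm (uact x) \<le> onorm (uact (cstar x * x))"
proof -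
  let ?k = "onorm (uact (cstar x * x))"
  have k: "?k \<ge> 0" by (rule onorm_pos_le[OF bounded_linear_uact])
  have "onorm (uact x) \<le> sqrt ?k"
  proof (rule onorm_bound)
    fix b
    have adj: "cstar (uact x b) * c = cstar b * uact (cstar x) c" for c
      by (simp add: uact_def cstar_add cstar_mult cstar_cscale cscale_mult_left cscale_mult_right algebra_simps)
    have "(norm (uact x b))\<^sup>2 = norm (cstar b * uact (cstar x * x) b)"
      by (simp add: cstar_identity[symmetric] adj uact_mult)
    also have "\<dots> \<le> norm b * (?k * norm b)"
      by (rule order_trans[OF norm_mult_ineq]) (auto intro: mult_left_mono onorm[OF bounded_linear_uact])
    also have "\<dots> = (sqrt ?k * norm b)\<^sup>2" using k by (simp add: power_mult_distrib power2_eq_square mult_ac)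
    finally show "norm (uact x b) \<le> sqrt ?k * norm b" by (rule power2_le_imp_le) (use k in simp)
  qed (use k in simp)
  then show ?thesis
    using mult_mono[of "onorm (uact x)" "sqrt ?k" "onorm (uact x)" "sqrt ?k"] k onorm_pos_le[OF bounded_linear_uact, of x] by simp
qed

instance
proof
  fix a b :: complex and x y :: "'a uni" and r :: real
  show "cscale (complex_of_real r) x = r *\<^sub>R x"
    "cscale a (cscale b x) = cscale (a * b) x" "cscale (a + b) x = cscale a x + cscale b x"
    "cscale a (x + y) = cscale a x + cscale a y" "cscale a x * y = cscale a (x * y)"
    "x * cscale a y = cscale a (x * y)" "cstar (cstar x) = x" "cstar (x + y) = cstar x + cstar y"
    "cstar (cscale a x) = cscale (cnj a) (cstar x)" "cstar (x * y) = cstar y * cstar x"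
    by ((rule uni_eqI; simp add: cscale_of_real cscale_assoc cscale_add_left cscale_add_right cscale_mult_left
        cscale_mult_right cstar_cstar cstar_add cstar_cscale cstar_mult algebra_simps scaleR_conv_of_real[where ?'a = complex])+)
  have "uact (cscale a x) = (\<lambda>b. cscale a (uact x b))"
    by (simp add: uact_def fun_eq_iff cscale_add_right cscale_mult_left cscale_assoc)
  then show "norm (cscale a x) = cmod a * norm x"
    by (simp add: norm_uni_def onorm_cscale_uact norm_mult max_mult_distrib_left)
  \<comment> \<open>Either term of the maximum may attain the norm of z, and each satisfies the
    inequality. Used for z and \<open>cstar z\<close> it also shows that \<open>cstar\<close> is
    isometric, whence the converse inequality.\<close>
  have ge: "norm z * norm z \<le> norm (cstar z * z)" for z :: "'a uni"
  proof -
    have "norm z = cmod (uscal z) \<or> norm z = onorm (uact z)" by (auto simp: norm_uni_def max_def)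
    moreover have "cmod (uscal z) * cmod (uscal z) = cmod (uscal (cstar z * z))" by (simp add: norm_mult)
    ultimately show ?thesis using cmod_scal_le[of "cstar z * z"] onorm_uact_le[of "cstar z * z"] uact_cstar_mult[of z] by auto
  qed
  have cc: "cstar (cstar z) = z" for z :: "'a uni" by (rule uni_eqI) (simp_all add: cstar_cstar)
  have le: "norm z \<le> norm (cstar z)" for z :: "'a uni"
  proof (cases "z = 0")
    case False
    have "norm z * norm z \<le> norm (cstar z) * norm z"
      using ge[of z] norm_mult_ineq[of "cstar z" z] by linarith
    then show ?thesis using False by simp
  qed simp
  have "norm (cstar x) = norm x" using le[of x] le[of "cstar x"] cc by simp
  then show "norm (cstar x * x) = (norm x)\<^sup>2"
    using ge[of x] norm_mult_ineq[of "cstar x" x] by (simp add: power2_eq_square)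
qed
end

section \<open>Components of the group of invertible elements\<close>

lemma path_componentI:
  fixes g :: "real \<Rightarrow> 'a::topological_space"
  assumes "continuous_on {0..1} g" "\<And>t. 0 \<le> t \<Longrightarrow> t \<le> 1 \<Longrightarrow> g t \<in> S"
  shows "path_component S (g 0) (g 1)"
  unfolding path_component_def
  by (rule exI[of _ g]) (use assms in \<open>auto simp: path_def path_image_def pathstart_def pathfinish_def\<close>)

lemma path_componentE:
  assumes "path_component S x y"
  obtains g :: "real \<Rightarrow> 'a::topological_space" where "continuous_on {0..1} g" "\<And>t. 0 \<le> t \<Longrightarrow> t \<le> 1 \<Longrightarrow> g t \<in> S" "g 0 = x" "g 1 = y"
  using assms unfolding path_component_def path_def path_image_def pathstart_def pathfinish_def
  by (auto simp: image_subset_iff)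

definition unitary :: "'u::cstar_algebra_1 \<Rightarrow> bool" where
  "unitary u \<longleftrightarrow> cstar u * u = 1 \<and> u * cstar u = 1"

lemma unitary_invs: "unitary u \<Longrightarrow> u \<in> invs"
  and unitary_uinv: "unitary u \<Longrightarrow> uinv u = cstar u"
  by (auto simp: unitary_def intro: invsI uinv_unique)

lemma norm_unitary: "unitary u \<Longrightarrow> norm u = 1"
proof -
  assume "unitary u"
  then have "norm u * norm u = 1" using norm_cstar_mult[of u] by (simp add: unitary_def)
  then have "sqrt (norm u * norm u) = 1" by simp
  then show ?thesis by simp
qed

lemma unitary_cstar: "unitary u \<Longrightarrow> unitary (cstar u)"
  by (simp add: unitary_def cstar_cstar)

lemma unitary_mult: "unitary u \<Longrightarrow> unitary v \<Longrightarrow> unitary (u * v)"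
  unfolding unitary_def
  by (simp add: cstar_mult mult.assoc) (metis mult.assoc mult.right_neutral mult.left_neutral)

lemma cstar_invs: "(x::'u::cstar_algebra_1) \<in> invs \<Longrightarrow> cstar x \<in> invs"
  and uinv_cstar: "(x::'u::cstar_algebra_1) \<in> invs \<Longrightarrow> uinv (cstar x) = cstar (uinv x)"
proof -
  assume x: "x \<in> invs"
  then have "cstar x * cstar (uinv x) = 1" "cstar (uinv x) * cstar x = 1"
    by (simp_all flip: cstar_mult)
  then show "cstar x \<in> invs" "uinv (cstar x) = cstar (uinv x)" by (auto intro: invsI uinv_unique)
qed

lemma invs_square: "h * h \<in> invs \<Longrightarrow> h \<in> invs"
proof -
  assume i: "h * h \<in> invs"
  have 1: "h * (h * uinv (h * h)) = 1" "uinv (h * h) * h * h = 1"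
    using uinv_right[OF i] uinv_left[OF i] by (simp_all only: mult.assoc)
  have "uinv (h * h) * h = (uinv (h * h) * h) * (h * (h * uinv (h * h)))" by (simp only: 1 mult_1_right)
  also have "\<dots> = (uinv (h * h) * h * h) * (h * uinv (h * h))" by (simp only: mult.assoc)
  finally have "uinv (h * h) * h = h * uinv (h * h)" by (simp only: 1 mult_1_left)
  with 1 show ?thesis by (intro invsI[of h "h * uinv (h * h)"]) simp_all
qed

section \<open>Closed star-subalgebras and homotopy of their invertible elements\<close>

text \<open>Closure under inverses is an assumption because it has a direct proof in the case of
  interest, the unitization of a hereditary subalgebra. The other instance is the whole
  algebra.\<close>

locale ustar_sub =
  fixes R :: "'u::cstar_algebra_1 set"
  assumes closed_R: "closed R" and one_R [simp]: "1 \<in> R"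
    and add_R [simp]: "\<And>x y. x \<in> R \<Longrightarrow> y \<in> R \<Longrightarrow> x + y \<in> R"
    and mult_R [simp]: "\<And>x y. x \<in> R \<Longrightarrow> y \<in> R \<Longrightarrow> x * y \<in> R"
    and cscale_R [simp]: "\<And>c x. x \<in> R \<Longrightarrow> cscale c x \<in> R"
    and cstar_R [simp]: "\<And>x. x \<in> R \<Longrightarrow> cstar x \<in> R"
    and uinv_R [simp]: "\<And>x. x \<in> R \<Longrightarrow> x \<in> invs \<Longrightarrow> uinv x \<in> R"
begin

lemma scaleR_R [simp]: "x \<in> R \<Longrightarrow> r *\<^sub>R x \<in> R"
  using cscale_R[of x "complex_of_real r"] by (simp add: cscale_of_real)

lemma uminus_R [simp]: "x \<in> R \<Longrightarrow> - x \<in> R"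
  using scaleR_R[of x "-1"] by simp

lemma diff_R [simp]: "x \<in> R \<Longrightarrow> y \<in> R \<Longrightarrow> x - y \<in> R"
  using add_R[of x "- y"] by simp

lemma zero_R [simp]: "0 \<in> R"
  using scaleR_R[of 1 0] by simp

lemma of_real_R [simp]: "of_real r \<in> R"
  by (simp add: of_real_def)

lemma sum_R [simp]: "(\<And>i. i \<in> I \<Longrightarrow> f i \<in> R) \<Longrightarrow> sum f I \<in> R"
  by (induction I rule: infinite_finite_induct) auto

lemma csq_R:
  assumes "a \<in> R" "norm (of_real c - a) \<le> c" "c > 0"
  shows "csq c a \<in> R"
  unfolding csq_def
  by (intro scaleR_R sqrt1m_closed[OF norm_one_minus_divide[OF assms(2,3)] closed_R]) (use assms in auto)

definition GL :: "'u set" where "GL = R \<inter> invs"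

abbreviation conn :: "'u \<Rightarrow> 'u \<Rightarrow> bool" where "conn \<equiv> path_component GL"

lemma GLI: "x \<in> R \<Longrightarrow> x \<in> invs \<Longrightarrow> x \<in> GL"
  by (simp add: GL_def)

lemma GL_one [simp]: "1 \<in> GL" by (simp add: GL_def)

lemma GL_mult [simp]: "x \<in> GL \<Longrightarrow> y \<in> GL \<Longrightarrow> x * y \<in> GL"
  by (simp add: GL_def invs_mult)

lemma GL_uinv [simp]: "x \<in> GL \<Longrightarrow> uinv x \<in> GL"
  by (simp add: GL_def)

lemma GL_R [simp]: "x \<in> GL \<Longrightarrow> x \<in> R" and GL_invs [simp]: "x \<in> GL \<Longrightarrow> x \<in> invs"
  by (simp_all add: GL_def)

lemma conn_refl: "x \<in> GL \<Longrightarrow> conn x x"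
  by (rule path_component_refl)

lemma conn_mult:
  assumes "conn x x'" "conn y y'"
  shows "conn (x * y) (x' * y')"
proof -
  obtain g :: "real \<Rightarrow> _" where g: "continuous_on {0..1} g" "\<And>t. 0 \<le> t \<Longrightarrow> t \<le> 1 \<Longrightarrow> g t \<in> GL" "g 0 = x" "g 1 = x'"
    by (rule path_componentE[OF assms(1)]) blast
  obtain h :: "real \<Rightarrow> _" where h: "continuous_on {0..1} h" "\<And>t. 0 \<le> t \<Longrightarrow> t \<le> 1 \<Longrightarrow> h t \<in> GL" "h 0 = y" "h 1 = y'"
    by (rule path_componentE[OF assms(2)]) blast
  show ?thesis
    using path_componentI[of "\<lambda>t. g t * h t" GL] g h by (simp add: continuous_on_mult)
qed

lemma conn_mult_left: "z \<in> GL \<Longrightarrow> conn x y \<Longrightarrow> conn (z * x) (z * y)"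
  by (simp add: conn_mult conn_refl)

lemma conn_mult_right: "z \<in> GL \<Longrightarrow> conn x y \<Longrightarrow> conn (x * z) (y * z)"
  by (simp add: conn_mult conn_refl)

lemma conn_near:
  assumes "x \<in> GL" "y \<in> R" "norm (x - y) * norm (uinv x) < 1"
  shows "conn x y"
proof -
  let ?g = "\<lambda>t. (1 - t) *\<^sub>R x + t *\<^sub>R y"
  have "?g t \<in> GL" if "0 \<le> t" "t \<le> 1" for t
  proof (rule GLI)
    show "?g t \<in> invs"
    proof (rule perturb_invs(1)[of x])
      have "x - ?g t = t *\<^sub>R (x - y)" by (simp add: algebra_simps)
      then have "norm (x - ?g t) \<le> norm (x - y)" using that by (simp add: mult_left_le_one_le)
      then show "norm (x - ?g t) * norm (uinv x) < 1"
        using assms(3) mult_right_mono[of "norm (x - ?g t)" "norm (x - y)" "norm (uinv x)"] by simp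
    qed (use assms in simp)
  qed (use assms in simp)
  then have "path_component GL (?g 0) (?g 1)"
    by (intro path_componentI continuous_intros) auto
  then show ?thesis by simp
qed

text \<open>Positive invertible elements are those bounded below by a positive scalar, and this is a
  convex condition.\<close>

lemma conn_convex_pos:
  assumes "cpos h" "h \<in> GL" "cpos k" "k \<in> GL" "0 \<le> t" "t \<le> 1"
  shows "(1 - t) *\<^sub>R h + t *\<^sub>R k \<in> GL"
proof (rule GLI)
  obtain e where e: "e > 0" "cpos (h - of_real e)" using cpos_invs_bounded_below assms by (metis GL_invs)
  obtain d where d: "d > 0" "cpos (k - of_real d)" using cpos_invs_bounded_below assms by (metis GL_invs)
  show "(1 - t) *\<^sub>R h + t *\<^sub>R k \<in> invs"
  proof (rule bounded_below_invs)
    show "(1 - t) * e + t * d > 0"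
      using assms(5,6) e(1) d(1) by (cases "t = 0") (auto intro: add_nonneg_pos)
    have "cpos ((1 - t) *\<^sub>R (h - of_real e) + t *\<^sub>R (k - of_real d))"
      using assms e d by (intro cpos_add cpos_scaleR) auto
    then show "cpos ((1 - t) *\<^sub>R h + t *\<^sub>R k - of_real ((1 - t) * e + t * d))"
      by (simp add: of_real_def algebra_simps)
  qed
qed (use assms in simp)

lemma conn_pos_one:
  assumes "cpos h" "h \<in> GL" shows "conn h 1"
proof -
  let ?g = "\<lambda>t. (1 - t) *\<^sub>R h + t *\<^sub>R 1"
  have "path_component GL (?g 0) (?g 1)"
    by (intro path_componentI continuous_intros conn_convex_pos assms) auto
  then show ?thesis by simp
qed

text \<open>Here h is |x|. A prescribed c makes |x| depend uniformly continuously on x as long as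
  the square of norm x is at most c.\<close>

lemma polar:
  assumes "x \<in> GL" "norm x * norm x \<le> c" "c > 0"
  defines "h \<equiv> csq c (cstar x * x)"
  shows "h * h = cstar x * x" "cpos h" "h \<in> GL" "unitary (x * uinv h)"
proof -
  have a: "norm (of_real c - cstar x * x) \<le> c"
    by (rule cpos_norm[OF cpos_cstar_mult]) (use assms in \<open>simp add: norm_cstar_mult\<close>)
  have sa: "cstar (cstar x * x) = cstar x * x" by (simp add: cstar_mult cstar_cstar)
  show hh: "h * h = cstar x * x" unfolding h_def by (rule csq_square[OF a assms(3)])
  show h: "cpos h" unfolding h_def by (rule cpos_csq[OF a assms(3) sa])
  have i: "h \<in> invs" by (rule invs_square) (simp only: hh invs_mult cstar_invs GL_invs[OF assms(1)])
  show "h \<in> GL" by (rule GLI[OF _ i]) (use assms a in \<open>simp add: h_def csq_R\<close>)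
  have "cstar (uinv h) = uinv h" using uinv_cstar[OF i] cpos_sa[OF h] by simp
  then have "cstar (x * uinv h) * (x * uinv h) = uinv h * (cstar x * x) * uinv h"
    by (simp add: cstar_mult mult.assoc)
  also have "\<dots> = 1" using i by (simp add: mult.assoc flip: hh)
  finally have 1: "cstar (x * uinv h) * (x * uinv h) = 1" .
  have "x * uinv h \<in> invs" using assms i by (simp add: invs_mult)
  then have "cstar (x * uinv h) = uinv (x * uinv h)"
    using 1 by (metis mult.assoc mult.right_neutral mult.left_neutral uinv_right)
  then show "unitary (x * uinv h)" unfolding unitary_def using 1 \<open>x * uinv h \<in> invs\<close> by simp
qed

lemma conn_unitary:
  assumes "x \<in> GL"
  obtains u where "u \<in> GL" "unitary u" "conn x u"
proof
  define c where "c = norm x * norm x + 1"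
  note p = polar[OF assms, of c]
  define h where "h = csq c (cstar x * x)"
  have c: "norm x * norm x \<le> c" "c > 0" by (simp_all add: c_def add_nonneg_pos)
  have h: "cpos h" "h \<in> GL" "unitary (x * uinv h)" using p c by (simp_all add: h_def)
  show "x * uinv h \<in> GL" "unitary (x * uinv h)" using h assms by simp_all
  have "conn (x * uinv h * h) (x * uinv h * 1)"
    using h assms by (intro conn_mult_left conn_pos_one) auto
  then show "conn x (x * uinv h)" using h by (simp add: mult.assoc)
qed

text \<open>Behind it is d b^-1 (b + d) = (b + d) b^-1 d: both sides expand to d + d b^-1 d.\<close>

lemma pivot_identity:
  assumes "b \<in> invs" "d * (uinv b * (b + d)) = e" shows "(b + d) * (uinv b * d) = e"
  using assms by (simp add: algebra_simps)

end

locale ustar_sub_dense = ustar_sub +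
  assumes dense_GL: "\<And>x e. x \<in> R \<Longrightarrow> e > 0 \<Longrightarrow> \<exists>y\<in>GL. norm (x - y) < e"
begin

text \<open>If b, d and g = b + d are invertible, then d b^{-1} g = g b^{-1} d. For suitable scalars l, m with
  l + m = 3/2, the pairs b = u + l, d = v + m represent (u, 1), (1, v) and (u, v) in the group of
  components, with one and the same g. The three resulting relations show that u and v commute there.\<close>
lemma conn_commute_unitary:
  assumes "u \<in> R" "v \<in> R" "unitary u" "unitary v"
  shows "conn (u * v) (v * u)"
proof -
  have uv: "u \<in> GL" "v \<in> GL" using assms by (auto intro: GLI unitary_invs)
  have "u + v + of_real (3/2) \<in> R" using assms by simp
  \<comment> \<open>Replacing v by the nearby q = g - u - 3/2 makes u + q + 3/2 exactly the
    invertible g. The shift 3/2 exceeds the norms of u and q, the latter below 9/8, and so leads to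
    the component of 1; half of it does not leave the component, as 3/4 + 1/8 < 1.\<close>
  then obtain g where g: "g \<in> GL" "norm (u + v + of_real (3/2) - g) < 1/8"
    using dense_GL[of _ "1/8"] by force
  define q where "q = g - u - of_real (3/2)"
  have q: "q \<in> R" "norm (v - q) < 1/8" using g assms by (simp_all add: q_def algebra_simps)
  have nu: "norm u = 1" "norm v = 1" using norm_unitary assms by auto
  have near: "conn w z" if "z \<in> R" "norm (w - z) < 1" "unitary w" "w \<in> R" for w z
    using that by (intro conn_near GLI unitary_invs) (simp_all add: unitary_uinv norm_unitary)
  have far: "conn (w + of_real (3/2)) 1" if "w \<in> R" "norm w < 3/2" for w
  proof -
    have i: "of_real (3/2) \<in> GL" by (intro GLI of_real_R of_real_invs) simp
    have ui: "uinv (of_real (3/2)) = (of_real (2/3) :: 'a)"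
      by (rule uinv_unique) (simp_all only: of_real_mult[symmetric], simp_all)
    have "conn (of_real (3/2)) (w + of_real (3/2))"
      by (rule conn_near[OF i]) (use that in \<open>simp_all only: ui add_R of_real_R, simp_all only: norm_of_real, simp\<close>)
    moreover have "conn (of_real (3/2)) 1" using i by (intro conn_pos_one) simp_all
    ultimately show ?thesis by (meson path_component_sym path_component_trans)
  qed
  have nq: "norm q < 3/2" using q(2) nu norm_triangle_ineq3[of v q] by linarith
  have n34: "norm (of_real (3/4) :: 'a) = 3/4" by (simp only: norm_of_real)
  have c1: "conn (q + of_real (3/2)) 1" by (rule far[OF q(1) nq])
  have c2: "conn (u + of_real (3/2)) 1" by (rule far) (use assms nu in simp_all)
  have c3: "conn v q" by (rule near) (use q assms in simp_all)
  have c4: "conn u (u + of_real (3/4))" by (rule near) (use assms n34 in simp_all)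
  have "norm (v - (q + of_real (3/4))) < 1"
    using norm_triangle_ineq4[of "v - q" "of_real (3/4)"] q(2) n34 by (simp add: algebra_simps)
  then have c5: "conn v (q + of_real (3/4))" by (intro near) (use q assms in simp_all)
  have cq: "conn q (q + of_real (3/4))" using c3 c5 path_component_sym path_component_trans by metis
  have mem: "q \<in> GL" "q + of_real (3/2) \<in> GL" "u + of_real (3/2) \<in> GL" "u + of_real (3/4) \<in> GL" "q + of_real (3/4) \<in> GL"
    using c1 c2 c3 c4 c5 path_component_mem by blast+
  \<comment> \<open>Applied to the pairs (u, q + 3/2), (u + 3/2, q) and (u + 3/4, q + 3/4), each
    with sum g.\<close>
  have key: "d * (uinv b * g) = g * (uinv b * d)" if "b \<in> invs" "b + d = g" for b d
    using pivot_identity[OF that(1) refl, of d] that(2) by simp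
  have cinv: "conn (uinv x) (uinv y)" if "conn x y" for x y
  proof -
    have m: "x \<in> GL" "y \<in> GL" using path_component_mem[OF that] .
    have "conn (uinv x * x * uinv y) (uinv x * y * uinv y)"
      using m that by (intro conn_mult_left conn_mult_right) auto
    then show ?thesis using m by (simp add: mult.assoc path_component_sym)
  qed
  let ?u = "uinv u"
  have r1: "conn (?u * g) (g * ?u)"
  proof -
    have "(q + of_real (3/2)) * (?u * g) = g * (?u * (q + of_real (3/2)))"
      by (rule key) (use uv in \<open>simp_all add: q_def\<close>)
    moreover have "conn ((q + of_real (3/2)) * (?u * g)) (1 * (?u * g))"
      using uv g by (intro conn_mult_right c1) auto
    moreover have "conn (g * (?u * (q + of_real (3/2)))) (g * (?u * 1))"
      using uv g by (intro conn_mult_left c1) auto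
    ultimately show ?thesis by (simp del: of_real_divide) (meson path_component_sym path_component_trans)
  qed
  have r2: "conn (q * g) (g * q)"
  proof -
    let ?b = "uinv (u + of_real (3/2))"
    have "q * (?b * g) = g * (?b * q)" by (rule key) (use mem in \<open>simp_all add: q_def\<close>)
    moreover have b: "conn ?b 1" using cinv[OF c2] by simp
    have "conn (q * (?b * g)) (q * (1 * g))" "conn (g * (?b * q)) (g * (1 * q))"
      using b mem g by (intro conn_mult_left conn_mult_right; simp)+
    ultimately show ?thesis by (simp del: of_real_divide) (meson path_component_sym path_component_trans)
  qed
  have "of_real (3/4) + of_real (3/4) = (of_real (3/2) :: 'a)" by (simp only: of_real_add[symmetric]) simp
  then have q34: "u + of_real (3/4) + (q + of_real (3/4)) = g" by (simp add: q_def algebra_simps del: of_real_divide)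
  have r3: "conn (q * (?u * g)) (g * (?u * q))"
  proof -
    let ?b = "uinv (u + of_real (3/4))" and ?d = "q + of_real (3/4)"
    have "?d * (?b * g) = g * (?b * ?d)" by (rule key[OF GL_invs[OF mem(4)] q34])
    moreover have b: "conn ?u ?b" by (rule cinv[OF c4])
    have "conn (q * (?u * g)) (?d * (?b * g))" "conn (g * (?u * q)) (g * (?b * ?d))"
      using b cq g by (intro conn_mult conn_refl; simp)+
    ultimately show ?thesis by (simp del: of_real_divide) (meson path_component_sym path_component_trans)
  qed
  \<comment> \<open>Together the relations give q u^-1 g ~ g u^-1 q ~ u^-1 g q ~ u^-1 q g;
    cancelling g and multiplying by u on both sides leaves u q ~ q u.\<close>
  have "conn (g * (?u * q)) (?u * (g * q))"
    using conn_mult_right[OF mem(1) path_component_sym[OF r1]] by (simp add: mult.assoc)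
  moreover have "conn (?u * (g * q)) (?u * (q * g))"
    using uv by (intro conn_mult_left path_component_sym[OF r2]) simp
  ultimately have "conn (q * (?u * g)) (?u * (q * g))" using r3 path_component_trans by metis
  then have "conn (u * (q * (?u * g) * (uinv g * u))) (u * (?u * (q * g) * (uinv g * u)))"
    using uv g by (intro conn_mult_left conn_mult_right) auto
  then have "conn (u * q) (q * u)" using uv g by (simp add: mult.assoc)
  moreover have "conn (u * v) (u * q)" "conn (v * u) (q * u)" using uv c3 by (auto intro: conn_mult_left conn_mult_right)
  ultimately show ?thesis by (meson path_component_sym path_component_trans)
qed

lemma conn_commute:
  assumes "x \<in> GL" "y \<in> GL" shows "conn (x * y) (y * x)"
proof -
  obtain u where u: "u \<in> GL" "unitary u" "conn x u" using conn_unitary[OF assms(1)] .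
  obtain v where v: "v \<in> GL" "unitary v" "conn y v" using conn_unitary[OF assms(2)] .
  have "conn (x * y) (u * v)" "conn (y * x) (v * u)" using u v by (auto intro: conn_mult)
  moreover have "conn (u * v) (v * u)" using u v by (auto intro: conn_commute_unitary)
  ultimately show ?thesis by (meson path_component_sym path_component_trans)
qed

text \<open>For invertible x the two elements are conjugate by x, and conjugation preserves
  components since these commute. Density reduces the general case to this one.\<close>

lemma conn_swap:
  assumes "x \<in> R" "y \<in> R" "1 - x * y \<in> invs"
  shows "conn (1 - x * y) (1 - y * x)"
proof -
  have i2: "1 - y * x \<in> invs" using jacobson_invs[of "- x" y] assms(3) by simp
  define K where "K = norm y * (norm (uinv (1 - x * y)) + norm (uinv (1 - y * x))) + 1"
  have K: "K > 0" unfolding K_def by (intro add_nonneg_pos mult_nonneg_nonneg add_nonneg_nonneg) auto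
  obtain x' where x': "x' \<in> GL" "norm (x - x') < 1 / K" using dense_GL[OF assms(1), of "1 / K"] K by auto
  have small: "norm (x - x') * norm y * a < 1" if "0 \<le> a" "norm y * a \<le> K" for a
  proof -
    have "norm (x - x') * norm y * a \<le> norm (x - x') * K"
      using that by (simp add: mult.assoc mult_left_mono)
    also have "\<dots> < 1" using x'(2) K by (simp add: field_simps)
    finally show ?thesis .
  qed
  have "conn (1 - x * y) (1 - x' * y)"
  proof (rule conn_near)
    have "(1 - x * y) - (1 - x' * y) = - ((x - x') * y)" by (simp add: algebra_simps)
    then have "norm ((1 - x * y) - (1 - x' * y)) \<le> norm (x - x') * norm y" by (simp add: norm_mult_ineq)
    then have "norm ((1 - x * y) - (1 - x' * y)) * norm (uinv (1 - x * y)) \<le> norm (x - x') * norm y * norm (uinv (1 - x * y))"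
      by (rule mult_right_mono) simp
    also have "\<dots> < 1" by (rule small) (auto simp: K_def distrib_left)
    finally show "norm ((1 - x * y) - (1 - x' * y)) * norm (uinv (1 - x * y)) < 1" .
  qed (rule GLI, use assms x' in simp_all)
  moreover have "conn (1 - y * x) (1 - y * x')"
  proof (rule conn_near)
    have "(1 - y * x) - (1 - y * x') = - (y * (x - x'))" by (simp add: algebra_simps)
    then have "norm ((1 - y * x) - (1 - y * x')) \<le> norm (x - x') * norm y" 
      using norm_mult_ineq[of y "x - x'"] by (simp only: norm_minus_cancel mult.commute[of "norm y"])
    then have "norm ((1 - y * x) - (1 - y * x')) * norm (uinv (1 - y * x)) \<le> norm (x - x') * norm y * norm (uinv (1 - y * x))"
      by (rule mult_right_mono) simp
    also have "\<dots> < 1" by (rule small) (auto simp: K_def distrib_left)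
    finally show "norm ((1 - y * x) - (1 - y * x')) * norm (uinv (1 - y * x)) < 1" .
  qed (rule GLI, use assms i2 x' in simp_all)
  moreover have "conn (1 - x' * y) (1 - y * x')"
  proof -
    have z: "1 - y * x' \<in> GL" using calculation(2) path_component_mem by metis
    have "conn (x' * (1 - y * x') * uinv x') ((1 - y * x') * x' * uinv x')"
      using x' z by (intro conn_mult_right conn_commute) auto
    moreover have "x' * (1 - y * x') * uinv x' = 1 - x' * y" using x' by (simp add: algebra_simps)
    moreover have "(1 - y * x') * x' * uinv x' = 1 - y * x'" using x' by (simp add: mult.assoc)
    ultimately show ?thesis by simp
  qed
  ultimately show ?thesis by (meson path_component_sym path_component_trans)
qed

end

section \<open>Invertible matrices\<close>

type_synonym 'u imat = "nat \<Rightarrow> nat \<Rightarrow> 'u"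

definition mone :: "'u::ring_1 imat" where
  "mone i j = (if i = j then 1 else 0)"

text \<open>An n by n matrix is extended by the identity matrix, so that the inclusion of the n by n
  invertible matrices into those of size n + 1 is an inclusion of sets.\<close>
definition mmul :: "nat \<Rightarrow> 'u::ring_1 imat \<Rightarrow> 'u imat \<Rightarrow> 'u imat" where
  "mmul n M N = (\<lambda>i j. if i < n \<and> j < n then \<Sum>l<n. M i l * N l j else mone i j)"

definition std_mat :: "nat \<Rightarrow> 'u::ring_1 imat \<Rightarrow> bool" where
  "std_mat n M \<longleftrightarrow> (\<forall>i j. \<not> (i < n \<and> j < n) \<longrightarrow> M i j = mone i j)"

lemma std_mat_mmul [simp]: "std_mat n (mmul n M N)"
  by (simp add: std_mat_def mmul_def)

lemma std_mat_mone [simp]: "std_mat n mone"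
  by (simp add: std_mat_def)

lemma std_matI_eq:
  assumes "std_mat n M" "std_mat n N" "\<And>i j. i < n \<Longrightarrow> j < n \<Longrightarrow> M i j = N i j"
  shows "M = N"
  using assms unfolding std_mat_def by (intro ext) metis

lemma mmul_assoc: "mmul n (mmul n A B) C = mmul n A (mmul n B C)"
proof (rule std_matI_eq)
  fix i j assume "i < n" "j < n"
  then have "mmul n (mmul n A B) C i j = (\<Sum>l<n. \<Sum>k<n. A i k * B k l * C l j)"
    by (simp add: mmul_def sum_distrib_right)
  also have "\<dots> = (\<Sum>k<n. \<Sum>l<n. A i k * B k l * C l j)" by (rule sum.swap)
  also have "\<dots> = mmul n A (mmul n B C) i j"
    using \<open>i < n\<close> \<open>j < n\<close> by (simp add: mmul_def sum_distrib_left mult.assoc)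
  finally show "mmul n (mmul n A B) C i j = mmul n A (mmul n B C) i j" .
qed simp_all

lemma mmul_mone_left: "std_mat n M \<Longrightarrow> mmul n mone M = M"
proof (rule std_matI_eq)
  fix i j assume "i < n" "j < n"
  then show "mmul n mone M i j = M i j"
    by (simp add: mmul_def mone_def if_distrib[of "\<lambda>z. z * _"] cong: if_cong)
qed simp_all

lemma mmul_mone_right: "std_mat n M \<Longrightarrow> mmul n M mone = M"
proof (rule std_matI_eq)
  fix i j assume "i < n" "j < n"
  then show "mmul n M mone i j = M i j"
    by (simp add: mmul_def mone_def if_distrib[of "\<lambda>z. _ * z"] cong: if_cong)
qed simp_all

section \<open>Rank-one perturbations of the identity and Schur complements\<close>

text \<open>The identity minus column x times row y. As in Jacobson's trick, its invertibility is
  governed by the single element 1 - yx, where yx is the sum of the products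
  \<open>y l * x l\<close>.\<close>

definition rank1 :: "nat \<Rightarrow> (nat \<Rightarrow> 'u::ring_1) \<Rightarrow> (nat \<Rightarrow> 'u) \<Rightarrow> 'u imat" where
  "rank1 n x y = (\<lambda>i j. if i < n \<and> j < n then mone i j - x i * y j else mone i j)"

lemma std_mat_rank1 [simp]: "std_mat n (rank1 n x y)"
  by (simp add: std_mat_def rank1_def)

lemma mmul_rank1_left:
  assumes "i < n" "j < n"
  shows "mmul n (rank1 n x y) M i j = M i j - x i * (\<Sum>l<n. y l * M l j)"
proof -
  have "(\<Sum>l<n. mone i l * M l j) = M i j"
    using assms by (simp add: mone_def if_distrib[of "\<lambda>z. z * _"] cong: if_cong)
  moreover have "mmul n (rank1 n x y) M i j = (\<Sum>l<n. mone i l * M l j) - (\<Sum>l<n. x i * y l * M l j)"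
    using assms by (simp add: mmul_def rank1_def left_diff_distrib sum_subtractf)
  ultimately show ?thesis by (simp add: sum_distrib_left mult.assoc)
qed

lemma mmul_rank1_right:
  assumes "i < n" "j < n"
  shows "mmul n M (rank1 n x y) i j = M i j - (\<Sum>l<n. M i l * x l) * y j"
proof -
  have "(\<Sum>l<n. M i l * mone l j) = M i j"
    using assms by (simp add: mone_def if_distrib[of "\<lambda>z. _ * z"] cong: if_cong)
  moreover have "mmul n M (rank1 n x y) i j = (\<Sum>l<n. M i l * mone l j) - (\<Sum>l<n. M i l * (x l * y j))"
    using assms by (simp add: mmul_def rank1_def right_diff_distrib sum_subtractf)
  ultimately show ?thesis by (simp add: sum_distrib_right mult.assoc)
qed

lemma rank1_mult:
  "mmul n (rank1 n x y) (rank1 n x' y) = rank1 n (\<lambda>i. x i + x' i - x i * (\<Sum>l<n. y l * x' l)) y"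
proof (rule std_matI_eq)
  fix i j assume ij: "i < n" "j < n"
  have "(\<Sum>l<n. y l * rank1 n x' y l j) = y j - (\<Sum>l<n. y l * x' l) * y j"
    using ij mmul_rank1_right[of i n j "\<lambda>_. y" x' y] by (simp add: mmul_def)
  then show "mmul n (rank1 n x y) (rank1 n x' y) i j = rank1 n (\<lambda>i. x i + x' i - x i * (\<Sum>l<n. y l * x' l)) y i j"
    using ij by (simp add: mmul_rank1_left) (simp add: rank1_def algebra_simps)
qed simp_all

text \<open>For a matrix of size n + 1 this is the last row after a row operation; s is chosen so
  that its last entry, the pivot, becomes invertible.\<close>

definition pivot_row :: "nat \<Rightarrow> (nat \<Rightarrow> 'u::ring_1) \<Rightarrow> 'u imat \<Rightarrow> nat \<Rightarrow> 'u" where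
  "pivot_row n s M j = M n j + (\<Sum>i<n. s i * M i j)"

definition schur :: "nat \<Rightarrow> (nat \<Rightarrow> 'u::ring_1) \<Rightarrow> 'u imat \<Rightarrow> 'u imat" where
  "schur n s M = (\<lambda>i j. if i < n \<and> j < n then M i j - M i n * uinv (pivot_row n s M n) * pivot_row n s M j else mone i j)"

lemma std_mat_schur [simp]: "std_mat n (schur n s M)"
  by (simp add: std_mat_def schur_def)

text \<open>If E is the row operation given by s, the inverse of E M is N E^-1, and its upper left
  block is the inverse of the Schur complement. Right multiplication by E^-1 subtracts from column j
  of N its column n times s j, which explains \<open>N'\<close>.\<close>

lemma schur_inverse:
  assumes MN: "mmul (Suc n) M N = mone" and NM: "mmul (Suc n) N M = mone" and p: "pivot_row n s M n \<in> invs"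
  defines "N' \<equiv> (\<lambda>i j. if i < n \<and> j < n then N i j - N i n * s j else mone i j)"
  shows "mmul n (schur n s M) N' = mone" "mmul n N' (schur n s M) = mone"
proof -
  let ?p = "pivot_row n s M" and ?w = "uinv (pivot_row n s M n)"
  have MN': "(\<Sum>l<n. M i l * N l j) = mone i j - M i n * N n j" if "i < Suc n" "j < Suc n" for i j
    using fun_cong[OF fun_cong[OF MN, of i], of j] that by (simp add: mmul_def algebra_simps)
  have NM': "(\<Sum>l<n. N i l * M l j) = mone i j - N i n * M n j" if "i < Suc n" "j < Suc n" for i j
    using fun_cong[OF fun_cong[OF NM, of i], of j] that by (simp add: mmul_def algebra_simps)
  show "mmul n (schur n s M) N' = mone"
  proof (rule std_matI_eq)
    fix i j assume ij: "i < n" "j < n"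
    define k where "k = N n j - N n n * s j"
    have a: "(\<Sum>l<n. M m l * (N l j - N l n * s j)) = mone m j - mone m n * s j - M m n * k" if "m < Suc n" for m
    proof -
      have "(\<Sum>l<n. M m l * (N l j - N l n * s j)) = (\<Sum>l<n. M m l * N l j) - (\<Sum>l<n. M m l * N l n) * s j"
        by (simp add: right_diff_distrib sum_subtractf sum_distrib_right mult.assoc)
      then show ?thesis using MN'[of m j] MN'[of m n] that ij by (simp add: k_def algebra_simps)
    qed
    have "(\<Sum>l<n. ?p l * (N l j - N l n * s j)) = (\<Sum>l<n. M n l * (N l j - N l n * s j))
        + (\<Sum>l<n. \<Sum>m<n. s m * (M m l * (N l j - N l n * s j)))"
      by (simp add: pivot_row_def distrib_right sum.distrib sum_distrib_right mult.assoc)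
    also have "(\<Sum>l<n. \<Sum>m<n. s m * (M m l * (N l j - N l n * s j))) = (\<Sum>m<n. s m * (\<Sum>l<n. M m l * (N l j - N l n * s j)))"
      by (subst sum.swap) (simp add: sum_distrib_left)
    also have "\<dots> = (\<Sum>m<n. s m * (mone m j - M m n * k))"
      by (rule sum.cong) (auto simp: a mone_def)
    also have "\<dots> = s j - (\<Sum>m<n. s m * M m n) * k"
    proof -
      have "(\<Sum>m<n. s m * mone m j) = s j"
        using ij by (simp add: mone_def if_distrib[of "\<lambda>z. _ * z"] cong: if_cong)
      then show ?thesis by (simp add: right_diff_distrib sum_subtractf sum_distrib_right mult.assoc)
    qed
    finally have "(\<Sum>l<n. ?p l * (N l j - N l n * s j)) =
        mone n j - mone n n * s j - M n n * k + (s j - (\<Sum>m<n. s m * M m n) * k)"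
      unfolding a[OF lessI] .
    then have b: "(\<Sum>l<n. ?p l * (N l j - N l n * s j)) = - (?p n * k)"
      using ij by (simp add: pivot_row_def distrib_right mone_def)
    have "mmul n (schur n s M) N' i j = (\<Sum>l<n. M i l * (N l j - N l n * s j)) - M i n * ?w * (\<Sum>l<n. ?p l * (N l j - N l n * s j))"
      using ij by (simp add: mmul_def schur_def N'_def left_diff_distrib sum_subtractf sum_distrib_left mult.assoc)
    also have "\<dots> = mone i j" using ij p by (simp add: a b mult.assoc) (simp add: mone_def)
    finally show "mmul n (schur n s M) N' i j = mone i j" .
  qed simp_all
  show "mmul n N' (schur n s M) = mone"
  proof (rule std_matI_eq)
    fix i j assume ij: "i < n" "j < n"
    have a: "(\<Sum>l<n. (N i l - N i n * s l) * M l m) = mone i m - N i n * ?p m" if "m < Suc n" for m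
    proof -
      have "(\<Sum>l<n. (N i l - N i n * s l) * M l m) = (\<Sum>l<n. N i l * M l m) - N i n * (\<Sum>l<n. s l * M l m)"
        by (simp add: left_diff_distrib sum_subtractf sum_distrib_left mult.assoc)
      then show ?thesis using NM'[of i m] that ij by (simp add: pivot_row_def algebra_simps)
    qed
    have "mmul n N' (schur n s M) i j = (\<Sum>l<n. (N i l - N i n * s l) * M l j) - (\<Sum>l<n. (N i l - N i n * s l) * M l n) * ?w * ?p j"
      using ij by (simp add: mmul_def schur_def N'_def right_diff_distrib sum_subtractf sum_distrib_right mult.assoc)
    also have "\<dots> = mone i j" unfolding a[OF lessI] a[OF less_SucI[OF ij(2)]] using ij p by (simp add: mult.assoc mone_def)
    finally show "mmul n N' (schur n s M) i j = mone i j" .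
  qed simp_all
qed

text \<open>Passing from s to s' multiplies the pivot by 1 - yx and the Schur complement by the
  inverse of I - xy. Up to homotopy the two changes cancel, so pivot times complement does not
  depend on s.\<close>

lemma schur_change:
  assumes p: "pivot_row n s M n \<in> invs" and p': "pivot_row n s' M n \<in> invs"
  defines "x \<equiv> (\<lambda>i. - M i n * uinv (pivot_row n s M n))" and "y \<equiv> (\<lambda>i. s' i - s i)"
  shows "pivot_row n s' M n = (1 - (\<Sum>i<n. y i * x i)) * pivot_row n s M n"
    "mmul n (rank1 n x y) (schur n s' M) = schur n s M"
proof -
  let ?d = "pivot_row n s M n" and ?d' = "pivot_row n s' M n"
  have y: "(\<Sum>i<n. y i * M i j) = pivot_row n s' M j - pivot_row n s M j" for j
    by (simp add: y_def pivot_row_def left_diff_distrib sum_subtractf)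
  have "(\<Sum>i<n. y i * x i) * ?d = - (\<Sum>i<n. y i * M i n)"
    using p by (simp add: x_def sum_distrib_right mult.assoc sum_negf)
  then show "?d' = (1 - (\<Sum>i<n. y i * x i)) * ?d" by (simp add: y left_diff_distrib)
  show "mmul n (rank1 n x y) (schur n s' M) = schur n s M"
  proof (rule std_matI_eq)
    fix i j assume ij: "i < n" "j < n"
    have "(\<Sum>l<n. y l * schur n s' M l j) = (\<Sum>l<n. y l * M l j) - (\<Sum>l<n. y l * M l n) * uinv ?d' * pivot_row n s' M j"
      using ij by (simp add: schur_def right_diff_distrib sum_subtractf sum_distrib_right mult.assoc)
    then have "(\<Sum>l<n. y l * schur n s' M l j) = ?d * (uinv ?d' * pivot_row n s' M j) - pivot_row n s M j"
      using p' by (simp add: y left_diff_distrib mult.assoc)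
    then have "mmul n (rank1 n x y) (schur n s' M) i j = schur n s' M i j - x i * (?d * (uinv ?d' * pivot_row n s' M j) - pivot_row n s M j)"
      using ij by (simp add: mmul_rank1_left)
    then show "mmul n (rank1 n x y) (schur n s' M) i j = schur n s M i j"
      using ij p by (simp add: schur_def x_def right_diff_distrib mult.assoc)
  qed simp_all
qed

context ustar_sub
begin

definition matR :: "nat \<Rightarrow> 'u imat set" where
  "matR n = {M. std_mat n M \<and> (\<forall>i j. M i j \<in> R)}"

definition GLn :: "nat \<Rightarrow> 'u imat set" where
  "GLn n = {M \<in> matR n. \<exists>N\<in>matR n. mmul n M N = mone \<and> mmul n N M = mone}"

abbreviation connn :: "nat \<Rightarrow> 'u imat \<Rightarrow> 'u imat \<Rightarrow> bool" where "connn n \<equiv> path_component (GLn n)"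

lemma mone_R [simp]: "mone i j \<in> R" by (simp add: mone_def)

lemma matR_mmul [simp]: "M \<in> matR n \<Longrightarrow> N \<in> matR n \<Longrightarrow> mmul n M N \<in> matR n"
  by (auto simp: matR_def mmul_def std_mat_def)

lemma matR_std: "M \<in> matR n \<Longrightarrow> std_mat n M" and matR_R: "M \<in> matR n \<Longrightarrow> M i j \<in> R"
  by (simp_all add: matR_def)

lemma GLn_matR: "M \<in> GLn n \<Longrightarrow> M \<in> matR n" by (simp add: GLn_def)

lemma GLnI: "M \<in> matR n \<Longrightarrow> N \<in> matR n \<Longrightarrow> mmul n M N = mone \<Longrightarrow> mmul n N M = mone \<Longrightarrow> M \<in> GLn n"
  by (auto simp: GLn_def)

lemma GLn_mone [simp]: "mone \<in> GLn n"
  by (rule GLnI[of _ _ mone]) (auto simp: matR_def mmul_mone_left)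

lemma GLn_mult:
  assumes "A \<in> GLn n" "B \<in> GLn n" shows "mmul n A B \<in> GLn n"
proof -
  obtain A' B' where *: "A' \<in> matR n" "mmul n A A' = mone" "mmul n A' A = mone" "B' \<in> matR n" "mmul n B B' = mone" "mmul n B' B = mone"
    using assms by (auto simp: GLn_def)
  have AB: "A \<in> matR n" "B \<in> matR n" using assms by (auto simp: GLn_def)
  show ?thesis
  proof (rule GLnI)
    show "mmul n A B \<in> matR n" "mmul n B' A' \<in> matR n" using * AB by auto
    have "mmul n (mmul n A B) (mmul n B' A') = mmul n A (mmul n (mmul n B B') A')" by (simp add: mmul_assoc)
    then show "mmul n (mmul n A B) (mmul n B' A') = mone" using * by (simp add: mmul_mone_left matR_std)
    have "mmul n (mmul n B' A') (mmul n A B) = mmul n B' (mmul n (mmul n A' A) B)" by (simp add: mmul_assoc)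
    then show "mmul n (mmul n B' A') (mmul n A B) = mone" using * AB by (simp add: mmul_mone_left matR_std)
  qed
qed

lemma matR_Suc: "M \<in> matR n \<Longrightarrow> M \<in> matR (Suc n)"
  by (auto simp: matR_def std_mat_def)

lemma mmul_Suc:
  assumes "M \<in> matR n" "N \<in> matR n" shows "mmul (Suc n) M N = mmul n M N"
proof (rule std_matI_eq[of "Suc n"])
  have out: "M i j = mone i j" "N i j = mone i j" if "\<not> (i < n \<and> j < n)" for i j
    using assms that by (auto simp: matR_def std_mat_def)
  show "std_mat (Suc n) (mmul n M N)" by (auto simp: std_mat_def mmul_def)
  fix i j assume ij: "i < Suc n" "j < Suc n"
  consider "i < n" "j < n" | "i = n" | "j = n" using ij by linarith
  then show "mmul (Suc n) M N i j = mmul n M N i j"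
  proof cases
    case 1 then show ?thesis by (simp add: mmul_def out) (simp add: mone_def)
  next
    case 2 then show ?thesis using ij by (simp add: mmul_def out) (simp add: mone_def)
  next
    case 3 then show ?thesis using ij by (simp add: mmul_def out) (simp add: mone_def)
  qed
qed simp

lemma GLn_Suc: "M \<in> GLn n \<Longrightarrow> M \<in> GLn (Suc n)"
proof -
  assume M: "M \<in> GLn n"
  then obtain N where N: "N \<in> matR n" "mmul n M N = mone" "mmul n N M = mone" by (auto simp: GLn_def)
  have "M \<in> matR n" using M by (simp add: GLn_def)
  with N show ?thesis by (intro GLnI[of _ _ N] matR_Suc) (simp_all add: mmul_Suc)
qed

lemma connnI:
  assumes "\<And>i j. continuous_on {0..1} (\<lambda>t. g t i j)" "\<And>t::real. 0 \<le> t \<Longrightarrow> t \<le> 1 \<Longrightarrow> g t \<in> GLn n"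
  shows "connn n (g 0) (g 1)"
  by (intro path_componentI continuous_on_coordinatewise_then_product assms)

lemma continuous_on_entry: "continuous_on S g \<Longrightarrow> continuous_on S (\<lambda>t. (g t :: 'u imat) i j)"
  using continuous_on_product_then_coordinatewise[OF continuous_on_product_then_coordinatewise[of S g i], of j] .

lemma connn_mult:
  assumes "connn n A A'" "connn n B B'"
  shows "connn n (mmul n A B) (mmul n A' B')"
proof -
  obtain g :: "real \<Rightarrow> _" where g: "continuous_on {0..1} g" "\<And>t. 0 \<le> t \<Longrightarrow> t \<le> 1 \<Longrightarrow> g t \<in> GLn n" "g 0 = A" "g 1 = A'"
    by (rule path_componentE[OF assms(1)]) blast
  obtain h :: "real \<Rightarrow> _" where h: "continuous_on {0..1} h" "\<And>t. 0 \<le> t \<Longrightarrow> t \<le> 1 \<Longrightarrow> h t \<in> GLn n" "h 0 = B" "h 1 = B'"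
    by (rule path_componentE[OF assms(2)]) blast
  note entry = continuous_on_entry[OF g(1)] continuous_on_entry[OF h(1)]
  have "connn n (mmul n (g 0) (h 0)) (mmul n (g 1) (h 1))"
  proof (rule connnI[of "\<lambda>t. mmul n (g t) (h t)"])
    show "continuous_on {0..1} (\<lambda>t. mmul n (g t) (h t) i j)" for i j
      unfolding mmul_def by (cases "i < n \<and> j < n") (auto intro!: continuous_on_sum continuous_on_mult entry)
  qed (use g h in \<open>simp add: GLn_mult\<close>)
  then show ?thesis using g h by simp
qed

lemma connn_mult_left: "Z \<in> GLn n \<Longrightarrow> connn n A B \<Longrightarrow> connn n (mmul n Z A) (mmul n Z B)"
  by (simp add: connn_mult path_component_refl)

lemma connn_mult_right: "Z \<in> GLn n \<Longrightarrow> connn n A B \<Longrightarrow> connn n (mmul n A Z) (mmul n B Z)"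
  by (simp add: connn_mult path_component_refl)

lemma connn_Suc: "connn n A B \<Longrightarrow> connn (Suc n) A B"
  by (rule path_component_of_subset[of "GLn n"]) (auto intro: GLn_Suc)

text \<open>The inverse is I + x w y with w = (1 - yx)^-1, as in the Sherman-Morrison
  formula.\<close>

lemma rank1_GLn:
  assumes "\<And>i. x i \<in> R" "\<And>i. y i \<in> R" "1 - (\<Sum>i<n. y i * x i) \<in> invs"
  shows "rank1 n x y \<in> GLn n"
proof -
  let ?s = "\<Sum>i<n. y i * x i"
  let ?w = "uinv (1 - ?s)"
  define x' where "x' = (\<lambda>i. - (x i * ?w))"
  have wR: "?w \<in> R" using assms by simp
  have s': "(\<Sum>l<n. y l * x' l) = - (?s * ?w)"
    by (simp add: x'_def sum_negf sum_distrib_right mult.assoc)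
  have w: "?w - ?s * ?w = 1" "?w - ?w * ?s = 1"
    using uinv_right[OF assms(3)] uinv_left[OF assms(3)] by (simp_all add: left_diff_distrib right_diff_distrib)
  have z1: "x i + x' i - x i * (\<Sum>l<n. y l * x' l) = 0" for i
  proof -
    have "x i + x' i - x i * (\<Sum>l<n. y l * x' l) = x i * (1 - (?w - ?s * ?w))"
      unfolding s' by (simp add: x'_def right_diff_distrib)
    then show ?thesis by (simp add: w)
  qed
  have z2: "x' i + x i - x' i * ?s = 0" for i
  proof -
    have "x' i + x i - x' i * ?s = x i * (1 - (?w - ?w * ?s))"
      by (simp add: x'_def right_diff_distrib mult.assoc)
    then show ?thesis by (simp add: w)
  qed
  have r0: "rank1 n (\<lambda>i. 0) y = mone" by (auto simp: rank1_def fun_eq_iff)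
  show ?thesis
  proof (rule GLnI)
    show "rank1 n x y \<in> matR n" "rank1 n x' y \<in> matR n"
      unfolding matR_def using assms(1,2) wR std_mat_rank1 by (auto simp: rank1_def x'_def simp del: std_mat_rank1) (auto simp: std_mat_def)
    show "mmul n (rank1 n x y) (rank1 n x' y) = mone" "mmul n (rank1 n x' y) (rank1 n x y) = mone"
      unfolding rank1_mult by (simp_all add: z1 z2 r0)
  qed
qed

lemma rank1_connn:
  assumes "\<And>i. continuous_on {0..1} (\<lambda>t. x t i)" "\<And>i. continuous_on {0..1} (\<lambda>t. y t i)"
    "\<And>t i. 0 \<le> t \<Longrightarrow> t \<le> 1 \<Longrightarrow> x t i \<in> R" "\<And>t i. 0 \<le> t \<Longrightarrow> t \<le> (1::real) \<Longrightarrow> y t i \<in> R"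
    "\<And>t. 0 \<le> t \<Longrightarrow> t \<le> 1 \<Longrightarrow> 1 - (\<Sum>i<n. y t i * x t i) \<in> invs"
  shows "connn n (rank1 n (x 0) (y 0)) (rank1 n (x 1) (y 1))"
proof (rule connnI[of "\<lambda>t. rank1 n (x t) (y t)"])
  show "continuous_on {0..1} (\<lambda>t. rank1 n (x t) (y t) i j)" for i j
    unfolding rank1_def by (cases "i < n \<and> j < n") (auto intro!: continuous_intros assms(1,2))
qed (use assms in \<open>auto intro: rank1_GLn\<close>)

definition dg :: "nat \<Rightarrow> 'u \<Rightarrow> 'u imat" where
  "dg k d = (\<lambda>i j. if i = k \<and> j = k then d else mone i j)"

lemma dg_rank1: "k < n \<Longrightarrow> dg k d = rank1 n (\<lambda>i. if i = k then 1 - d else 0) (\<lambda>i. if i = k then 1 else 0)"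
  by (auto simp: dg_def rank1_def mone_def fun_eq_iff)

lemma dg_sum: "k < (n::nat) \<Longrightarrow> (\<Sum>i<n. (if i = k then 1 else 0) * (if i = k then z else 0)) = (z::'u)"
  by (simp add: if_distrib[of "\<lambda>z. _ * z"] cong: if_cong)

lemma dg_GLn: "k < n \<Longrightarrow> d \<in> GL \<Longrightarrow> dg k d \<in> GLn n"
  unfolding dg_rank1 by (rule rank1_GLn) (auto simp: dg_sum)

lemma dg_mult: "k < n \<Longrightarrow> mmul n (dg k a) (dg k b) = dg k (a * b)"
  unfolding dg_rank1[of k n] rank1_mult dg_sum
  by (rule arg_cong2[where f = "rank1 n"]) (auto simp: fun_eq_iff algebra_simps)

lemma dg_connn:
  assumes "k < n" "conn a b" shows "connn n (dg k a) (dg k b)"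
proof -
  obtain g :: "real \<Rightarrow> _" where g: "continuous_on {0..1} g" "\<And>t. 0 \<le> t \<Longrightarrow> t \<le> 1 \<Longrightarrow> g t \<in> GL" "g 0 = a" "g 1 = b"
    by (rule path_componentE[OF assms(2)]) blast
  have "connn n (dg k (g 0)) (dg k (g 1))"
  proof (rule connnI[of "\<lambda>t. dg k (g t)"])
    show "continuous_on {0..1} (\<lambda>t. dg k (g t) i j)" for i j
      unfolding dg_def by (cases "i = k \<and> j = k") (auto intro!: g)
  qed (use g assms in \<open>simp add: dg_GLn\<close>)
  then show ?thesis using g by simp
qed

lemma dg_one: "dg k 1 = mone"
  by (auto simp: dg_def mone_def fun_eq_iff)

lemma pivot_row_R [simp]: "M \<in> matR m \<Longrightarrow> (\<And>i. s i \<in> R) \<Longrightarrow> pivot_row n s M j \<in> R"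
  by (simp add: pivot_row_def matR_R)

lemma schur_GLn:
  assumes "M \<in> GLn (Suc n)" "\<And>i. s i \<in> R" "pivot_row n s M n \<in> invs"
  shows "schur n s M \<in> GLn n"
proof -
  obtain N where N: "N \<in> matR (Suc n)" "mmul (Suc n) M N = mone" "mmul (Suc n) N M = mone"
    using assms(1) by (auto simp: GLn_def)
  have M: "M \<in> matR (Suc n)" using assms(1) by (simp add: GLn_def)
  show ?thesis
  proof (rule GLnI[OF _ _ schur_inverse[OF N(2,3) assms(3)]])
    show "schur n s M \<in> matR n"
      using pivot_row_R[OF M assms(2)] M assms(2,3) by (auto simp: matR_def schur_def std_mat_def)
    show "(\<lambda>i j. if i < n \<and> j < n then N i j - N i n * s j else mone i j) \<in> matR n"
      using assms(2) matR_R[OF N(1)] by (auto simp: matR_def std_mat_def)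
  qed
qed

text \<open>Gaussian elimination: \<open>A1\<close> makes the pivot invertible, \<open>A2\<close>
  clears its row and \<open>A3\<close> its column. What remains is block diagonal with the Schur
  complement and the pivot as blocks.\<close>

lemma GLn_connected:
  assumes conn: "\<And>x. x \<in> GL \<Longrightarrow> conn x 1"
    and piv: "\<And>n M. M \<in> GLn (Suc n) \<Longrightarrow> \<exists>s. (\<forall>i. s i \<in> R) \<and> pivot_row n s M n \<in> invs"
  shows "M \<in> GLn n \<Longrightarrow> connn n M mone"
proof (induction n arbitrary: M)
  case 0
  then have "M = mone" by (intro std_matI_eq[of 0]) (auto simp: GLn_def matR_std)
  then show ?case by (simp add: path_component_refl)
next
  case (Suc n)
  let ?m = "Suc n"
  obtain s where s: "\<And>i. s i \<in> R" "pivot_row n s M n \<in> invs" using piv[OF Suc.prems] by blast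
  have M: "M \<in> matR ?m" using Suc.prems by (simp add: GLn_def)
  let ?p = "pivot_row n s M" and ?w = "uinv (pivot_row n s M n)"
  have pR: "?p j \<in> R" for j using M s(1) by simp
  have wR: "?w \<in> R" using pR s(2) by simp
  define e where "e = (\<lambda>i. if i = n then 1 else 0 :: 'u)"
  define y1 where "y1 = (\<lambda>i. if i < n then s i else 0)"
  define y2 where "y2 = (\<lambda>j. if j < n then ?w * ?p j else 0)"
  define x3 where "x3 = (\<lambda>i. if i < n then M i n * ?w else 0)"
  have R: "e i \<in> R" "y1 i \<in> R" "y2 i \<in> R" "x3 i \<in> R" for i
    using s wR pR matR_R[OF M] by (auto simp: e_def y1_def y2_def x3_def)
  define A1 where "A1 = rank1 ?m (\<lambda>i. - e i) y1"
  define A2 where "A2 = rank1 ?m e y2"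
  define A3 where "A3 = rank1 ?m x3 e"
  \<comment> \<open>Row and column have disjoint supports, so yx = 0, and scaling y by t deforms
    each elementary matrix into the identity through invertible ones.\<close>
  have z: "(\<Sum>i<?m. (t *\<^sub>R y1 i) * - e i) = 0" "(\<Sum>i<?m. (t *\<^sub>R y2 i) * e i) = 0" "(\<Sum>i<?m. (t *\<^sub>R e i) * x3 i) = 0" for t
    by (rule sum.neutral; auto simp: e_def y1_def y2_def x3_def)+
  have r0: "rank1 ?m x (\<lambda>i. 0) = mone" for x :: "nat \<Rightarrow> 'u" by (auto simp: rank1_def fun_eq_iff)
  have c: "connn ?m mone (rank1 ?m x y)" if "\<And>i. x i \<in> R" "\<And>i. y i \<in> R" "\<And>t. (\<Sum>i<?m. (t *\<^sub>R y i) * x i) = 0" for x y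
  proof -
    have "connn ?m (rank1 ?m x (\<lambda>i. 0 *\<^sub>R y i)) (rank1 ?m x (\<lambda>i. 1 *\<^sub>R y i))"
    proof (rule rank1_connn[of "\<lambda>t. x" "\<lambda>t i. t *\<^sub>R y i"])
      fix t :: real
      show "1 - (\<Sum>i<?m. (t *\<^sub>R y i) * x i) \<in> invs" unfolding that(3) by simp
    qed (auto intro!: continuous_intros simp: that(1,2))
    then show ?thesis by (simp add: r0)
  qed
  have c1: "connn ?m mone A1" "connn ?m mone A2" "connn ?m mone A3"
    unfolding A1_def A2_def A3_def by (rule c; use R z in \<open>simp del: sum.lessThan_Suc\<close>)+
  have sg: "schur n s M \<in> GLn n" by (rule schur_GLn[OF Suc.prems s])
  have out: "schur n s M i j = mone i j" if "\<not> (i < n \<and> j < n)" for i j using that by (auto simp: schur_def)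
  have e1: "mmul ?m A1 M i j = (if i = n then ?p j else M i j)" if "i < ?m" "j < ?m" for i j
    using that unfolding A1_def mmul_rank1_left[OF that]
    by (auto simp: e_def y1_def pivot_row_def)
  have e2: "mmul ?m (mmul ?m A1 M) A2 i j = (if j < n then if i < n then schur n s M i j else 0 else if i = n then ?p n else M i n)"
    if "i < ?m" "j < ?m" for i j
  proof -
    have "(\<Sum>l<?m. mmul ?m A1 M i l * e l) = mmul ?m A1 M i n"
      by (simp add: e_def)
    then have "mmul ?m (mmul ?m A1 M) A2 i j = mmul ?m A1 M i j - mmul ?m A1 M i n * y2 j"
      using that unfolding A2_def mmul_rank1_right[OF that] by simp
    also have "\<dots> = (if j < n then if i < n then schur n s M i j else 0 else if i = n then ?p n else M i n)"
      using that s(2) by (auto simp: e1 y2_def schur_def mult.assoc less_Suc_eq)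
    finally show ?thesis .
  qed
  have e3: "mmul ?m A3 (mmul ?m (mmul ?m A1 M) A2) = mmul ?m (schur n s M) (dg n (?p n))" (is "?L = ?Rr")
  proof (rule std_matI_eq)
    fix i j assume ij: "i < ?m" "j < ?m"
    have "(\<Sum>l<?m. e l * mmul ?m (mmul ?m A1 M) A2 l j) = mmul ?m (mmul ?m A1 M) A2 n j" by (simp add: e_def)
    then have l: "?L i j = mmul ?m (mmul ?m A1 M) A2 i j - x3 i * mmul ?m (mmul ?m A1 M) A2 n j"
      using ij unfolding A3_def mmul_rank1_left[OF ij] by simp
    have "(\<Sum>l<?m. schur n s M i l * (if l = n then 1 - ?p n else 0)) = schur n s M i n * (1 - ?p n)" by simp
    then have r: "?Rr i j = schur n s M i j - schur n s M i n * (1 - ?p n) * (if j = n then 1 else 0)"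
      using ij unfolding dg_rank1[OF lessI] mmul_rank1_right[OF ij] by simp
    show "?L i j = ?Rr i j"
      unfolding l r using ij s(2) by (auto simp: e2 x3_def out less_Suc_eq mult.assoc) (auto simp: mone_def)
  qed simp_all
  have "connn ?m (mmul ?m mone (mmul ?m (mmul ?m mone M) mone)) (mmul ?m A3 (mmul ?m (mmul ?m A1 M) A2))"
    by (intro connn_mult c1 path_component_refl Suc.prems)
  then have "connn ?m M (mmul ?m (schur n s M) (dg n (?p n)))"
    unfolding e3 by (simp add: mmul_mone_left mmul_mone_right matR_std[OF M])
  moreover have "connn ?m (mmul ?m (schur n s M) (dg n (?p n))) (mmul ?m mone (dg n 1))"
    using pR s(2) by (intro connn_mult connn_Suc[OF Suc.IH[OF sg]] dg_connn conn GLI) auto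
  ultimately show ?case by (simp add: dg_one mmul_mone_left) (meson path_component_trans)
qed

end

section \<open>Lowering the size of matrices when the invertible elements are dense\<close>

context ustar_sub_dense
begin

text \<open>The last row of a left inverse N combines the last column of M to 1. With
  \<open>N n n\<close> approximated by an invertible z the combination stays invertible, and
  dividing by z gives the last row the coefficient 1 that \<open>pivot_row\<close>
  prescribes.\<close>

lemma pivot_exists:
  assumes "M \<in> GLn (Suc n)"
  shows "\<exists>s. (\<forall>i. s i \<in> R) \<and> pivot_row n s M n \<in> invs"
proof -
  obtain N where N: "N \<in> matR (Suc n)" "mmul (Suc n) N M = mone"
    using assms by (auto simp: GLn_def)
  have M: "M \<in> matR (Suc n)" using assms by (simp add: GLn_def)
  have sum: "(\<Sum>l<n. N n l * M l n) + N n n * M n n = 1"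
    using fun_cong[OF fun_cong[OF N(2), of n], of n] by (simp add: mmul_def mone_def)
  define K where "K = norm (M n n) + 1"
  have K: "K > 0" by (simp add: K_def add_nonneg_pos)
  obtain z where z: "z \<in> GL" "norm (N n n - z) < 1 / K"
    using dense_GL[OF matR_R[OF N(1)], of "1 / K" n n] K by auto
  define u where "u = (\<Sum>l<n. N n l * M l n) + z * M n n"
  have "1 - u = (N n n - z) * M n n" using sum unfolding u_def by (simp add: left_diff_distrib) (simp add: algebra_simps)
  then have "norm (1 - u) \<le> norm (N n n - z) * norm (M n n)" by (simp add: norm_mult_ineq)
  also have "\<dots> \<le> norm (N n n - z) * K" by (intro mult_left_mono) (auto simp: K_def)
  also have "\<dots> < 1" using z(2) K by (simp add: field_simps)
  finally have u: "u \<in> invs" by (rule neumann_invs)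
  have "pivot_row n (\<lambda>l. uinv z * N n l) M n = uinv z * u"
    using z(1) by (simp add: pivot_row_def u_def distrib_left sum_distrib_left mult.assoc)
  then have "pivot_row n (\<lambda>l. uinv z * N n l) M n \<in> invs" using u z(1) by (simp add: invs_mult)
  then show ?thesis using z(1) matR_R[OF N(1)] by (intro exI[of _ "\<lambda>l. uinv z * N n l"]) simp
qed

text \<open>A homotopy version of Jacobson's trick for columns and rows. Once \<open>x 0\<close> has
  been moved to an invertible \<open>x0\<close>, the whole of yx can be pushed into its first
  summand.\<close>

lemma rank1_connn_dg:
  assumes x: "\<And>i. x i \<in> R" and y: "\<And>i. y i \<in> R" and i: "1 - (\<Sum>i<Suc m. y i * x i) \<in> invs"
  shows "connn (Suc m) (rank1 (Suc m) x y) (dg 0 (1 - (\<Sum>i<Suc m. y i * x i)))"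
proof -
  let ?n = "Suc m"
  define s where "s = (\<Sum>i<?n. y i * x i)"
  define K where "K = norm (y 0) * norm (uinv (1 - s)) + 1"
  have K: "K > 0" by (simp add: K_def add_nonneg_pos)
  obtain x0 where x0: "x0 \<in> GL" "norm (x 0 - x0) < 1 / K" using dense_GL[OF x, of "1 / K" 0] K by auto
  define s' where "s' = s + y 0 * (x0 - x 0)"
  have near: "norm ((1 - s) - (1 - (s + t *\<^sub>R (y 0 * (x0 - x 0))))) * norm (uinv (1 - s)) < 1" if "0 \<le> t" "t \<le> 1" for t
  proof -
    have "norm (t *\<^sub>R (y 0 * (x0 - x 0))) \<le> norm (y 0 * (x0 - x 0))" using that by (simp add: mult_left_le_one_le)
    also have "\<dots> \<le> norm (y 0) * norm (x0 - x 0)" by (rule norm_mult_ineq)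
    finally have "norm (t *\<^sub>R (y 0 * (x0 - x 0))) * norm (uinv (1 - s)) \<le> norm (y 0) * norm (x0 - x 0) * norm (uinv (1 - s))"
      by (rule mult_right_mono) simp
    also have "\<dots> = norm (x0 - x 0) * (norm (y 0) * norm (uinv (1 - s)))" by simp
    also have "\<dots> \<le> norm (x0 - x 0) * K" by (rule mult_left_mono) (auto simp: K_def)
    also have "\<dots> < 1" using x0(2) K by (simp add: field_simps norm_minus_commute)
    finally show ?thesis by simp
  qed
  have GLs: "1 - s \<in> GL" using i x y by (intro GLI) (auto simp: s_def simp del: sum.lessThan_Suc)
  have c: "conn (1 - s) (1 - s')"
    by (rule conn_near[OF GLs]) (use near[of 1] x0 x y in \<open>auto simp: s'_def s_def simp del: sum.lessThan_Suc\<close>)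
  have sh: "(\<Sum>i<?n. f i) = f 0 + (\<Sum>i<m. f (Suc i))" for f :: "nat \<Rightarrow> 'a" by (rule sum.lessThan_Suc_shift)
  define r where "r = (\<Sum>i<m. y (Suc i) * x (Suc i))"
  have s: "s = y 0 * x 0 + r" "s' = y 0 * x0 + r" by (simp_all add: s_def s'_def sh r_def algebra_simps del: sum.lessThan_Suc)
  define x1 where "x1 = (\<lambda>t i. if i = 0 then (1 - t) *\<^sub>R x 0 + t *\<^sub>R x0 else x i)"
  have p1: "connn ?n (rank1 ?n (x1 0) y) (rank1 ?n (x1 1) y)"
  proof (rule rank1_connn[of x1 "\<lambda>_. y"])
    fix t :: real assume t: "0 \<le> t" "t \<le> 1"
    have "(\<Sum>i<?n. y i * x1 t i) = s + t *\<^sub>R (y 0 * (x0 - x 0))"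
      by (simp add: sh x1_def s r_def algebra_simps del: sum.lessThan_Suc)
    moreover have "1 - (s + t *\<^sub>R (y 0 * (x0 - x 0))) \<in> invs"
      by (rule perturb_invs(1)[OF GL_invs[OF GLs] near[OF t]])
    ultimately show "1 - (\<Sum>i<?n. y i * x1 t i) \<in> invs" by simp
  next
    show "continuous_on {0..1} (\<lambda>t. x1 t i)" for i unfolding x1_def by (cases "i = 0") (auto intro!: continuous_intros)
  qed (use x y x0 in \<open>auto simp: x1_def\<close>)
  define x2 where "x2 = (\<lambda>t i. if i = 0 then x0 else (1 - t) *\<^sub>R x i)"
  \<comment> \<open>While the other entries of x shrink, their contribution to yx is handed over to
    entry 0 of y by dividing by \<open>x0\<close>; so yx = \<open>s'\<close> all the time.\<close>
  define y2 where "y2 = (\<lambda>t i. if i = 0 then y 0 + t *\<^sub>R (r * uinv x0) else y i)"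
  have rR: "r \<in> R" using x y by (simp add: r_def)
  have s'i: "1 - s' \<in> invs" using c path_component_mem by (metis GL_invs)
  have p2: "connn ?n (rank1 ?n (x2 0) (y2 0)) (rank1 ?n (x2 1) (y2 1))"
  proof (rule rank1_connn[of x2 y2])
    fix t :: real
    have "(\<Sum>i<m. y (Suc i) * (1 - t) *\<^sub>R x (Suc i)) = (1 - t) *\<^sub>R r"
      by (simp add: r_def scaleR_sum_right)
    then have "(\<Sum>i<?n. y2 t i * x2 t i) = s'"
      using x0(1) by (simp add: sh x2_def y2_def s algebra_simps del: sum.lessThan_Suc)
    then show "1 - (\<Sum>i<?n. y2 t i * x2 t i) \<in> invs" using s'i by simp
  next
    show "continuous_on {0..1} (\<lambda>t. x2 t i)" "continuous_on {0..1} (\<lambda>t. y2 t i)" for i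
      unfolding x2_def y2_def by (cases "i = 0"; auto intro!: continuous_intros)+
  qed (use x y x0 rR in \<open>auto simp: x2_def y2_def\<close>)
  \<comment> \<open>Now x is supported at index 0, hence the other entries of y do not enter yx and
    can be scaled away.\<close>
  define y3 where "y3 = (\<lambda>t i. if i = 0 then y2 1 0 else (1 - t) *\<^sub>R y i)"
  have y0: "y2 1 0 * x0 = s'" using x0(1) by (simp add: y2_def s distrib_right mult.assoc)
  have p3: "connn ?n (rank1 ?n (x2 1) (y3 0)) (rank1 ?n (x2 1) (y3 1))"
  proof (rule rank1_connn[of "\<lambda>_. x2 1" y3])
    fix t :: real
    have "(\<Sum>i<?n. y3 t i * x2 1 i) = s'"
      using y0 by (simp add: sh x2_def y3_def del: sum.lessThan_Suc)
    then show "1 - (\<Sum>i<?n. y3 t i * x2 1 i) \<in> invs" using s'i by simp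
  next
    show "continuous_on {0..1} (\<lambda>t. y3 t i)" for i
      unfolding y3_def by (cases "i = 0") (auto intro!: continuous_intros)
  qed (use x y x0 rR in \<open>auto simp: x2_def y2_def y3_def\<close>)
  have e0: "x1 0 = x" by (auto simp: x1_def)
  have e1: "x2 0 = x1 1" "y2 0 = y" by (auto simp: x1_def x2_def y2_def)
  have e2: "y3 0 = y2 1" by (auto simp: y2_def y3_def)
  have e3: "rank1 ?n (x2 1) (y3 1) = dg 0 (1 - x0 * y2 1 0)"
    by (auto simp: rank1_def x2_def y3_def dg_def mone_def fun_eq_iff)
  \<comment> \<open>The corner entry has its factors in the opposite order; \<open>conn_swap\<close>
    exchanges them.\<close>
  have "1 - y2 1 0 * x0 \<in> invs" using y0 s'i by simp
  then have "conn (1 - y2 1 0 * x0) (1 - x0 * y2 1 0)"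
    by (intro conn_swap) (use x0 y rR in \<open>auto simp: y2_def\<close>)
  then have "conn (1 - x0 * y2 1 0) (1 - s)" using c y0 by (metis path_component_sym path_component_trans)
  then have "connn ?n (dg 0 (1 - x0 * y2 1 0)) (dg 0 (1 - s))" by (intro dg_connn) auto
  then show ?thesis using p1 p2 p3 unfolding e0 e1 e2 e3 s_def by (meson path_component_trans)
qed

text \<open>The matrix of size n obtained from M of size n + 1 by multiplying a Schur complement with its pivot. Up
  to homotopy it does not depend on the row operation s that makes the pivot invertible, and it is constant
  along paths. This is how a path of larger matrices is pushed down.\<close>
definition reduce :: "nat \<Rightarrow> (nat \<Rightarrow> 'a) \<Rightarrow> 'a imat \<Rightarrow> 'a imat" where
  "reduce n s M = mmul n (dg 0 (pivot_row n s M n)) (schur n s M)"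

text \<open>With q = 1 - yx, d the pivot for s and S' the Schur complement for s', the chain is d (I
  - xy) S' ~ d q S' ~ q d S'. The last step is commutativity of components. The reduced size is at
  least 1, as the pivot goes into entry 0.\<close>

lemma reduce_connn:
  assumes M: "M \<in> GLn (Suc (Suc m))" and s: "\<And>i. s i \<in> R" "\<And>i. s' i \<in> R"
    and p: "pivot_row (Suc m) s M (Suc m) \<in> invs" "pivot_row (Suc m) s' M (Suc m) \<in> invs"
  shows "connn (Suc m) (reduce (Suc m) s M) (reduce (Suc m) s' M)"
proof -
  let ?n = "Suc m"
  let ?d = "pivot_row ?n s M ?n" and ?d' = "pivot_row ?n s' M ?n"
  define x where "x = (\<lambda>i. - M i ?n * uinv ?d)"
  define y where "y = (\<lambda>i. s' i - s i)"
  define q where "q = 1 - (\<Sum>i<?n. y i * x i)"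
  have mR: "M \<in> matR (Suc ?n)" using M by (simp add: GLn_def)
  have dR: "?d \<in> R" "?d' \<in> R" using mR s by auto
  have x: "x i \<in> R" and y: "y i \<in> R" for i using matR_R[OF mR] s dR p by (auto simp: x_def y_def)
  have ch: "?d' = q * ?d" "mmul ?n (rank1 ?n x y) (schur ?n s' M) = schur ?n s M"
    using schur_change[OF p] unfolding q_def x_def y_def .
  have q: "q \<in> GL"
  proof (rule GLI)
    show "q \<in> R" using x y by (simp add: q_def del: sum.lessThan_Suc)
    have "q * ?d \<in> invs" using p(2) by (simp only: ch(1))
    then show "q \<in> invs" by (rule invs_mult_cancel_right[OF p(1)])
  qed
  have d: "?d \<in> GL" using dR p by (intro GLI)
  have sG: "schur ?n s' M \<in> GLn ?n" by (rule schur_GLn[OF M s(2) p(2)])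
  have "connn ?n (rank1 ?n x y) (dg 0 q)"
    unfolding q_def by (rule rank1_connn_dg[OF x y]) (use q in \<open>simp add: q_def del: sum.lessThan_Suc\<close>)
  then have "connn ?n (mmul ?n (dg 0 ?d) (mmul ?n (rank1 ?n x y) (schur ?n s' M))) (mmul ?n (dg 0 ?d) (mmul ?n (dg 0 q) (schur ?n s' M)))"
    by (intro connn_mult_left connn_mult_right sG dg_GLn d) auto
  moreover have "mmul ?n (dg 0 ?d) (mmul ?n (dg 0 q) (schur ?n s' M)) = mmul ?n (dg 0 (?d * q)) (schur ?n s' M)"
    by (subst mmul_assoc[symmetric]) (simp add: dg_mult)
  ultimately have A: "connn ?n (mmul ?n (dg 0 ?d) (schur ?n s M)) (mmul ?n (dg 0 (?d * q)) (schur ?n s' M))"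
    by (simp only: ch(2))
  have B: "connn ?n (mmul ?n (dg 0 (?d * q)) (schur ?n s' M)) (mmul ?n (dg 0 (q * ?d)) (schur ?n s' M))"
    by (intro connn_mult_right sG dg_connn conn_commute d q) auto
  show ?thesis
    unfolding reduce_def ch(1) by (rule path_component_trans[OF A B])
qed

lemma reduce_GLn:
  assumes "M \<in> GLn (Suc (Suc m))" "\<And>i. s i \<in> R" "pivot_row (Suc m) s M (Suc m) \<in> invs"
  shows "reduce (Suc m) s M \<in> GLn (Suc m)"
proof -
  have "pivot_row (Suc m) s M (Suc m) \<in> GL"
    using assms GLn_matR[OF assms(1)] by (intro GLI) auto
  then show ?thesis unfolding reduce_def by (intro GLn_mult dg_GLn schur_GLn assms) auto
qed

lemma reduce_GLn_Suc:
  assumes "X \<in> GLn n"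
  shows "reduce n (\<lambda>_. 0) X = X" "pivot_row n (\<lambda>_. 0) X n \<in> invs"
proof -
  have out: "X i j = mone i j" if "\<not> (i < n \<and> j < n)" for i j
    using assms that by (auto simp: GLn_def matR_def std_mat_def)
  have p: "pivot_row n (\<lambda>_. 0) X j = mone n j" for j by (simp add: pivot_row_def out)
  have "schur n (\<lambda>_. 0) X = X"
  proof (rule std_matI_eq[of n])
    show "std_mat n X" using assms by (simp add: GLn_def matR_std)
    fix i j assume "i < n" "j < n"
    then show "schur n (\<lambda>_. 0) X i j = X i j" by (simp add: schur_def p) (simp add: mone_def)
  qed simp
  then show "reduce n (\<lambda>_. 0) X = X" "pivot_row n (\<lambda>_. 0) X n \<in> invs"
    using assms by (simp_all add: reduce_def p GLn_def matR_std) (simp_all add: mone_def dg_one mmul_mone_left matR_std)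
qed

text \<open>One s need not serve the whole path, but it serves a neighbourhood, invertibility of the
  pivot being an open condition. The local homotopies are chained over the connected interval, where
  s is changed by \<open>reduce_connn\<close>; at the ends s = 0 gives back X and Y.\<close>

lemma connn_SucD:
  assumes "X \<in> GLn (Suc m)" "Y \<in> GLn (Suc m)" "connn (Suc (Suc m)) X Y"
  shows "connn (Suc m) X Y"
proof -
  let ?n = "Suc m"
  obtain g :: "real \<Rightarrow> _" where g: "continuous_on {0..1} g" "\<And>t. 0 \<le> t \<Longrightarrow> t \<le> 1 \<Longrightarrow> g t \<in> GLn (Suc ?n)" "g 0 = X" "g 1 = Y"
    by (rule path_componentE[OF assms(3)]) blast
  note entry = continuous_on_entry[OF g(1)]
  define ok where "ok = (\<lambda>s M. (\<forall>i. s i \<in> R) \<and> pivot_row ?n s M ?n \<in> invs)"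
  define rel where "rel = (\<lambda>t t'. \<exists>s s'. ok s (g t) \<and> ok s' (g t') \<and> connn ?n (reduce ?n s (g t)) (reduce ?n s' (g t')))"
  have change: "connn ?n (reduce ?n s (g t)) (reduce ?n s' (g t))" if "ok s (g t)" "ok s' (g t)" "0 \<le> t" "t \<le> 1" for s s' t
    using that g by (intro reduce_connn) (auto simp: ok_def)
  have "rel 0 1"
  proof (rule connected_equivalence_relation[of "{0..1::real}"])
    show "rel y x" if "rel x y" for x y using that unfolding rel_def by (metis path_component_sym)
    show "rel x z" if xyz: "rel x y" "rel y z" "y \<in> {0..1}" for x y z
    proof -
      obtain s s' where 1: "ok s (g x)" "ok s' (g y)" "connn ?n (reduce ?n s (g x)) (reduce ?n s' (g y))"
        using xyz(1) by (auto simp: rel_def)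
      obtain s2 s3 where 2: "ok s2 (g y)" "ok s3 (g z)" "connn ?n (reduce ?n s2 (g y)) (reduce ?n s3 (g z))"
        using xyz(2) by (auto simp: rel_def)
      have "connn ?n (reduce ?n s' (g y)) (reduce ?n s2 (g y))" using change 1 2 xyz(3) by auto
      then show ?thesis unfolding rel_def using 1 2 by (meson path_component_trans)
    qed
  next
    fix t :: real assume t: "t \<in> {0..1}"
    obtain s where s: "ok s (g t)" using pivot_exists[of "g t" ?n] g(2) t by (auto simp: ok_def)
    have cont: "continuous_on {0..1} (\<lambda>t. pivot_row ?n s (g t) j)" for j
      unfolding pivot_row_def by (intro continuous_on_add continuous_on_sum continuous_on_mult continuous_on_const entry)
    define T where "T = {0..1} \<inter> (\<lambda>t. pivot_row ?n s (g t) ?n) -` invs"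
    have "openin (top_of_set {0..1}) T" unfolding T_def by (intro continuous_openin_preimage_gen cont open_invs)
    moreover have "t \<in> T" using s t by (auto simp: T_def ok_def)
    ultimately obtain e where e: "e > 0" "ball t e \<inter> {0..1} \<subseteq> T" by (meson openin_contains_ball)
    have "rel t x" if x: "x \<in> ball t e \<inter> {0..1}" for x
    proof -
      let ?l = "\<lambda>u. (1 - u) *\<^sub>R t + u *\<^sub>R x"
      have l: "?l u \<in> ball t e \<inter> {0..1}" if "0 \<le> u" "u \<le> 1" for u
        by (rule convexD_alt[OF convex_Int[OF convex_ball convex_closed_interval(1), simplified] _ x that])
          (use t e in auto)
      have lT: "?l u \<in> T" if "u \<in> {0..1}" for u using l[of u] e that by auto
      have cl: "continuous_on {0..1} (\<lambda>u. f (?l u))" if "continuous_on {0..1} f" for f :: "real \<Rightarrow> 'a"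
        by (rule continuous_on_compose2[OF that]) (auto intro!: continuous_intros simp: subset_iff dest: lT simp: T_def)
      have "connn ?n (reduce ?n s (g (?l 0))) (reduce ?n s (g (?l 1)))"
      proof (rule connnI[of "\<lambda>u. reduce ?n s (g (?l u))"])
        fix i j
        have inv: "continuous_on {0..1} (\<lambda>u. uinv (pivot_row ?n s (g (?l u)) ?n))"
          by (intro continuous_on_uinv cl cont) (use lT in \<open>auto simp: T_def\<close>)
        have schur: "continuous_on {0..1} (\<lambda>u. schur ?n s (g (?l u)) i j)" for i j
        proof (cases "i < ?n \<and> j < ?n")
          case True
          show ?thesis unfolding schur_def if_P[OF True]
            by (intro continuous_on_diff continuous_on_mult inv cl[OF entry] cl[OF cont])
        qed (auto simp: schur_def)
        have "continuous_on {0..1} (\<lambda>u. dg 0 (pivot_row ?n s (g (?l u)) ?n) i j)" for i j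
        proof (cases "i = 0 \<and> j = 0")
          case True
          show ?thesis unfolding dg_def if_P[OF True] by (rule cl[OF cont])
        qed (auto simp: dg_def)
        note dgc = this
        show "continuous_on {0..1} (\<lambda>u. reduce ?n s (g (?l u)) i j)"
        proof (cases "i < ?n \<and> j < ?n")
          case True
          show ?thesis unfolding reduce_def mmul_def if_P[OF True]
            by (intro continuous_on_sum continuous_on_mult dgc schur)
        qed (auto simp: reduce_def mmul_def)
      next
        fix u :: real assume "0 \<le> u" "u \<le> 1"
        then have "?l u \<in> T" using lT by simp
        then show "reduce ?n s (g (?l u)) \<in> GLn ?n"
          using s g(2) by (intro reduce_GLn) (auto simp: T_def ok_def)
      qed
      moreover have "ok s (g x)" using s x e by (auto simp: ok_def T_def)
      ultimately show ?thesis using s by (auto simp: rel_def)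
    qed
    then show "\<exists>T. openin (top_of_set {0..1}) T \<and> t \<in> T \<and> (\<forall>x\<in>T. rel t x)"
      using e t by (intro exI[of _ "{0..1} \<inter> ball t e"]) (auto simp: openin_open_Int)
  qed auto
  then obtain s s' where s: "ok s X" "ok s' Y" "connn ?n (reduce ?n s X) (reduce ?n s' Y)"
    using g(3,4) by (auto simp: rel_def)
  have ok0: "ok (\<lambda>_. 0) X" "ok (\<lambda>_. 0) Y" using reduce_GLn_Suc(2) assms by (auto simp: ok_def)
  have "connn ?n X (reduce ?n s X)" "connn ?n (reduce ?n s' Y) Y"
    using change[of "\<lambda>_. 0" 0 s] change[of s' 1 "\<lambda>_. 0"] s ok0 g(3,4) reduce_GLn_Suc(1) assms by auto
  then show ?thesis using s(3) by (meson path_component_trans)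
qed

lemma conn_of_connn:
  assumes "a \<in> GL" "connn (Suc k) (dg 0 a) mone" shows "conn a 1"
proof -
  have a1: "dg 0 a \<in> GLn (Suc 0)" by (rule dg_GLn) (use assms in auto)
  have "connn (Suc k) (dg 0 a) mone \<Longrightarrow> connn (Suc 0) (dg 0 a) mone"
  proof (induction k)
    case (Suc k)
    have "dg 0 a \<in> GLn (Suc k)" by (rule dg_GLn) (use assms in auto)
    then show ?case using connn_SucD[OF _ GLn_mone Suc.prems] Suc.IH by blast
  qed
  then obtain g :: "real \<Rightarrow> _" where g: "continuous_on {0..1} g" "\<And>t. 0 \<le> t \<Longrightarrow> t \<le> 1 \<Longrightarrow> g t \<in> GLn (Suc 0)" "g 0 = dg 0 a" "g 1 = mone"
    using assms(2) by (auto elim: path_componentE)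
  have "conn (g 0 0 0) (g 1 0 0)"
  proof (rule path_componentI[of "\<lambda>t. g t 0 0"])
    show "continuous_on {0..1} (\<lambda>t. g t 0 0)" by (rule continuous_on_entry[OF g(1)])
    fix t :: real assume "0 \<le> t" "t \<le> 1"
    then obtain N where N: "N \<in> matR (Suc 0)" "mmul (Suc 0) (g t) N = mone" "mmul (Suc 0) N (g t) = mone" "g t \<in> matR (Suc 0)"
      using g(2)[of t] by (auto simp: GLn_def)
    have "g t 0 0 * N 0 0 = 1" "N 0 0 * g t 0 0 = 1"
      using fun_cong[OF fun_cong[OF N(2), of 0], of 0] fun_cong[OF fun_cong[OF N(3), of 0], of 0]
      by (simp_all add: mmul_def mone_def)
    then show "g t 0 0 \<in> GL" using N by (intro GLI invsI[of _ "N 0 0"]) (auto simp: matR_R)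
  qed
  then show ?thesis using g by (simp add: dg_def mone_def)
qed

end

section \<open>Unitary matrices\<close>

text \<open>The scale follows the element, so that this is a root of every positive a and still
  continuous along paths.\<close>

definition psqrt :: "'u::cstar_algebra_1 \<Rightarrow> 'u" where
  "psqrt a = csq (norm a + 1) a"

lemma
  assumes "cpos a"
  shows psqrt_square: "psqrt a * psqrt a = a" and cpos_psqrt: "cpos (psqrt a)"
  using csq_square[OF cpos_csq_norm[OF assms]] cpos_csq[OF cpos_csq_norm[OF assms] cpos_sa[OF assms]]
  by (simp_all add: psqrt_def)

lemma psqrt_invs: "cpos a \<Longrightarrow> a \<in> invs \<Longrightarrow> psqrt a \<in> invs"
  by (rule invs_square) (simp add: psqrt_square)

text \<open>For the positive root x the factor 1 + x is invertible, and its product with x - 1 is 0.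
  The fact makes Gram-Schmidt leave unitary matrices unchanged.\<close>

lemma psqrt_one: "psqrt (1::'u::cstar_algebra_1) = 1"
proof -
  let ?x = "psqrt (1::'u)"
  have x: "?x * ?x = 1" "cpos ?x" by (simp_all add: psqrt_square cpos_psqrt)
  have i: "1 + ?x \<in> invs" by (rule cpos_add_invs) (simp_all add: x)
  have "(1 + ?x) * (?x - 1) = 0" by (simp add: algebra_simps x)
  then have "uinv (1 + ?x) * ((1 + ?x) * (?x - 1)) = 0" by simp
  then show ?thesis using i by simp
qed

lemma continuous_on_psqrt:
  fixes f :: "real \<Rightarrow> 'u::cstar_algebra_1"
  assumes "continuous_on S f" "\<And>t. t \<in> S \<Longrightarrow> cpos (f t)"
  shows "continuous_on S (\<lambda>t. psqrt (f t))"
proof -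
  have n: "norm (f t) + 1 \<noteq> 0" for t using norm_ge_zero[of "f t"] by linarith
  have "continuous_on S (\<lambda>t. sqrt1m (1 - f t /\<^sub>R (norm (f t) + 1)))"
  proof (rule continuous_on_compose2[OF uniformly_continuous_imp_continuous[OF sqrt1m_uniformly_continuous]])
    show "continuous_on S (\<lambda>t. 1 - f t /\<^sub>R (norm (f t) + 1))"
      by (intro continuous_intros assms(1)) (use n in auto)
    show "(\<lambda>t. 1 - f t /\<^sub>R (norm (f t) + 1)) ` S \<subseteq> cball 0 1"
      using norm_one_minus_divide[OF cpos_csq_norm[OF assms(2)]] by auto
  qed
  then show ?thesis unfolding psqrt_def csq_def by (intro continuous_intros assms(1))
qed

section \<open>Gram-Schmidt orthonormalization over a C*-algebra\<close>

definition ip :: "nat \<Rightarrow> (nat \<Rightarrow> 'u::cstar_algebra_1) \<Rightarrow> (nat \<Rightarrow> 'u) \<Rightarrow> 'u" where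
  "ip n x y = (\<Sum>i<n. cstar (x i) * y i)"

lemma cstar_sum: "cstar (sum f I) = (\<Sum>i\<in>I. cstar (f i :: 'a::cstar_algebra))"
  by (induction I rule: infinite_finite_induct) (auto simp: cstar_add)

lemma ip_cstar: "cstar (ip n x y) = ip n y x"
  by (simp add: ip_def cstar_sum cstar_mult cstar_cstar)

lemma ip_diff_right: "ip n x (\<lambda>i. y i - z i) = ip n x y - ip n x z"
  by (simp add: ip_def right_diff_distrib sum_subtractf)

lemma ip_mult_right: "ip n x (\<lambda>i. y i * c) = ip n x y * c"
  by (simp add: ip_def sum_distrib_right mult.assoc)

lemma ip_sum_right: "ip n x (\<lambda>i. \<Sum>k\<in>K. y k i) = (\<Sum>k\<in>K. ip n x (y k))"
  unfolding ip_def sum_distrib_left by (rule sum.swap)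

lemma cpos_sum: "(\<And>i. i \<in> I \<Longrightarrow> cpos (f i)) \<Longrightarrow> cpos (sum f I)"
  by (induction I rule: infinite_finite_induct) (auto intro: cpos_add)

lemma cpos_ip: "cpos (ip n x x)"
  unfolding ip_def by (intro cpos_sum cpos_cstar_mult)

text \<open>A Cauchy-Schwarz inequality with an unspecified constant, which is enough for
  \<open>ip_invs\<close>.\<close>

lemma ip_bound:
  fixes r N :: "nat \<Rightarrow> 'u::cstar_algebra_1"
  obtains C where "C \<ge> 0" "cpos (C *\<^sub>R ip n r r - cstar (\<Sum>i<n. N i * r i) * (\<Sum>i<n. N i * r i))"
proof (induction n arbitrary: thesis)
  case 0
  show ?case by (rule 0[of 0]) (simp_all add: ip_def)
next
  case (Suc n)
  obtain C where C: "C \<ge> 0" "cpos (C *\<^sub>R ip n r r - cstar (\<Sum>i<n. N i * r i) * (\<Sum>i<n. N i * r i))"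
    using Suc.IH by blast
  define X where "X = (\<Sum>i<n. N i * r i)"
  define y where "y = N n * r n"
  define A where "A = ip n r r"
  define b where "b = cstar (r n) * r n"
  define K where "K = norm (cstar (N n) * N n)"
  have K: "K \<ge> 0" by (simp add: K_def)
  have "cpos (of_real K - cstar (N n) * N n)"
    by (rule cpos_of_real_minus) (simp_all add: K_def cstar_mult cstar_cstar)
  then have "cpos (cstar (r n) * (of_real K - cstar (N n) * N n) * r n)" by (rule cpos_conj)
  also have "cstar (r n) * (of_real K - cstar (N n) * N n) * r n = K *\<^sub>R b - cstar y * y"
    by (simp add: y_def b_def cstar_mult of_real_def algebra_simps)
  finally have 1: "cpos (K *\<^sub>R b - cstar y * y)" .
  have 2: "cpos (C *\<^sub>R A - cstar X * X)" using C by (simp add: X_def A_def)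
  have 3: "cpos A" "cpos b" by (simp_all add: A_def b_def cpos_ip cpos_cstar_mult)
  \<comment> \<open>By the parallelogram law the square of X + y is at most twice the squares of X
    and y; the last two summands raise both coefficients to the common value 2 (C + K).\<close>
  have "cpos (cstar (X - y) * (X - y) + (2 *\<^sub>R (C *\<^sub>R A - cstar X * X) + (2 *\<^sub>R (K *\<^sub>R b - cstar y * y)
      + ((2 * K) *\<^sub>R A + (2 * C) *\<^sub>R b))))"
    using 1 2 3 C K by (intro cpos_add cpos_cstar_mult cpos_scaleR) auto
  also have "cstar (X - y) * (X - y) + (2 *\<^sub>R (C *\<^sub>R A - cstar X * X) + (2 *\<^sub>R (K *\<^sub>R b - cstar y * y)
      + ((2 * K) *\<^sub>R A + (2 * C) *\<^sub>R b))) = (2 * (C + K)) *\<^sub>R (A + b) - cstar (X + y) * (X + y)"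
    by (simp add: cstar_add cstar_diff algebra_simps scaleR_2)
  finally show ?case
    using C K by (intro Suc.prems[of "2 * (C + K)"]) (simp_all add: ip_def A_def b_def X_def y_def)
qed

text \<open>\<open>ip_bound\<close> gives 1 <= C \<open>ip n r r\<close>: a column with a left
  inverse is bounded below. This is what permits Gram-Schmidt to divide by its length.\<close>

lemma ip_invs:
  fixes r N :: "nat \<Rightarrow> 'u::cstar_algebra_1"
  assumes "(\<Sum>i<n. N i * r i) = 1"
  shows "ip n r r \<in> invs"
proof -
  obtain C where C: "C \<ge> 0" "cpos (C *\<^sub>R ip n r r - 1)"
    using ip_bound[of n r N] assms by auto
  then have "cpos ((C + 1) *\<^sub>R ip n r r - 1)"
    using cpos_add[OF C(2) cpos_ip[of n r]] by (simp add: algebra_simps)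
  then have "cpos ((1 / (C + 1)) *\<^sub>R ((C + 1) *\<^sub>R ip n r r - 1))" using C(1) by (intro cpos_scaleR) auto
  also have "(1 / (C + 1)) *\<^sub>R ((C + 1) *\<^sub>R ip n r r - 1) = ip n r r - of_real (1 / (C + 1))"
    using C(1) by (simp add: scaleR_right_diff_distrib of_real_def)
  finally show ?thesis using C(1) by (intro bounded_below_invs[of "1 / (C + 1)"]) auto
qed

definition mstar :: "nat \<Rightarrow> 'u::cstar_algebra_1 imat \<Rightarrow> 'u imat" where
  "mstar n M = (\<lambda>i j. if i < n \<and> j < n then cstar (M j i) else mone i j)"

context ustar_sub
begin

definition Umat :: "nat \<Rightarrow> 'u imat set" where
  "Umat n = {M \<in> matR n. mmul n (mstar n M) M = mone \<and> mmul n M (mstar n M) = mone}"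

lemma mstar_matR: "M \<in> matR n \<Longrightarrow> mstar n M \<in> matR n"
  by (auto simp: matR_def mstar_def std_mat_def)

lemma Umat_GLn: "M \<in> Umat n \<Longrightarrow> M \<in> GLn n"
  unfolding Umat_def by (auto intro: GLnI[of _ _ "mstar n M"] mstar_matR)

lemma psqrt_R: "a \<in> R \<Longrightarrow> cpos a \<Longrightarrow> psqrt a \<in> R"
  unfolding psqrt_def by (rule csq_R[OF _ cpos_csq_norm])

lemma ip_R: "(\<And>i. x i \<in> R) \<Longrightarrow> (\<And>i. y i \<in> R) \<Longrightarrow> ip n x y \<in> R"
  unfolding ip_def by simp

text \<open>The invariant of the Gram-Schmidt process after m columns; the third clause says that rows of index at
  least m of a left inverse of G annihilate the columns found so far, which makes the next residue unimodular.\<close>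
definition gs_inv :: "nat \<Rightarrow> nat \<Rightarrow> 'u imat \<Rightarrow> 'u imat \<Rightarrow> bool" where
  "gs_inv n m G Q \<longleftrightarrow> (\<forall>i j. Q i j \<in> R)
    \<and> (\<forall>j<m. \<forall>k<m. ip n (\<lambda>i. Q i j) (\<lambda>i. Q i k) = mone j k)
    \<and> (\<forall>N. mmul n N G = mone \<longrightarrow> (\<forall>l<n. m \<le> l \<longrightarrow> (\<forall>k<m. (\<Sum>i<n. N l i * Q i k) = 0)))
    \<and> (\<forall>j<m. \<exists>T. \<forall>i<n. G i j = (\<Sum>k<m. Q i k * T k))
    \<and> (G \<in> Umat n \<longrightarrow> (\<forall>i<n. \<forall>j<m. Q i j = G i j))"

definition gs_residue :: "nat \<Rightarrow> nat \<Rightarrow> 'u imat \<Rightarrow> 'u imat \<Rightarrow> nat \<Rightarrow> 'u" where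
  "gs_residue n m G Q = (\<lambda>i. G i m - (\<Sum>k<m. Q i k * ip n (\<lambda>i. Q i k) (\<lambda>i. G i m)))"

definition gs_step :: "nat \<Rightarrow> nat \<Rightarrow> 'u imat \<Rightarrow> 'u imat \<Rightarrow> 'u imat" where
  "gs_step n m G Q = (let r = gs_residue n m G Q in
     (\<lambda>i j. if j = m then r i * uinv (psqrt (ip n r r)) else Q i j))"

lemma gs_step_inv:
  assumes G: "G \<in> GLn n" and m: "m < n" and inv: "gs_inv n m G Q"
  shows "ip n (gs_residue n m G Q) (gs_residue n m G Q) \<in> invs" "gs_inv n (Suc m) G (gs_step n m G Q)"
proof -
  define r where "r = gs_residue n m G Q"
  define a where "a = ip n r r"
  define w where "w = uinv (psqrt a)"
  define Q' where "Q' = gs_step n m G Q"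
  obtain N0 where N0: "mmul n N0 G = mone" using G by (auto simp: GLn_def)
  have GR: "G i j \<in> R" for i j using G by (auto simp: GLn_def matR_def)
  have QR: "Q i j \<in> R" for i j using inv by (simp add: gs_inv_def)
  have orth: "ip n (\<lambda>i. Q i j) (\<lambda>i. Q i k) = mone j k" if "j < m" "k < m" for j k using inv that by (simp add: gs_inv_def)
  have van: "(\<Sum>i<n. N l i * Q i k) = 0" if "mmul n N G = mone" "l < n" "m \<le> l" "k < m" for N l k
    using inv that by (simp add: gs_inv_def)
  have r: "r i = G i m - (\<Sum>k<m. Q i k * ip n (\<lambda>i. Q i k) (\<lambda>i. G i m))" for i by (simp add: r_def gs_residue_def)
  \<comment> \<open>Row l of a left inverse annihilates the old columns of Q, so on the residue it
    sees only column m of G. For l = m the value is 1, and the residue is left invertible.\<close>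
  have Nr: "(\<Sum>i<n. N l i * r i) = mone l m" if N: "mmul n N G = mone" and l: "l < n" "m \<le> l" for N l
  proof -
    have "(\<Sum>i<n. N l i * r i) = (\<Sum>i<n. N l i * G i m) - (\<Sum>i<n. \<Sum>k<m. N l i * Q i k * ip n (\<lambda>i. Q i k) (\<lambda>i. G i m))"
      by (simp add: r right_diff_distrib sum_subtractf sum_distrib_left mult.assoc)
    also have "(\<Sum>i<n. \<Sum>k<m. N l i * Q i k * ip n (\<lambda>i. Q i k) (\<lambda>i. G i m)) = (\<Sum>k<m. (\<Sum>i<n. N l i * Q i k) * ip n (\<lambda>i. Q i k) (\<lambda>i. G i m))"
      by (subst sum.swap) (simp add: sum_distrib_right)
    also have "\<dots> = 0" using van[OF N l] by (intro sum.neutral) auto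
    also have "(\<Sum>i<n. N l i * G i m) = mone l m"
      using fun_cong[OF fun_cong[OF N, of l], of m] l m by (simp add: mmul_def)
    finally show ?thesis by simp
  qed
  have "(\<Sum>i<n. N0 m i * r i) = 1" using Nr[OF N0 m] by (simp add: mone_def)
  then have ai: "a \<in> invs" unfolding a_def by (rule ip_invs)
  then show "ip n (gs_residue n m G Q) (gs_residue n m G Q) \<in> invs" by (simp add: a_def r_def)
  have ap: "cpos a" by (simp add: a_def cpos_ip)
  note pi = psqrt_invs[OF ap ai]
  have rR: "r i \<in> R" for i using GR QR by (simp add: r ip_R)
  have wR: "w \<in> R" using rR pi unfolding w_def by (intro uinv_R psqrt_R ap) (simp_all add: a_def ip_R)
  have ws: "cstar w = w" unfolding w_def using uinv_cstar[OF pi] cpos_sa[OF cpos_psqrt[OF ap]] by simp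
  have Q': "Q' i j = (if j = m then r i * w else Q i j)" for i j
    by (simp add: Q'_def gs_step_def Let_def w_def a_def r_def)
  have Qr: "ip n (\<lambda>i. Q i k) r = 0" if k: "k < m" for k
  proof -
    have "ip n (\<lambda>i. Q i k) r = ip n (\<lambda>i. Q i k) (\<lambda>i. G i m) - (\<Sum>l<m. mone k l * ip n (\<lambda>i. Q i l) (\<lambda>i. G i m))"
      unfolding r ip_diff_right ip_sum_right ip_mult_right using k by (simp add: orth)
    also have "(\<Sum>l<m. mone k l * ip n (\<lambda>i. Q i l) (\<lambda>i. G i m)) = ip n (\<lambda>i. Q i k) (\<lambda>i. G i m)"
      using k by (simp add: mone_def if_distrib[of "\<lambda>z. z * _"] cong: if_cong)
    finally show ?thesis by simp
  qed
  have rQ: "ip n r (\<lambda>i. Q i k) = 0" if k: "k < m" for k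
    using Qr[OF k] ip_cstar[of n "\<lambda>i. Q i k" r] by simp
  have ww: "ip n (\<lambda>i. r i * w) (\<lambda>i. r i * w) = 1"
  proof -
    have "ip n (\<lambda>i. r i * w) (\<lambda>i. r i * w) = w * a * w"
      by (simp add: ip_def a_def cstar_mult ws sum_distrib_left sum_distrib_right mult.assoc)
    also have "\<dots> = w * (psqrt a * psqrt a) * w" by (simp add: psqrt_square ap)
    also have "\<dots> = 1" using pi by (simp add: w_def mult.assoc)
    finally show ?thesis .
  qed
  have left: "ip n (\<lambda>i. r i * w) x = w * ip n r x" for x
    by (simp add: ip_def cstar_mult ws sum_distrib_left mult.assoc)
  show "gs_inv n (Suc m) G (gs_step n m G Q)"
    unfolding gs_inv_def Q'_def[symmetric]
  proof (intro conjI allI impI)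
    show "Q' i j \<in> R" for i j using QR rR wR by (simp add: Q')
    show "ip n (\<lambda>i. Q' i j) (\<lambda>i. Q' i k) = mone j k" if "j < Suc m" "k < Suc m" for j k
      using that orth[of j k] ww Qr[of j] rQ[of k]
      by (auto simp: Q' less_Suc_eq ip_mult_right left) (auto simp: mone_def)
    show "(\<Sum>i<n. N l i * Q' i k) = 0" if "mmul n N G = mone" "l < n" "Suc m \<le> l" "k < Suc m" for N l k
    proof (cases "k = m")
      case True
      have "(\<Sum>i<n. N l i * Q' i k) = (\<Sum>i<n. N l i * r i) * w"
        by (simp add: Q' True sum_distrib_right mult.assoc)
      then show ?thesis using Nr[of N l] that by (simp add: mone_def)
    qed (use van[of N l k] that in \<open>auto simp: Q'\<close>)
    show "\<exists>T. \<forall>i<n. G i j = (\<Sum>k<Suc m. Q' i k * T k)" if j: "j < Suc m" for j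
    proof (cases "j = m")
      case True
      show ?thesis
      proof (intro exI[of _ "\<lambda>k. if k = m then psqrt a else ip n (\<lambda>i. Q i k) (\<lambda>i. G i m)"] allI impI)
        fix i
        have "r i * w * psqrt a = r i" using pi by (simp add: w_def mult.assoc)
        then show "G i j = (\<Sum>k<Suc m. Q' i k * (if k = m then psqrt a else ip n (\<lambda>i. Q i k) (\<lambda>i. G i m)))"
          by (simp add: Q' True r)
      qed
    next
      case False
      then have "j < m" using j by simp
      moreover have "\<forall>j<m. \<exists>T. \<forall>i<n. G i j = (\<Sum>k<m. Q i k * T k)" using inv unfolding gs_inv_def by blast
      ultimately obtain T where "\<forall>i<n. G i j = (\<Sum>k<m. Q i k * T k)" by blast
      then show ?thesis by (intro exI[of _ "T(m := 0)"]) (simp add: Q')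
    qed
    \<comment> \<open>For orthonormal columns the projection coefficients vanish and the length is
      1. Thus unitary end points of a path remain fixed.\<close>
    show "Q' i j = G i j" if U: "G \<in> Umat n" and i: "i < n" and j: "j < Suc m" for i j
    proof -
      have QG: "Q i k = G i k" if "i < n" "k < m" for i k using inv U that by (simp add: gs_inv_def)
      have GG: "ip n (\<lambda>i. G i k) (\<lambda>i. G i l) = mone k l" if "k < n" "l < n" for k l
      proof -
        have "mmul n (mstar n G) G k l = mone k l" using U by (simp add: Umat_def)
        then show ?thesis using that by (simp add: mmul_def mstar_def ip_def)
      qed
      have ipc: "ip n (\<lambda>i. Q i k) (\<lambda>i. G i m) = 0" if "k < m" for k
      proof -
        have "ip n (\<lambda>i. Q i k) (\<lambda>i. G i m) = ip n (\<lambda>i. G i k) (\<lambda>i. G i m)"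
          unfolding ip_def by (rule sum.cong) (auto simp: QG that)
        then show ?thesis using GG[of k m] that m by (simp add: mone_def)
      qed
      have rG: "r i = G i m" for i by (simp add: r ipc)
      have "a = 1" unfolding a_def rG using GG[OF m m] by (simp add: mone_def)
      then have "w = 1" by (simp add: w_def psqrt_one)
      then show ?thesis using j QG[OF i, of j] by (auto simp: Q' rG less_Suc_eq)
    qed
  qed
qed

lemma gram_schmidt_path:
  assumes g: "\<And>i j. continuous_on {0..1} (\<lambda>t. g t i j)" "\<And>t. t \<in> {0..1} \<Longrightarrow> g t \<in> GLn n" and "m \<le> n"
  shows "\<exists>Q :: real \<Rightarrow> 'u imat. (\<forall>i j. continuous_on {0..1} (\<lambda>t. Q t i j)) \<and> (\<forall>t\<in>{0..1}. gs_inv n m (g t) (Q t))"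
  using \<open>m \<le> n\<close>
proof (induction m)
  case 0
  show ?case by (rule exI[of _ "\<lambda>t i j. 0"]) (simp add: gs_inv_def)
next
  case (Suc m)
  then obtain Q :: "real \<Rightarrow> 'u imat" where Q: "\<And>i j. continuous_on {0..1} (\<lambda>t. Q t i j)" "\<And>t. t \<in> {0..1} \<Longrightarrow> gs_inv n m (g t) (Q t)"
    by (metis Suc_leD)
  have cr: "continuous_on {0..1} (\<lambda>t. gs_residue n m (g t) (Q t) i)" for i
    unfolding gs_residue_def ip_def
    by (intro continuous_on_diff continuous_on_sum continuous_on_mult continuous_on_cstar g Q)
  have cp: "continuous_on {0..1} (\<lambda>t. psqrt (ip n (gs_residue n m (g t) (Q t)) (gs_residue n m (g t) (Q t))))"
    by (rule continuous_on_psqrt[OF _ cpos_ip]) (unfold ip_def, intro continuous_on_sum continuous_on_mult continuous_on_cstar cr)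
  show ?case
  proof (intro exI[of _ "\<lambda>t. gs_step n m (g t) (Q t)"] conjI allI ballI)
    fix i j
    show "continuous_on {0..1} (\<lambda>t. gs_step n m (g t) (Q t) i j)"
    proof (cases "j = m")
      case True
      show ?thesis unfolding gs_step_def Let_def if_P[OF True]
        by (intro continuous_on_mult continuous_on_uinv cr cp psqrt_invs cpos_ip gs_step_inv(1))
          (use Suc.prems g(2) Q(2) in auto)
    qed (simp add: gs_step_def Let_def Q)
  qed (use gs_step_inv(2) Suc.prems g(2) Q(2) in auto)
qed

lemma Umat_path:
  assumes "connn n U mone" "U \<in> Umat n"
  shows "path_component (Umat n) U mone"
proof -
  obtain g :: "real \<Rightarrow> _" where g: "continuous_on {0..1} g" "\<And>t. 0 \<le> t \<Longrightarrow> t \<le> 1 \<Longrightarrow> g t \<in> GLn n" "g 0 = U" "g 1 = mone"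
    by (rule path_componentE[OF assms(1)]) blast
  obtain Q :: "real \<Rightarrow> 'u imat" where Q: "\<And>i j. continuous_on {0..1} (\<lambda>t. Q t i j)" "\<And>t. t \<in> {0..1} \<Longrightarrow> gs_inv n n (g t) (Q t)"
  proof -
    have "g t \<in> GLn n" if "t \<in> {0..1}" for t using g(2) that by simp
    from gram_schmidt_path[OF continuous_on_entry[OF g(1)] this order_refl] show ?thesis using that by blast
  qed
  define V where "V = (\<lambda>t i j. if i < n \<and> j < n then Q t i j else mone i j)"
  have V: "V t \<in> Umat n" if t: "t \<in> {0..1}" for t
  proof -
    have QR: "Q t i j \<in> R" for i j using Q(2)[OF t] by (simp add: gs_inv_def)
    have VR: "V t \<in> matR n" using QR by (auto simp: matR_def std_mat_def V_def)
    have 1: "mmul n (mstar n (V t)) (V t) = mone"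
    proof (rule std_matI_eq)
      fix j k assume jk: "j < n" "k < n"
      then have "ip n (\<lambda>i. Q t i j) (\<lambda>i. Q t i k) = mone j k" using Q(2)[OF t] by (simp add: gs_inv_def)
      then show "mmul n (mstar n (V t)) (V t) j k = mone j k" using jk by (simp add: mmul_def mstar_def V_def ip_def)
    qed simp_all
    \<comment> \<open>Orthonormality of the columns only says that the adjoint of V is a left
      inverse. Since g t = V T is invertible, V has a right inverse too, which must equal the
      adjoint.\<close>
    have "\<forall>j<n. \<exists>T. \<forall>i<n. g t i j = (\<Sum>k<n. Q t i k * T k)" using Q(2)[OF t] by (simp add: gs_inv_def)
    then obtain T where T: "\<And>i j. i < n \<Longrightarrow> j < n \<Longrightarrow> g t i j = (\<Sum>k<n. Q t i k * T j k)" by metis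
    have gt: "g t \<in> GLn n" using g(2) t by simp
    then obtain N where N: "mmul n (g t) N = mone" by (auto simp: GLn_def)
    have "g t = mmul n (V t) (\<lambda>k j. T j k)"
      by (rule std_matI_eq[of n]) (use gt in \<open>auto simp: GLn_def matR_std T mmul_def V_def\<close>, auto simp: std_mat_def mmul_def)
    then have 2: "mmul n (V t) (mmul n (\<lambda>k j. T j k) N) = mone" using N by (simp add: mmul_assoc)
    define W where "W = mmul n (\<lambda>k j. T j k) N"
    have "mmul n (mstar n (V t)) (mmul n (V t) W) = mmul n (mmul n (mstar n (V t)) (V t)) W" by (simp add: mmul_assoc)
    then have "mstar n (V t) = W" using 1 2 mmul_mone_left[of n W] mmul_mone_right[OF matR_std[OF mstar_matR[OF VR]]]
      by (simp add: W_def)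
    then show ?thesis using 1 2 VR by (simp add: Umat_def W_def)
  qed
  have "path_component (Umat n) (V 0) (V 1)"
  proof (rule path_componentI)
    show "continuous_on {0..1} V"
    proof (intro continuous_on_coordinatewise_then_product)
      show "continuous_on {0..1} (\<lambda>t. V t i j)" for i j
        unfolding V_def by (cases "i < n \<and> j < n") (auto simp: Q)
    qed
  qed (use V in auto)
  moreover have "V t = g t" if "t \<in> {0..1}" "g t \<in> Umat n" for t
  proof (rule std_matI_eq[of n])
    show "std_mat n (V t)" by (auto simp: V_def std_mat_def)
    show "std_mat n (g t)" using that(2) by (auto simp: Umat_def matR_def)
    show "V t i j = g t i j" if "i < n" "j < n" for i j
      using Q(2)[OF \<open>t \<in> {0..1}\<close>] \<open>g t \<in> Umat n\<close> that by (simp add: gs_inv_def V_def)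
  qed
  moreover have "mone \<in> Umat n"
  proof -
    have "mstar n mone = (mone :: 'u imat)" by (auto simp: mstar_def mone_def fun_eq_iff)
    then show ?thesis by (simp add: Umat_def matR_def mmul_mone_left)
  qed
  ultimately show ?thesis using g(3,4) assms(2) by simp
qed

end

section \<open>Hereditary subalgebras\<close>

lemma cstar_subalgebra_scaleR: "cstar_subalgebra B \<Longrightarrow> x \<in> B \<Longrightarrow> r *\<^sub>R x \<in> B"
  by (metis cscale_of_real cstar_subalgebra_def)

lemma cstar_subalgebra_diff: "cstar_subalgebra B \<Longrightarrow> x \<in> B \<Longrightarrow> y \<in> B \<Longrightarrow> x - y \<in> B"
proof -
  assume B: "cstar_subalgebra B" "x \<in> B" "y \<in> B"
  have "- y \<in> B" using cstar_subalgebra_scaleR[OF B(1,3), of "-1"] by simp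
  then have "x + - y \<in> B" using B unfolding cstar_subalgebra_def by blast
  then show ?thesis by simp
qed

text \<open>2 - c has a self-adjoint root s in the unitization, and x = s b lies in A because A is
  an ideal there; the difference is \<open>cstar x * x\<close>.\<close>

lemma positive_conj_minus:
  fixes b c :: "'a::cstar_algebra"
  assumes "cstar c = c" "norm c \<le> 1"
  shows "positive (2 *\<^sub>R (cstar b * b) - cstar b * c * b)"
proof -
  define z where "z = 2 *\<^sub>R 1 - Uni c 0"
  have n: "norm (of_real 2 - z) \<le> 2" using assms by (simp add: z_def of_real_def)
  have sz: "cstar z = z" using assms by (intro uni_eqI) (simp_all add: z_def)
  define s where "s = csq 2 z"
  have s: "s * s = z" "cstar s = s" unfolding s_def using csq_square[OF n] csq_sa[OF n] sz by auto
  define x where "x = uvec (s * Uni b 0)"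
  have x: "s * Uni b 0 = Uni x 0" by (rule uni_eqI) (simp_all add: x_def)
  have "Uni (cstar x * x) 0 = cstar (Uni x 0) * Uni x 0" by (rule uni_eqI) simp_all
  also have "\<dots> = cstar (Uni b 0) * (s * s) * Uni b 0"
    unfolding x[symmetric] by (simp only: cstar_mult s(2) mult.assoc)
  also have "\<dots> = Uni (2 *\<^sub>R (cstar b * b) - cstar b * c * b) 0"
    unfolding s z_def by (rule uni_eqI) (simp_all add: algebra_simps cscale_mult_left cscale_mult_right cscale_scaleR_left)
  finally have "cstar x * x = 2 *\<^sub>R (cstar b * b) - cstar b * c * b" by simp
  then show ?thesis unfolding positive_def by metis
qed

text \<open>Adding 2 \<open>cstar b * b\<close> gives an element between 0 and 4
  \<open>cstar b * b\<close>, to which heredity applies.\<close>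

lemma hereditary_conj_contraction:
  assumes "hereditary B" "b \<in> B" "cstar c = c" "norm c \<le> 1"
  shows "cstar b * c * b \<in> B"
proof -
  have sub: "cstar_subalgebra B" using assms(1) by (simp add: hereditary_def)
  have bb: "cstar b * b \<in> B" using sub assms(2) by (auto simp: cstar_subalgebra_def)
  let ?a = "2 *\<^sub>R (cstar b * b) + cstar b * c * b"
  have "positive ?a" using positive_conj_minus[of "- c" b] assms by simp
  moreover have "4 *\<^sub>R (cstar b * b) - ?a = 2 *\<^sub>R (cstar b * b) - cstar b * c * b"
    using scaleR_left_distrib[of 2 2 "cstar b * b"] by simp
  then have "positive (4 *\<^sub>R (cstar b * b) - ?a)" using positive_conj_minus[OF assms(3,4), of b] by (simp only:)
  moreover have "4 *\<^sub>R (cstar b * b) \<in> B" by (rule cstar_subalgebra_scaleR[OF sub bb])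
  ultimately have "?a \<in> B" using assms(1) unfolding hereditary_def by blast
  then have "?a - 2 *\<^sub>R (cstar b * b) \<in> B" by (intro cstar_subalgebra_diff sub cstar_subalgebra_scaleR bb)
  then show ?thesis by simp
qed

lemma hereditary_conj:
  assumes "hereditary B" "b \<in> B"
  shows "cstar b * c * b \<in> B"
proof -
  have sub: "cstar_subalgebra B" using assms(1) by (simp add: hereditary_def)
  have sa: "cstar b * c * b \<in> B" if "cstar c = c" for c
  proof -
    define k where "k = norm c + 1"
    have k: "k > 0" by (simp add: k_def add_nonneg_pos)
    have "cstar b * (c /\<^sub>R k) * b \<in> B"
      by (rule hereditary_conj_contraction[OF assms]) (use k that in \<open>simp_all add: k_def field_simps\<close>)
    then have "k *\<^sub>R (cstar b * (c /\<^sub>R k) * b) \<in> B" by (rule cstar_subalgebra_scaleR[OF sub])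
    then show ?thesis using k by simp
  qed
  define p q where "p = c + cstar c" and "q = cscale \<i> (c - cstar c)"
  have "cstar p = p" "cstar q = q"
    by (simp_all add: p_def q_def cstar_add cstar_cscale cstar_diff cstar_cstar add.commute cscale_diff_right)
  then have pq: "cstar b * p * b \<in> B" "cscale (- \<i>) (cstar b * q * b) \<in> B"
    using sa sub unfolding cstar_subalgebra_def by blast+
  have "cscale (- \<i>) (cstar b * q * b) = cstar b * (c - cstar c) * b"
    by (simp add: q_def cscale_mult_left cscale_mult_right cscale_assoc)
  then have "cstar b * p * b + cstar b * (c - cstar c) * b \<in> B" using pq sub by (simp add: cstar_subalgebra_def)
  then have "(1/2) *\<^sub>R (cstar b * p * b + cstar b * (c - cstar c) * b) \<in> B" by (rule cstar_subalgebra_scaleR[OF sub])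
  moreover have "cstar b * p * b + cstar b * (c - cstar c) * b = 2 *\<^sub>R (cstar b * c * b)"
    by (simp add: p_def algebra_simps scaleR_2)
  ultimately show ?thesis by simp
qed

text \<open>Polarization of \<open>hereditary_conj\<close>: with f = \<open>cstar b\<close> the sum
  \<open>cstar f * c * d + cstar d * c * f\<close> lies in B, and replacing d by i d gives the
  difference as well.\<close>

lemma hereditary_sandwich:
  assumes B: "hereditary B" and "b \<in> B" "d \<in> B"
  shows "b * c * d \<in> B"
proof -
  have sub: "cstar_subalgebra B" using assms(1) by (simp add: hereditary_def)
  define f where "f = cstar b"
  have f: "f \<in> B" using sub assms(2) by (simp add: f_def cstar_subalgebra_def)
  have P: "cstar f * c * d' + cstar d' * c * f \<in> B" if "d' \<in> B" for d'
  proof -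
    have "f + d' \<in> B" using f that sub by (simp add: cstar_subalgebra_def)
    then have "cstar (f + d') * c * (f + d') - cstar f * c * f - cstar d' * c * d' \<in> B"
      by (intro cstar_subalgebra_diff[OF sub] hereditary_conj[OF B] f that)
    then show ?thesis by (simp add: cstar_add algebra_simps)
  qed
  have id: "cscale \<i> d \<in> B" using sub assms(3) by (simp add: cstar_subalgebra_def)
  have "cscale (- \<i>) (cstar f * c * cscale \<i> d + cstar (cscale \<i> d) * c * f) \<in> B"
    using P[OF id] sub unfolding cstar_subalgebra_def by blast
  then have "cstar f * c * d - cstar d * c * f \<in> B"
    by (simp add: cstar_cscale cscale_mult_left cscale_mult_right cscale_add_right cscale_diff_right cscale_assoc)
  then have "(cstar f * c * d + cstar d * c * f) + (cstar f * c * d - cstar d * c * f) \<in> B"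
    using P[OF assms(3)] sub unfolding cstar_subalgebra_def by blast
  then have "(1/2) *\<^sub>R ((cstar f * c * d + cstar d * c * f) + (cstar f * c * d - cstar d * c * f)) \<in> B"
    by (rule cstar_subalgebra_scaleR[OF sub])
  moreover have "(cstar f * c * d + cstar d * c * f) + (cstar f * c * d - cstar d * c * f) = 2 *\<^sub>R (cstar f * c * d)"
    by (simp add: scaleR_2)
  ultimately show ?thesis by (simp add: f_def cstar_cstar)
qed

section \<open>The unitization of a hereditary subalgebra\<close>

text \<open>The unitization of B, realised inside that of A with the same adjoined unit.\<close>

definition UB :: "'a::cstar_algebra set \<Rightarrow> 'a uni set" where
  "UB B = {x. uvec x \<in> B}"

definition IB :: "'a::cstar_algebra set \<Rightarrow> 'a uni set" where
  "IB B = {x. uvec x \<in> B \<and> uscal x = 0}"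

lemma mem_UB: "x \<in> UB B \<longleftrightarrow> uvec x \<in> B"
  by (simp add: UB_def)

lemma mem_IB: "x \<in> IB B \<longleftrightarrow> uvec x \<in> B \<and> uscal x = 0"
  by (simp add: IB_def)

lemma IB_sandwich:
  assumes "hereditary B" "b \<in> IB B" "d \<in> IB B"
  shows "b * z * d \<in> IB B"
proof -
  have sub: "cstar_subalgebra B" using assms(1) by (simp add: hereditary_def)
  have 1: "uvec b * uvec z * uvec d \<in> B" using hereditary_sandwich[OF assms(1)] assms by (simp add: mem_IB)
  have "uvec b * uvec d \<in> B" using assms sub by (simp add: mem_IB cstar_subalgebra_def)
  then have "cscale (uscal z) (uvec b * uvec d) \<in> B" using sub by (simp add: cstar_subalgebra_def)
  with 1 have "uvec b * uvec z * uvec d + cscale (uscal z) (uvec b * uvec d) \<in> B" using sub by (simp add: cstar_subalgebra_def)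
  then show ?thesis using assms by (simp add: mem_IB distrib_right cscale_mult_left)
qed

lemma IB_closure:
  assumes "cstar_subalgebra B" "x \<in> IB B" "y \<in> IB B"
  shows "x + y \<in> IB B" "x - y \<in> IB B" "x * y \<in> IB B" "cstar x \<in> IB B" "r *\<^sub>R x \<in> IB B"
  using assms cstar_subalgebra_diff[OF assms(1)] cstar_subalgebra_scaleR[OF assms(1)]
  by (auto simp: mem_IB cstar_subalgebra_def)

lemma ustar_sub_UB:
  assumes B: "hereditary B"
  shows "ustar_sub (UB B)"
proof
  have sub: "cstar_subalgebra B" using B by (simp add: hereditary_def)
  have UB: "UB B = uvec -` B" by (auto simp: mem_UB)
  show "closed (UB B)" unfolding UB
    by (intro closed_vimage continuous_on_vec continuous_on_id) (use sub in \<open>simp add: cstar_subalgebra_def\<close>)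
  show "1 \<in> UB B" using sub by (simp add: mem_UB cstar_subalgebra_def)
  show "x + y \<in> UB B" "x * y \<in> UB B" if "x \<in> UB B" "y \<in> UB B" for x y
    using that sub by (auto simp: mem_UB cstar_subalgebra_def)
  show "cscale c x \<in> UB B" "cstar x \<in> UB B" if "x \<in> UB B" for c x
    using that sub by (auto simp: mem_UB cstar_subalgebra_def)
  \<comment> \<open>Let x = b + l with l scalar and l' its inverse. Solving x y = 1 and y x = 1 for
    y and inserting one into the other gives y = l' - l'^2 b + l'^2 b y b, where the unknown y is
    sandwiched by b.\<close>
  fix x assume x: "x \<in> UB B" "x \<in> invs"
  define y where "y = uinv x"
  define m where "m = uscal y"
  define b where "b = Uni (uvec x) 0"
  define l where "l = Uni (0::'a) (uscal x)"
  define l' where "l' = Uni (0::'a) m"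
  have xy: "x * y = 1" "y * x = 1" using x by (simp_all add: y_def)
  have "uscal x * m = 1" using arg_cong[OF xy(1), of uscal] by (simp add: m_def)
  then have ll: "l' * l = 1" by (intro uni_eqI) (simp_all add: l_def l'_def mult.commute)
  have cent: "l' * z = z * l'" for z
    by (rule uni_eqI) (simp_all add: l'_def mult.commute)
  have xb: "x = b + l" by (rule uni_eqI) (simp_all add: b_def l_def)
  have "l' * (x * y) = l' * b * y + y"
    unfolding xb by (simp add: distrib_left distrib_right mult.assoc[symmetric] ll)
  then have y1: "y = l' - l' * b * y" using xy by (simp add: algebra_simps)
  have "l' * (y * x) = l' * (y * b) + y"
    unfolding xb by (simp add: distrib_left mult.assoc) (metis cent ll mult.assoc mult.left_neutral mult.right_neutral)
  then have y2: "y = l' - l' * (y * b)" using xy by (simp add: algebra_simps)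
  have "y = l' - l' * b * (l' - l' * (y * b))" using y1 y2 by metis
  also have "\<dots> = l' - l' * l' * b + l' * l' * (b * y * b)"
    by (simp add: algebra_simps) (metis cent mult.assoc)
  finally have y: "y = l' - l' * l' * b + l' * l' * (b * y * b)" .
  have bI: "b \<in> IB B" using x by (simp add: b_def mem_IB mem_UB)
  have "uvec (l' * l' * z) \<in> B" if "z \<in> IB B" for z
    using that sub by (simp add: l'_def mem_IB cstar_subalgebra_def)
  then have "uvec (l' * l' * (b * y * b)) \<in> B" "uvec (l' * l' * b) \<in> B" using IB_sandwich[OF B bI bI] bI by blast+
  then have "uvec (l' * l' * (b * y * b)) - uvec (l' * l' * b) \<in> B" by (rule cstar_subalgebra_diff[OF sub])
  moreover have "uvec y = uvec (l' * l' * (b * y * b)) - uvec (l' * l' * b)"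
    by (subst y) (simp add: l'_def)
  ultimately show "uinv x \<in> UB B" by (simp add: mem_UB y_def)
qed

text \<open>m dominates both \<open>cstar a * a\<close> and \<open>a * cstar a\<close>, so h = m (c
  + m)^-1 serves on both sides. Since 1 - h = c (c + m)^-1, one finds (1 - h) m (1 - h) <= c, and c
  is the square of e/2.\<close>

lemma approx_unit:
  assumes B: "hereditary B" and a: "a \<in> IB B" and e: "e > 0"
  obtains h where "h \<in> IB B" "norm (a - h * a) < e" "norm (a - a * h) < e"
proof
  have sub: "cstar_subalgebra B" using B by (simp add: hereditary_def)
  define m where "m = cstar a * a + a * cstar a"
  define c where "c = (e / 2) * (e / 2)"
  have c: "c > 0" using e by (simp add: c_def)
  have m: "cpos m" "m \<in> IB B"
    using IB_closure[OF sub] a by (auto simp: m_def intro: cpos_add cpos_cstar_mult cpos_mult_cstar)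
  define k where "k = of_real c + m"
  have k: "k \<in> invs" by (rule bounded_below_invs[OF c]) (simp add: k_def m)
  define v where "v = uinv k"
  have v: "k * v = 1" "v * k = 1" "k * (v * z) = z" "v * (k * z) = z" for z using k by (simp_all add: v_def)
  have mv: "m * v = v * m"
  proof -
    have "m * k = k * m" by (simp add: k_def algebra_simps of_real_commute)
    then have "v * (m * k) * v = v * (k * m) * v" by simp
    then show ?thesis by (simp add: v mult.assoc)
  qed
  have vs: "cstar v = v"
  proof -
    have "cstar k = k" using cpos_sa[OF m(1)] by (simp add: k_def cstar_add)
    then show ?thesis using uinv_cstar[OF k] by (simp add: v_def)
  qed
  define h where "h = m * v"
  have one: "1 - h = c *\<^sub>R v"
  proof -
    have "k * v = c *\<^sub>R v + m * v" by (simp add: k_def distrib_right of_real_def)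
    then show ?thesis by (simp add: v h_def algebra_simps)
  qed
  have "c *\<^sub>R h = m - m * v * m"
  proof -
    have "c *\<^sub>R h = m * (1 - h)" unfolding one by (simp add: h_def)
    also have "\<dots> = m - m * (m * v)" by (simp add: h_def right_diff_distrib)
    also have "m * (m * v) = m * (v * m)" by (rule arg_cong[OF mv])
    finally show ?thesis by (simp only: mult.assoc)
  qed
  \<comment> \<open>v is not in B, but in c h = m - m v m it stands between two elements of
    B.\<close>
  moreover have "m - m * v * m \<in> IB B"
    using IB_sandwich[OF B m(2) m(2)] IB_closure(2)[OF sub m(2)] by blast
  ultimately have "(1 / c) *\<^sub>R (c *\<^sub>R h) \<in> IB B" using IB_closure(5)[OF sub _ m(2)] by metis
  then show "h \<in> IB B" using c by simp
  have bound: "norm (x * (1 - h)) < e" if x: "cpos (m - cstar x * x)" for x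
  proof -
    define w where "w = 1 - h"
    have w: "w = c *\<^sub>R v" "cstar w = w" by (simp_all add: w_def one vs)
    have "cpos (cstar w * (m - cstar x * x) * w)" by (rule cpos_conj[OF x])
    then have 1: "cpos (w * m * w - cstar (x * w) * (x * w))" by (simp add: w(2) cstar_mult algebra_simps)
    \<comment> \<open>With k = c + m this sum is c k^2 - c^2 m; conjugation by v = k^-1 turns it
      into c - w m w.\<close>
    have "cpos (c *\<^sub>R ((c * c) *\<^sub>R 1 + c *\<^sub>R m + m * m))"
      using c by (intro cpos_scaleR cpos_add cpos_square cpos_sa cpos_1 m(1)) auto
    then have "cpos (cstar v * (c *\<^sub>R ((c * c) *\<^sub>R 1 + c *\<^sub>R m + m * m)) * v)" by (rule cpos_conj)
    also have "c *\<^sub>R ((c * c) *\<^sub>R 1 + c *\<^sub>R m + m * m) = c *\<^sub>R (k * k) - (c * c) *\<^sub>R m"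
      by (simp add: k_def of_real_def algebra_simps)
    also have "cstar v * \<dots> * v = of_real c - w * m * w"
      by (simp add: vs w(1) algebra_simps v) (simp add: of_real_def)
    finally have "cpos (of_real c - w * m * w)" .
    from cpos_add[OF this 1] have "cpos (of_real c - cstar (x * w) * (x * w))" by simp
    then have "norm (cstar (x * w) * (x * w)) \<le> c" by (rule cpos_norm_le[OF cpos_cstar_mult])
    then have "norm (x * w) * norm (x * w) \<le> (e / 2) * (e / 2)" by (simp add: norm_cstar_mult c_def)
    then have "(norm (x * w))\<^sup>2 \<le> (e / 2)\<^sup>2" by (simp add: power2_eq_square)
    then have "norm (x * w) \<le> e / 2" by (rule power2_le_imp_le) (use e in simp)
    then show ?thesis using e by (simp add: w_def)
  qed
  have "norm (a * (1 - h)) < e" by (rule bound) (simp add: m_def cpos_mult_cstar)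
  then show "norm (a - a * h) < e" by (simp add: algebra_simps)
  have hs: "cstar h = h" by (simp add: h_def cstar_mult vs cpos_sa[OF m(1)] mv)
  have "norm (cstar a * (1 - h)) < e" by (rule bound) (simp add: m_def cpos_cstar_mult cstar_cstar)
  moreover have "cstar (cstar a * (1 - h)) = a - h * a" by (simp add: cstar_mult cstar_diff cstar_cstar hs algebra_simps)
  ultimately show "norm (a - h * a) < e" by (metis norm_cstar)
qed

text \<open>The perturbation d need not lie in the hereditary subalgebra; moving h to the other side by
  Jacobson's trick sandwiches it there.\<close>
lemma jacobson_compress:
  fixes a h d :: "'u::{real_normed_algebra_1,banach}"
  assumes "1 + h * a - d \<in> invs" "norm d \<le> 1/2"
  shows "1 - d \<in> invs" "1 + a * uinv (1 - d) * h \<in> invs"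
    "norm (a * h - a * uinv (1 - d) * h) \<le> 2 * norm a * norm d * norm h"
proof -
  have n: "norm (1 - (1 - d)) < 1" using assms(2) by simp
  show i: "1 - d \<in> invs" by (rule neumann_invs(1)[OF n])
  define r where "r = uinv (1 - d)"
  have r: "(1 - d) * r = 1" using i by (simp add: r_def)
  have "norm r \<le> 1 / (1 - norm d)" using neumann_invs(2)[OF n] by (simp add: r_def)
  also have "\<dots> \<le> 2" using assms(2) by (simp add: field_simps)
  finally have nr: "norm r \<le> 2" .
  have "(1 + h * a - d) * r = (1 - d) * r + h * (a * r)" by (simp add: algebra_simps)
  then have "(1 + h * a - d) * r = 1 + h * (a * r)" using r by simp
  moreover have "(1 + h * a - d) * r \<in> invs" using assms(1) i by (simp add: r_def invs_mult)
  ultimately show "1 + a * uinv (1 - d) * h \<in> invs" using jacobson_invs[of h "a * r"] by (simp add: r_def)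
  have "1 - r = - (d * r)" using r by (simp add: algebra_simps)
  moreover have "a * h - a * r * h = a * (1 - r) * h" by (simp add: algebra_simps)
  ultimately have "a * h - a * r * h = - (a * (d * r) * h)" by simp
  then have "norm (a * h - a * r * h) = norm (a * (d * r) * h)" by simp
  also have "\<dots> \<le> norm a * norm (d * r) * norm h" by (rule norm_mult3_ineq)
  also have "\<dots> \<le> norm a * (norm d * 2) * norm h"
    by (intro mult_right_mono mult_left_mono order_trans[OF norm_mult_ineq]) (use nr in \<open>auto intro: mult_left_mono\<close>)
  finally show "norm (a * h - a * uinv (1 - d) * h) \<le> 2 * norm a * norm d * norm h" by (simp add: r_def mult_ac)
qed

lemma Uni_scal_invs: "c \<noteq> 0 \<Longrightarrow> Uni (0::'a::cstar_algebra) c \<in> invs"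
  by (rule invsI[of _ "Uni 0 (inverse c)"]) (rule uni_eqI; simp)+

text \<open>1 + a is close to 1 + a h, the Jacobson counterpart of 1 + h a. An invertible element
  near the latter exists only in the unitization of A; \<open>jacobson_compress\<close> turns it
  into one of the unitization of B near the former.\<close>

lemma UB_dense:
  fixes B :: "'a::cstar_algebra set"
  assumes B: "hereditary B" and dense: "\<And>(x::'a uni) e. e > 0 \<Longrightarrow> \<exists>y\<in>invs. norm (x - y) < e"
  shows "ustar_sub_dense (UB B)"
proof -
  interpret ustar_sub "UB B" by (rule ustar_sub_UB[OF B])
  have sub: "cstar_subalgebra B" using B by (simp add: hereditary_def)
  have one: "\<exists>y\<in>GL. norm (1 + a - y) < e" if a: "a \<in> IB B" and e: "e > 0" for a e
  proof -
    obtain h where h: "h \<in> IB B" "norm (a - h * a) < e/2" "norm (a - a * h) < e/2"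
      using approx_unit[OF B a, of "e/2"] e by auto
    define K where "K = 2 * norm a * norm h + 1"
    have K: "K > 0" by (simp add: K_def add_nonneg_pos)
    obtain g where g: "g \<in> invs" "norm (1 + h * a - g) < min (1/2) (e / (2 * K))"
      using dense[of "min (1/2) (e / (2 * K))" "1 + h * a"] e K by auto
    define d where "d = 1 + h * a - g"
    have dinv: "1 + h * a - d \<in> invs" "norm d \<le> 1/2" using g by (simp_all add: d_def)
    note j = jacobson_compress[OF dinv]
    let ?y = "1 + a * uinv (1 - d) * h"
    have "?y \<in> UB B"
      using IB_sandwich[OF B a h(1), of "uinv (1 - d)"] by (simp add: mem_IB mem_UB)
    then have "?y \<in> GL" using j by (intro GLI)
    moreover have "norm (1 + a - ?y) < e"
    proof -
      have "1 + a - ?y = (a - a * h) + (a * h - a * uinv (1 - d) * h)" by simp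
      then have "norm (1 + a - ?y) \<le> norm (a - a * h) + norm (a * h - a * uinv (1 - d) * h)" by (metis norm_triangle_ineq)
      also have "norm (a * h - a * uinv (1 - d) * h) \<le> norm d * K"
        using order_trans[OF j(3), of "norm d * K"] by (simp add: K_def algebra_simps)
      also have "norm d * K \<le> e / 2" using g K by (simp add: d_def field_simps)
      finally show ?thesis using h by simp
    qed
    ultimately show ?thesis by blast
  qed
  show ?thesis
  proof
    fix x and e :: real assume x: "x \<in> UB B" and e: "e > 0"
    \<comment> \<open>Elements with scalar part 0 are never invertible, so 0 is replaced by
      e/2.\<close>
    define l where "l = (if uscal x = 0 then complex_of_real (e / 2) else uscal x)"
    have l: "l \<noteq> 0" "cmod (uscal x - l) \<le> e / 2" using e by (auto simp: l_def)
    define a where "a = Uni (cscale (inverse l) (uvec x)) 0"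
    have a: "a \<in> IB B" using x sub by (simp add: a_def mem_IB mem_UB cstar_subalgebra_def)
    obtain y where y: "y \<in> GL" "norm (1 + a - y) < e / (2 * cmod l)"
      using one[OF a, of "e / (2 * cmod l)"] e l by auto
    let ?z = "Uni 0 l * y"
    have zR: "Uni (0::'a) l \<in> UB B" using sub by (simp add: mem_UB cstar_subalgebra_def)
    have "?z \<in> GL" using y zR Uni_scal_invs[OF l(1)] by (intro GL_mult GLI) auto
    moreover have "norm (x - ?z) < e"
    proof -
      have "x = Uni 0 (uscal x - l) + Uni 0 l * (1 + a)"
        by (rule uni_eqI) (use l in \<open>simp_all add: a_def cscale_assoc\<close>)
      then have "x - ?z = Uni 0 (uscal x - l) + Uni 0 l * (1 + a - y)" by (simp add: algebra_simps)
      then have "norm (x - ?z) \<le> cmod (uscal x - l) + cmod l * norm (1 + a - y)"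
        using norm_triangle_ineq[of "Uni (0::'a) (uscal x - l)" "Uni 0 l * (1 + a - y)"]
          norm_mult_ineq[of "Uni (0::'a) l" "1 + a - y"] by simp
      also have "cmod l * norm (1 + a - y) < e / 2" using y l by (simp add: field_simps)
      finally show ?thesis using l by simp
    qed
    ultimately show "\<exists>y\<in>GL. norm (x - y) < e" by blast
  qed
qed

lemma UB_connected:
  fixes B :: "'a::cstar_algebra set"
  assumes B: "hereditary B"
    and paths: "\<And>(f::real \<Rightarrow> 'a uni) e. continuous_on {0..1} f \<Longrightarrow> (\<And>t. uscal (f t) = 1) \<Longrightarrow> e > 0 \<Longrightarrow>
      \<exists>g. continuous_on {0..1} g \<and> (\<forall>t\<in>{0..1}. g t \<in> invs \<and> norm (f t - g t) < e)"
    and x: "x \<in> ustar_sub.GL (UB B)"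
  shows "path_component (ustar_sub.GL (UB B)) x 1"
proof -
  interpret ustar_sub "UB B" by (rule ustar_sub_UB[OF B])
  have sub: "cstar_subalgebra B" using B by (simp add: hereditary_def)
  define l where "l = uscal x"
  have "uscal x * uscal (uinv x) = 1" using x by (metis GL_invs uinv_right uni_sel(4) uni_sel(12))
  then have l: "l \<noteq> 0" by (auto simp: l_def)
  have cl: "conn (Uni 0 l) 1"
  proof -
    have "path_connected (- {0::complex})" by (rule path_connected_punctured_universe) simp
    then have "path_component (- {0}) l 1" using l by (auto simp: path_connected_component)
    then obtain p :: "real \<Rightarrow> complex" where p: "continuous_on {0..1} p" "\<And>t. 0 \<le> t \<Longrightarrow> t \<le> 1 \<Longrightarrow> p t \<in> - {0}" "p 0 = l" "p 1 = 1"
      by (rule path_componentE) blast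
    have "conn (Uni 0 (p 0)) (Uni 0 (p 1))"
      by (rule path_componentI[of "\<lambda>t. Uni 0 (p t)"]) (use p sub in \<open>auto intro!: continuous_intros GLI Uni_scal_invs simp: mem_UB cstar_subalgebra_def\<close>)
    then show ?thesis using p by (simp add: one_uni_def)
  qed
  define a where "a = Uni (cscale (inverse l) (uvec x)) 0"
  have a: "a \<in> IB B" using x sub GL_R[OF x] by (simp add: a_def mem_IB mem_UB cstar_subalgebra_def)
  have xa: "x = Uni 0 l * (1 + a)" by (rule uni_eqI) (use l in \<open>simp_all add: a_def cscale_assoc l_def\<close>)
  have "1 + a \<in> invs" using x Uni_scal_invs[OF l] by (metis invs_mult_cancel_left xa GL_invs)
  then have aG: "1 + a \<in> GL" using a by (intro GLI) (simp_all add: mem_IB mem_UB)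
  \<comment> \<open>Half the perturbation radius of 1 + a: the error of \<open>h\<close> and that of
    the approximating path add up to less than 2e.\<close>
  define e where "e = 1 / (2 * (norm (uinv (1 + a)) + 1))"
  have e: "e > 0" by (simp add: e_def add_nonneg_pos)
  obtain h where h: "h \<in> IB B" "norm (a - h * a) < e" "norm (a - a * h) < e"
    using approx_unit[OF B a e] .
  define K where "K = 2 * norm a * norm h + 1"
  have K: "K > 0" by (simp add: K_def add_nonneg_pos)
  define f where "f = (\<lambda>t. 1 + h * ((1 - t) *\<^sub>R a))"
  have "uscal (f t) = 1" for t using h a by (simp add: f_def mem_IB)
  moreover have "continuous_on {0..1} f" unfolding f_def by (intro continuous_intros)
  moreover have "min (1/2) (e / K) > 0" using e K by simp
  ultimately obtain g where g: "continuous_on {0..1} g" "\<And>t. t \<in> {0..1} \<Longrightarrow> g t \<in> invs \<and> norm (f t - g t) < min (1/2) (e / K)"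
    using paths[of f "min (1/2) (e / K)"] by blast
  define d where "d = (\<lambda>t. f t - g t)"
  have d: "1 + h * ((1 - t) *\<^sub>R a) - d t \<in> invs" "norm (d t) \<le> 1/2" if "t \<in> {0..1}" for t
    using g(2)[OF that] by (simp_all add: d_def f_def)
  note j = jacobson_compress[OF d]
  \<comment> \<open>The factor 1 - t stands at a, so \<open>G 1\<close> is exactly 1 whatever d is,
    and only the end t = 0 needs correction.\<close>
  define G where "G = (\<lambda>t. 1 + ((1 - t) *\<^sub>R a) * uinv (1 - d t) * h)"
  have cd: "continuous_on {0..1} d" unfolding d_def f_def by (intro continuous_intros g)
  have "conn (G 0) (G 1)"
  proof (rule path_componentI)
    show "continuous_on {0..1} G" unfolding G_def by (intro continuous_intros cd j(1))
    fix t :: real assume "0 \<le> t" "t \<le> 1"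
    then have t: "t \<in> {0..1}" by simp
    have "(1 - t) *\<^sub>R a \<in> IB B" using IB_closure(5)[OF sub a a] .
    then have "G t \<in> UB B" using IB_sandwich[OF B _ h(1), of "(1 - t) *\<^sub>R a" "uinv (1 - d t)"]
      by (simp add: G_def mem_IB mem_UB)
    then show "G t \<in> GL" using j(2)[OF t t] by (intro GLI) (simp_all add: G_def)
  qed
  moreover have "conn (1 + a) (G 0)"
  proof (rule conn_near[OF aG])
    show "G 0 \<in> UB B" using IB_sandwich[OF B a h(1), of "uinv (1 - d 0)"] by (simp add: G_def mem_IB mem_UB)
    have "1 + a - G 0 = (a - a * h) + (a * h - a * uinv (1 - d 0) * h)" by (simp add: G_def)
    then have "norm (1 + a - G 0) \<le> norm (a - a * h) + norm (a * h - a * uinv (1 - d 0) * h)" by (metis norm_triangle_ineq)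
    also have "norm (a * h - a * uinv (1 - d 0) * h) \<le> norm (d 0) * K"
      using order_trans[OF j(3)[of 0], of "norm (d 0) * K"] by (simp add: K_def algebra_simps)
    also have "norm (d 0) * K \<le> e" using g(2)[of 0] K by (simp add: d_def field_simps)
    finally have "norm (1 + a - G 0) < 2 * e" using h by simp
    then have "norm (1 + a - G 0) * norm (uinv (1 + a)) \<le> 2 * e * norm (uinv (1 + a))" by (intro mult_right_mono) auto
    also have "\<dots> < 1" by (simp add: e_def divide_less_eq add_nonneg_pos)
    finally show "norm (1 + a - G 0) * norm (uinv (1 + a)) < 1" .
  qed
  ultimately have "conn (1 + a) 1" by (simp add: G_def) (meson path_component_trans)
  then have "conn (Uni 0 l * (1 + a)) (1 * 1)" by (intro conn_mult cl)
  then show ?thesis using xa by simp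
qed

section \<open>Translation between the two kinds of matrices\<close>

text \<open>Matrices of the statement are padded by 0, those used above by the identity. After the
  change of padding, \<open>mat_diag_one\<close> has no effect on the matrix.\<close>

definition of_mat :: "nat \<Rightarrow> (nat \<Rightarrow> nat \<Rightarrow> 'a \<times> complex) \<Rightarrow> 'a::cstar_algebra uni imat" where
  "of_mat n M = (\<lambda>i j. if i < n \<and> j < n then Uni (fst (M i j)) (snd (M i j)) else mone i j)"

definition to_mat :: "nat \<Rightarrow> 'a::cstar_algebra uni imat \<Rightarrow> (nat \<Rightarrow> nat \<Rightarrow> 'a \<times> complex)" where
  "to_mat n V = (\<lambda>i j. if i < n \<and> j < n then (uvec (V i j), uscal (V i j)) else 0)"

definition upair :: "'a \<times> complex \<Rightarrow> 'a uni" where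
  "upair p = Uni (fst p) (snd p)"

lemma upair_mult: "upair (uni_mult cscale p q) = upair p * upair (q :: 'a::cstar_algebra \<times> complex)"
  by (rule uni_eqI) (simp_all add: upair_def uni_mult_def)

lemma upair_add: "upair (p + q) = upair p + upair (q :: 'a::cstar_algebra \<times> complex)"
  by (rule uni_eqI) (simp_all add: upair_def)

lemma upair_zero: "upair 0 = (0 :: 'a::cstar_algebra uni)"
  by (simp add: upair_def zero_uni_def)

lemma upair_one: "upair (0, 1) = (1 :: 'a::cstar_algebra uni)"
  by (simp add: upair_def one_uni_def)

lemma upair_sum: "upair (sum f I) = (\<Sum>i\<in>I. upair (f i :: 'a::cstar_algebra \<times> complex))"
  by (induction I rule: infinite_finite_induct) (auto simp: upair_add upair_zero)

lemma upair_star: "upair (uni_star p) = cstar (upair (p :: 'a::cstar_algebra \<times> complex))"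
  by (rule uni_eqI) (simp_all add: upair_def uni_star_def)

lemma mat_mult_of_mat: "of_mat n (mat_mult n M N) = mmul n (of_mat n M) (of_mat n N)"
  by (auto simp: of_mat_def mat_mult_def mmul_def fun_eq_iff upair_def[symmetric] upair_sum upair_mult)

lemma mat_star_of_mat: "of_mat n (mat_star n M) = mstar n (of_mat n M)"
  by (auto simp: of_mat_def mat_star_def mstar_def fun_eq_iff upair_def[symmetric] upair_star)

lemma of_mat_one: "of_mat n (mat_one n) = mone"
  by (auto simp: of_mat_def mat_one_def mone_def fun_eq_iff zero_uni_def one_uni_def)

lemma of_mat_inj:
  assumes "of_mat n M = of_mat n N" "\<And>i j. \<not> (i < n \<and> j < n) \<Longrightarrow> M i j = N i j"
  shows "M = N"
proof (intro ext)
  fix i j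
  show "M i j = N i j"
    using fun_cong[OF fun_cong[OF assms(1), of i], of j] assms(2)[of i j]
    by (cases "i < n \<and> j < n") (auto simp: of_mat_def prod_eq_iff)
qed

lemma of_to_mat: "std_mat n V \<Longrightarrow> of_mat n (to_mat n V) = V"
  by (auto simp: of_mat_def to_mat_def std_mat_def fun_eq_iff)

lemma unitary_mat_iff:
  fixes B :: "'a::cstar_algebra set"
  assumes B: "hereditary B"
  shows "unitary_mat B n U \<longleftrightarrow> of_mat n U \<in> ustar_sub.Umat (UB B) n \<and> (\<forall>i j. \<not> (i < n \<and> j < n) \<longrightarrow> U i j = 0)"
proof -
  interpret ustar_sub "UB B" by (rule ustar_sub_UB[OF B])
  have z: "0 \<in> B" using B by (simp add: hereditary_def cstar_subalgebra_def)
  have m: "is_mat B n U \<longleftrightarrow> of_mat n U \<in> matR n \<and> (\<forall>i j. \<not> (i < n \<and> j < n) \<longrightarrow> U i j = 0)"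
    using z by (auto simp: is_mat_def matR_def std_mat_def of_mat_def mem_UB mone_def)
  have e: "mat_mult n X Y = mat_one n \<longleftrightarrow> mmul n (of_mat n X) (of_mat n Y) = mone" for X Y :: "nat \<Rightarrow> nat \<Rightarrow> 'a \<times> complex"
  proof
    assume "mmul n (of_mat n X) (of_mat n Y) = mone"
    then have "of_mat n (mat_mult n X Y) = of_mat n (mat_one n)" by (simp add: mat_mult_of_mat of_mat_one)
    then show "mat_mult n X Y = mat_one n"
      by (rule of_mat_inj) (auto simp: mat_mult_def mat_one_def)
  qed (metis mat_mult_of_mat of_mat_one)
  show ?thesis unfolding unitary_mat_def Umat_def m e mat_star_of_mat by auto
qed

lemma K1_trivial_of_connected:
  fixes B :: "'a::cstar_algebra set"
  assumes B: "hereditary B" and dense: "ustar_sub_dense (UB B)"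
    and conn: "\<And>x. x \<in> ustar_sub.GL (UB B) \<Longrightarrow> path_component (ustar_sub.GL (UB B)) x 1"
  shows "K1_trivial B"
  unfolding K1_trivial_def
proof (intro allI impI)
  interpret ustar_sub_dense "UB B" by (rule dense)
  fix n and U :: "nat \<Rightarrow> nat \<Rightarrow> 'a \<times> complex" assume "unitary_mat B n U"
  then have U: "of_mat n U \<in> Umat n" "\<And>i j. \<not> (i < n \<and> j < n) \<Longrightarrow> U i j = 0"
    using unitary_mat_iff[OF B] by auto
  have "connn n (of_mat n U) mone"
    by (rule GLn_connected[OF conn pivot_exists Umat_GLn[OF U(1)]])
  then have "path_component (Umat n) (of_mat n U) mone" by (rule Umat_path[OF _ U(1)])
  then obtain V :: "real \<Rightarrow> _" where V: "continuous_on {0..1} V" "\<And>t. 0 \<le> t \<Longrightarrow> t \<le> 1 \<Longrightarrow> V t \<in> Umat n" "V 0 = of_mat n U" "V 1 = mone"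
    by (rule path_componentE) blast
  show "\<exists>k \<gamma>. (\<forall>t::real\<in>{0..1}. unitary_mat B (n + k) (\<gamma> t)) \<and>
        (\<forall>i j. continuous_on {0..1} (\<lambda>t. \<gamma> t i j)) \<and>
        \<gamma> 0 = mat_diag_one n k U \<and> \<gamma> 1 = mat_one (n + k)"
  proof (intro exI[of _ "0::nat"] exI[of _ "\<lambda>t. to_mat n (V t)"] conjI ballI allI)
    fix t :: real assume "t \<in> {0..1}"
    then have Vt: "V t \<in> Umat n" using V(2) by simp
    then have "of_mat n (to_mat n (V t)) = V t" by (intro of_to_mat) (simp add: Umat_def matR_std)
    then show "unitary_mat B (n + 0) (to_mat n (V t))"
      using Vt by (simp add: unitary_mat_iff[OF B]) (simp add: to_mat_def)
  next
    fix i j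
    show "continuous_on {0..1} (\<lambda>t. to_mat n (V t) i j)"
      using continuous_on_entry[OF V(1), of i j]
      by (cases "i < n \<and> j < n") (auto simp: to_mat_def intro!: continuous_on_Pair continuous_on_vec continuous_on_scal)
  next
    show "to_mat n (V 0) = mat_diag_one n 0 U"
      using U(2) by (auto simp: V(3) to_mat_def of_mat_def mat_diag_one_def fun_eq_iff)
    show "to_mat n (V 1) = mat_one (n + 0)"
      by (auto simp: V(4) to_mat_def mat_one_def mone_def fun_eq_iff zero_prod_def)
  qed
qed

text \<open>Vanishing of K_1 gives a path only after stabilisation of the 1 by 1 matrix u;
  \<open>conn_of_connn\<close> brings it down to size 1 again.\<close>

lemma unitary_connected_of_K1_trivial:
  assumes B: "hereditary B" and dense: "ustar_sub_dense (UB B)" and K1: "K1_trivial B"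
    and u: "u \<in> UB B" "unitary u"
  shows "path_component (ustar_sub.GL (UB B)) u 1"
proof -
  interpret ustar_sub_dense "UB B" by (rule dense)
  have uG: "u \<in> GL" using u by (intro GLI unitary_invs)
  define U where "U = to_mat 1 (dg 0 u)"
  have std: "std_mat (Suc 0) (dg 0 u)" by (auto simp: std_mat_def dg_def)
  have ofU: "of_mat 1 U = dg 0 u" using std by (simp add: U_def of_to_mat)
  have "dg 0 u \<in> Umat 1"
    using u std by (auto simp: Umat_def matR_def dg_def unitary_def mmul_def mstar_def mone_def fun_eq_iff)
  moreover have "U i j = 0" if "\<not> (i < 1 \<and> j < 1)" for i j unfolding U_def to_mat_def using that by (simp only: if_False)
  ultimately have "unitary_mat B 1 U" unfolding unitary_mat_iff[OF B] ofU by blast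
  then obtain k \<gamma> where g: "\<And>t::real. t \<in> {0..1} \<Longrightarrow> unitary_mat B (1 + k) (\<gamma> t)"
      "\<And>i j. continuous_on {0..1} (\<lambda>t. \<gamma> t i j)" "\<gamma> 0 = mat_diag_one 1 k U" "\<gamma> 1 = mat_one (1 + k)"
    using K1 unfolding K1_trivial_def by meson
  have "connn (Suc k) (of_mat (1 + k) (\<gamma> 0)) (of_mat (1 + k) (\<gamma> 1))"
  proof (rule connnI)
    show "continuous_on {0..1} (\<lambda>t. of_mat (1 + k) (\<gamma> t) i j)" for i j
      unfolding of_mat_def
      by (cases "i < 1 + k \<and> j < 1 + k") (auto intro!: continuous_on_Uni continuous_on_fst continuous_on_snd g)
    show "of_mat (1 + k) (\<gamma> t) \<in> GLn (Suc k)" if "0 \<le> t" "t \<le> 1" for t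
      using g(1)[of t] that unitary_mat_iff[OF B] Umat_GLn by auto
  qed
  moreover have "of_mat (1 + k) (\<gamma> 1) = mone" unfolding g by (rule of_mat_one)
  moreover have "of_mat (1 + k) (\<gamma> 0) = dg 0 u"
    unfolding g by (auto simp: of_mat_def mat_diag_one_def U_def to_mat_def dg_def mone_def fun_eq_iff one_uni_def zero_uni_def)
  ultimately show ?thesis using conn_of_connn[OF uG, of k] by simp
qed

section \<open>Paths of invertible elements\<close>

lemma ustar_sub_UNIV: "ustar_sub (UNIV :: 'u::cstar_algebra_1 set)"
  by standard auto

text \<open>The scalar part of the square of a self-adjoint element is a nonnegative real number,
  which excludes -1.\<close>

lemma uscal_cpos_eq_1:
  fixes h :: "'a::cstar_algebra uni"
  assumes "cpos h" "uscal h * uscal h = 1" shows "uscal h = 1"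
proof -
  obtain x where x: "cstar x = x" "h = x * x" using assms(1) by (auto simp: cpos_def)
  have "cnj (uscal x) = uscal x" using arg_cong[OF x(1), of uscal] by simp
  then obtain r where r: "uscal x = complex_of_real r" by (metis Reals_cnj_iff Reals_cases)
  have h: "uscal h = complex_of_real (r * r)" by (simp add: x(2) r)
  then have "complex_of_real ((r * r) * (r * r)) = complex_of_real 1" using assms(2) by simp
  then have "(r * r) * (r * r) = 1" by (simp only: of_real_eq_iff)
  then have "r * r = 1 \<or> r * r = -1" by (simp add: square_eq_1_iff)
  then have "r * r = 1" using zero_le_square[of r] by linarith
  then show ?thesis by (simp add: h)
qed

text \<open>From 0 <= a <= b and n b n = 0 follows n a n = 0, and a = \<open>cstar x * x\<close>
  turns this into x n = 0. When n is the part of a positive h above a level, these are the elements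
  living where h is below it.\<close>

lemma hereditary_annihilator:
  fixes n :: "'a::cstar_algebra uni"
  assumes n: "cstar n = n"
  shows "hereditary {b. Uni b 0 * n = 0 \<and> n * Uni b 0 = 0}" (is "hereditary ?B")
  unfolding hereditary_def cstar_subalgebra_def
proof (intro conjI ballI allI impI)
  have emb: "Uni (a + b) 0 = Uni a 0 + Uni b 0" "Uni (a * b) 0 = Uni a 0 * Uni b 0"
     "Uni (cscale c a) 0 = cscale c (Uni a 0)" "Uni (cstar a) 0 = cstar (Uni a 0)" "Uni (a - b) 0 = Uni a 0 - Uni b 0" for a b :: 'a and c
    by (rule uni_eqI; simp)+
  have B: "?B = {b. Uni b 0 * n = 0} \<inter> {b. n * Uni b 0 = 0}" by auto
  show "closed ?B" unfolding B
    by (intro closed_Int closed_Collect_eq continuous_intros)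
  show "0 \<in> ?B" using zero_uni_def[where ?'a = 'a] by simp
  show "x + y \<in> ?B" "x * y \<in> ?B" if "x \<in> ?B" "y \<in> ?B" for x y
    using that by (simp_all add: emb distrib_left distrib_right mult.assoc) (simp add: mult.assoc[symmetric])
  show "cscale c x \<in> ?B" if "x \<in> ?B" for c x
    using that by (simp add: emb cscale_mult_left cscale_mult_right)
  show cs: "cstar x \<in> ?B" if "x \<in> ?B" for x
  proof -
    have "cstar (n * Uni x 0) = 0" "cstar (Uni x 0 * n) = 0" using that by simp_all
    then show ?thesis by (simp add: cstar_mult n emb)
  qed
  fix a b assume ab: "b \<in> ?B \<and> positive a \<and> positive (b - a)"
  then obtain x z where x: "a = cstar x * x" and z: "b - a = cstar z * z" by (auto simp: positive_def)
  let ?x = "Uni x 0" and ?z = "Uni z 0"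
  have a: "Uni a 0 = cstar ?x * ?x" and ba: "Uni b 0 - Uni a 0 = cstar ?z * ?z"
    by (simp_all add: x emb) (metis emb x z)
  have "cstar n * Uni a 0 * n = cstar (?x * n) * (?x * n)" by (simp add: a cstar_mult mult.assoc)
  moreover have "cstar n * (Uni b 0 - Uni a 0) * n = - (cstar n * Uni a 0 * n)"
    using ab by (simp add: n right_diff_distrib left_diff_distrib)
  moreover have "cpos (cstar n * (Uni b 0 - Uni a 0) * n)" unfolding ba by (intro cpos_conj cpos_cstar_mult)
  ultimately have "cpos (- (cstar (?x * n) * (?x * n)))" by simp
  then have "cstar (?x * n) * (?x * n) = 0"
    using cpos_add_eq_0(1)[OF cpos_cstar_mult] by (metis add.right_inverse)
  then have xn: "?x * n = 0" by simp
  then have an: "Uni a 0 * n = 0" by (simp add: a mult.assoc)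
  moreover have "n * Uni a 0 = cstar (Uni a 0 * n)" by (simp add: a cstar_mult cstar_cstar n)
  ultimately show "a \<in> ?B" by simp
qed

lemma csq_uniformly_continuous:
  fixes c e :: real
  assumes c: "c > 0" and e: "e > 0"
  obtains d where "d > 0" "\<And>a b :: 'u::cstar_algebra_1. norm (of_real c - a) \<le> c \<Longrightarrow> norm (of_real c - b) \<le> c \<Longrightarrow> norm (a - b) < d \<Longrightarrow> norm (csq c a - csq c b) < e"
proof -
  have "e / sqrt c > 0" using c e by simp
  then obtain d where d: "d > 0" "\<And>x x' :: 'u. x \<in> cball 0 1 \<Longrightarrow> x' \<in> cball 0 1 \<Longrightarrow> dist x' x < d \<Longrightarrow> dist (sqrt1m x') (sqrt1m x) < e / sqrt c"
    using sqrt1m_uniformly_continuous unfolding uniformly_continuous_on_def by metis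
  show thesis
  proof (rule that[of "d * c"])
    show "d * c > 0" using d c by simp
    fix a b :: 'u assume ab: "norm (of_real c - a) \<le> c" "norm (of_real c - b) \<le> c" "norm (a - b) < d * c"
    have "(1 - a /\<^sub>R c) - (1 - b /\<^sub>R c) = - ((a - b) /\<^sub>R c)" by (simp add: scaleR_right_diff_distrib)
    then have "dist (1 - a /\<^sub>R c) (1 - b /\<^sub>R c) = norm (a - b) / c" using c by (simp add: dist_norm divide_inverse mult.commute)
    then have "dist (1 - a /\<^sub>R c) (1 - b /\<^sub>R c) < d" using ab(3) c by (simp only: pos_divide_less_eq)
    then have "norm (sqrt1m (1 - a /\<^sub>R c) - sqrt1m (1 - b /\<^sub>R c)) < e / sqrt c"
      using d(2)[of "1 - b /\<^sub>R c" "1 - a /\<^sub>R c"] norm_one_minus_divide[OF ab(1) c] norm_one_minus_divide[OF ab(2) c]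
      by (simp only: dist_norm[of "sqrt1m _"] mem_cball dist_0_norm)
    moreover have "csq c a - csq c b = sqrt c *\<^sub>R (sqrt1m (1 - a /\<^sub>R c) - sqrt1m (1 - b /\<^sub>R c))"
      by (simp add: csq_def scaleR_right_diff_distrib)
    then have "norm (csq c a - csq c b) = norm (sqrt1m (1 - a /\<^sub>R c) - sqrt1m (1 - b /\<^sub>R c)) * sqrt c"
      using c by (simp add: mult.commute)
    ultimately show "norm (csq c a - csq c b) < e" using c by (simp only: pos_less_divide_eq real_sqrt_gt_zero)
  qed
qed

text \<open>Polar decomposition along the path, then division by the scalar part, a number of
  modulus 1; neither moves the ends. Scalar part 1 puts x - 1 into B itself, where multiplication by
  h has a small effect.\<close>

lemma unitary_path_one_scal:
  fixes B :: "'a::cstar_algebra set"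
  assumes B: "hereditary B" and c: "path_component (ustar_sub.GL (UB B)) w 1"
    and w: "unitary w" "uscal w = 1"
  shows "path_component {x \<in> UB B. unitary x \<and> uscal x = 1} w 1"
proof -
  interpret ustar_sub "UB B" by (rule ustar_sub_UB[OF B])
  obtain g :: "real \<Rightarrow> _" where g: "continuous_on {0..1} g" "\<And>t. 0 \<le> t \<Longrightarrow> t \<le> 1 \<Longrightarrow> g t \<in> GL" "g 0 = w" "g 1 = 1"
    by (rule path_componentE[OF c]) blast
  define h where "h = (\<lambda>t. psqrt (cstar (g t) * g t))"
  have ch: "continuous_on {0..1} h"
    unfolding h_def by (intro continuous_on_psqrt continuous_intros g cpos_cstar_mult)
  have p: "h t \<in> GL" "unitary (g t * uinv (h t))" if "0 \<le> t" "t \<le> 1" for t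
    using polar(3,4)[OF g(2)[OF that], of "norm (cstar (g t) * g t) + 1"]
    by (simp_all add: h_def psqrt_def norm_cstar_mult add_nonneg_pos)
  define v where "v = (\<lambda>t. g t * uinv (h t))"
  have cv: "continuous_on {0..1} v" unfolding v_def by (intro continuous_intros g ch) (use p in auto)
  define W where "W = (\<lambda>t. Uni 0 (cnj (uscal (v t))) * v t)"
  have sc: "cnj (uscal x) * uscal x = 1" if "unitary x" for x :: "'a uni"
  proof -
    have "cstar x * x = 1" using that by (simp add: unitary_def)
    from arg_cong[OF this, of uscal] show ?thesis by simp
  qed
  have z: "0 \<in> B" using B by (simp add: hereditary_def cstar_subalgebra_def)
  have "path_component {x \<in> UB B. unitary x \<and> uscal x = 1} (W 0) (W 1)"
  proof (rule path_componentI)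
    show "continuous_on {0..1} W" unfolding W_def by (intro continuous_intros cv)
    fix t :: real assume t: "0 \<le> t" "t \<le> 1"
    have v: "unitary (v t)" using p(2)[OF t] by (simp add: v_def)
    have vR: "v t \<in> UB B" unfolding v_def using p(1)[OF t] g(2)[OF t] by auto
    have "unitary (Uni (0::'a) (cnj (uscal (v t))))"
      unfolding unitary_def using sc[OF v] by (auto intro!: uni_eqI simp: mult.commute)
    then have "unitary (W t)" unfolding W_def by (rule unitary_mult[OF _ v])
    moreover have "W t \<in> UB B" unfolding W_def by (rule mult_R[OF _ vR]) (simp add: mem_UB z)
    ultimately show "W t \<in> {x \<in> UB B. unitary x \<and> uscal x = 1}" using sc[OF v] by (simp add: W_def)
  qed
  moreover have "W 0 = w"
    using w g(3) by (simp add: W_def v_def h_def unitary_def psqrt_one flip: one_uni_def)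
  moreover have "W 1 = 1" using g(4) by (simp add: W_def v_def h_def psqrt_one flip: one_uni_def)
  ultimately show ?thesis by simp
qed

text \<open>Write p = u h and q = v k by polar decomposition. The unitary w = u^* v is close to 1 except on the
  part where h is small, hence close to 1 + b with b in a hereditary subalgebra B of elements x such that
  the norm of x h is at most e times that of x. A path of unitaries in the unitization of B from 1 to w then
  yields a path from p to q that stays close to p.\<close>
lemma local_connectivity:
  fixes e C :: real
  assumes dense: "\<And>(x::'a::cstar_algebra uni) e. e > 0 \<Longrightarrow> \<exists>y\<in>invs. norm (x - y) < e"
    and K1: "\<And>B::'a set. hereditary B \<Longrightarrow> K1_trivial B"
    and e: "e > 0" and C: "C > 0"
  obtains d where "d > 0" "\<And>p q :: 'a uni. p \<in> invs \<Longrightarrow> q \<in> invs \<Longrightarrow> uscal p = 1 \<Longrightarrow> uscal q = 1 \<Longrightarrow>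
     norm p \<le> C \<Longrightarrow> norm q \<le> C \<Longrightarrow> norm (p - q) < d \<Longrightarrow> path_component {z \<in> invs. norm (z - p) < e} p q"
proof -
  \<comment> \<open>The elements x met in the unitization of B have norm (x - 1) at most 5/2, and
    5/2 r < e. The ratio 16 of r to \<open>s0\<close> makes the distance from w to w' less than 4 s0
    / r = 1/4.\<close>
  define r where "r = e / 8"
  define s0 where "s0 = r / 16"
  have r: "r > 0" "s0 > 0" using e by (simp_all add: r_def s0_def)
  define c where "c = C * C"
  have c: "c > 0" using C by (simp add: c_def)
  obtain d0 where d0: "d0 > 0" "\<And>a b :: 'a uni. norm (of_real c - a) \<le> c \<Longrightarrow> norm (of_real c - b) \<le> c \<Longrightarrow> norm (a - b) < d0 \<Longrightarrow> norm (csq c a - csq c b) < s0"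
    using csq_uniformly_continuous[OF c r(2)] by metis
  define d where "d = min s0 (d0 / (2 * C))"
  have d: "d > 0" using r d0 C by (simp add: d_def)
  show thesis
  proof (rule that[OF d])
    fix p q :: "'a uni"
    assume p: "p \<in> invs" and q: "q \<in> invs" and sp: "uscal p = 1" and sq: "uscal q = 1"
      and np: "norm p \<le> C" and nq: "norm q \<le> C" and pq: "norm (p - q) < d"
    interpret U: ustar_sub "UNIV :: 'a uni set" by (rule ustar_sub_UNIV)
    have GLU: "U.GL = invs" by (auto simp: U.GL_def)
    define h where "h = csq c (cstar p * p)"
    define k where "k = csq c (cstar q * q)"
    have npc: "norm p * norm p \<le> c" and nqc: "norm q * norm q \<le> c" unfolding c_def using np nq C by (auto intro: mult_mono)
    have h: "h * h = cstar p * p" "cpos h" "h \<in> invs" "unitary (p * uinv h)"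
      using U.polar[of p c] p npc c by (simp_all add: h_def GLU)
    have k: "k * k = cstar q * q" "cpos k" "k \<in> invs" "unitary (q * uinv k)"
      using U.polar[of q c] q nqc c by (simp_all add: k_def GLU)
    define u where "u = p * uinv h"
    define v where "v = q * uinv k"
    have u: "unitary u" "p = u * h" and v: "unitary v" "q = v * k" using h k by (simp_all add: u_def v_def mult.assoc)
    have hk: "norm (h - k) < s0"
      unfolding h_def k_def
    proof (rule d0(2))
      show "norm (of_real c - cstar p * p) \<le> c" "norm (of_real c - cstar q * q) \<le> c"
        using npc nqc by (auto intro!: cpos_norm cpos_cstar_mult simp: norm_cstar_mult)
      have "cstar p * p - cstar q * q = cstar p * (p - q) + cstar (p - q) * q" by (simp add: cstar_diff algebra_simps)
      then have "norm (cstar p * p - cstar q * q) \<le> norm (cstar p * (p - q)) + norm (cstar (p - q) * q)"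
        by (metis norm_triangle_ineq)
      also have "\<dots> \<le> norm p * norm (p - q) + norm (p - q) * norm q"
        by (intro add_mono order_trans[OF norm_mult_ineq]) simp_all
      also have "\<dots> \<le> C * norm (p - q) + norm (p - q) * C"
        by (intro add_mono mult_right_mono mult_left_mono np nq) auto
      also have "\<dots> < d0" using pq C by (simp add: d_def field_simps)
      finally show "norm (cstar p * p - cstar q * q) < d0" .
    qed
    have sh: "uscal h = 1"
      by (rule uscal_cpos_eq_1[OF h(2)]) (use arg_cong[OF h(1), of uscal] sp in simp)
    have sk: "uscal k = 1"
      by (rule uscal_cpos_eq_1[OF k(2)]) (use arg_cong[OF k(1), of uscal] sq in simp)
    have su: "uscal u = 1" "uscal v = 1" using arg_cong[OF u(2), of uscal] arg_cong[OF v(2), of uscal] sh sk sp sq by simp_all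
    define w where "w = cstar u * v"
    have w: "unitary w" "uscal w = 1" using u v su by (simp_all add: w_def unitary_mult unitary_cstar)
    have uw: "u * (w * x) = v * x" for x using u(1) by (simp add: w_def mult.assoc[symmetric] unitary_def)
    define y where "y = w - 1"
    have uu: "cstar u * (u * x) = x" for x using u(1) by (simp add: mult.assoc[symmetric] unitary_def)
    \<comment> \<open>u w h = v h is close to v k = q, which is close to p = u h.\<close>
    have yh: "norm (y * h) < 2 * s0"
    proof -
      have "y * h = cstar u * (q - p) + w * (h - k)"
        by (simp add: y_def w_def u(2) v(2) algebra_simps uu)
      then have "norm (y * h) \<le> norm (cstar u * (q - p)) + norm (w * (h - k))" by (metis norm_triangle_ineq)
      also have "\<dots> \<le> norm (q - p) + norm (h - k)"
        using norm_mult_ineq[of "cstar u" "q - p"] norm_mult_ineq[of w "h - k"] norm_unitary[OF u(1)] norm_unitary[OF w(1)] by simp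
      finally show ?thesis using pq hk by (simp add: d_def norm_minus_commute)
    qed
    have hs: "cstar h = h" by (rule cpos_sa[OF h(2)])
    have y'h: "norm (cstar y * h) < 2 * s0"
    proof -
      have "cstar y = - (cstar w * y)" using w(1) by (simp add: y_def cstar_diff algebra_simps unitary_def)
      then have "cstar y * h = - (cstar w * (y * h))" by (simp add: mult.assoc)
      then have "norm (cstar y * h) \<le> norm (y * h)"
        using norm_mult_ineq[of "cstar w" "y * h"] norm_unitary[OF w(1)] by simp
      then show ?thesis using yh by simp
    qed
    have sa: "cstar (of_real r - h) = of_real r - h" by (simp add: cstar_diff hs)
    \<comment> \<open>A cut of h at the level r: n is the excess of h over r, m the amount by which
      h falls short of r, and s = r - m below is the minimum of h and r.\<close>
    obtain m n where mn: "cpos m" "cpos n" "of_real r - h = m - n" "m * n = 0" "n * m = 0"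
      "\<And>z. z * (of_real r - h) = (of_real r - h) * z \<Longrightarrow> z * m = m * z \<and> z * n = n * z"
      using pos_neg_parts[OF sa] by metis
    have com: "h * m = m * h" "h * n = n * h"
      using mn(6)[of h] by (simp_all add: algebra_simps of_real_commute)
    have hn: "h = of_real r - m + n" using mn(3) by (simp add: algebra_simps)
    define s where "s = of_real r - m"
    have hsn: "h = s + n" using hn by (simp add: s_def)
    \<comment> \<open>m h >= 0 together with m n = 0 gives m^2 <= r m.\<close>
    have nm: "norm m \<le> r"
    proof -
      have "cpos (m * h)" by (rule cpos_mult[OF mn(1) h(2) com(1)[symmetric]])
      also have "m * h = m * of_real r - m * m + m * n" unfolding hn by (simp only: distrib_left right_diff_distrib)
      also have "\<dots> = of_real r * m - m * m" by (simp only: mn(4) add_0_right of_real_commute)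
      finally have "norm (m * m) \<le> norm (of_real r * m)" by (intro cpos_norm_mono cpos_square cpos_sa mn(1))
      then have "norm m * norm m \<le> r * norm m" using r norm_square_sa[OF cpos_sa[OF mn(1)]] by (simp add: of_real_def)
      then show ?thesis using r by (cases "m = 0") auto
    qed
    have s: "cpos s" unfolding s_def by (rule cpos_of_real_minus[OF cpos_sa[OF mn(1)] nm])
    have ns: "norm s \<le> r" by (rule cpos_norm_le[OF s]) (simp add: s_def mn(1))
    have ss: "cstar s = s" by (rule cpos_sa[OF s])
    have sn: "s * n = of_real r * n" "n * s = of_real r * n" by (simp_all add: s_def left_diff_distrib right_diff_distrib mn(4,5) of_real_commute)
    \<comment> \<open>s <= h and both commute, so s^2 <= h^2; the difference is n (2s + n).\<close>
    have key: "norm (x * s) \<le> norm (x * h)" for x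
    proof -
      have "cpos (n * (s + s + n))"
        by (intro cpos_mult cpos_add s mn(2)) (simp add: algebra_simps sn)
      also have "n * (s + s + n) = h * h - s * s" by (simp add: hsn algebra_simps sn)
      finally have "cpos (cstar (cstar x) * (h * h - s * s) * cstar x)" by (rule cpos_conj)
      then have "cpos ((x * h) * cstar (x * h) - (x * s) * cstar (x * s))"
        by (simp add: cstar_cstar cstar_mult hs ss algebra_simps)
      then have "norm ((x * s) * cstar (x * s)) \<le> norm ((x * h) * cstar (x * h))"
        by (intro cpos_norm_mono cpos_mult_cstar)
      then have "(norm (x * s))\<^sup>2 \<le> (norm (x * h))\<^sup>2" by (simp add: norm_mult_cstar power2_eq_square)
      then show ?thesis by (rule power2_le_imp_le) simp
    qed
    have ys: "norm (y * s) < 2 * s0" using key[of y] yh by simp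
    have "norm (cstar y * s) < 2 * s0" using key[of "cstar y"] y'h by simp
    moreover have "cstar (cstar y * s) = s * y" by (simp add: cstar_mult cstar_cstar ss)
    ultimately have sy: "norm (s * y) < 2 * s0" by (metis norm_cstar)
    \<comment> \<open>A cut-off that annihilates n, so that f y f belongs to B. Because 1 - f = s /
      r, the bounds on y s and s y show that w' is close to w.\<close>
    define f where "f = (1 / r) *\<^sub>R m"
    have f: "1 - f = (1 / r) *\<^sub>R s" using r by (simp add: f_def s_def scaleR_right_diff_distrib of_real_def)
    have nf: "norm f \<le> 1" using nm r by (simp add: f_def)
    define b where "b = f * y * f"
    define w' where "w' = 1 + b"
    have ww': "norm (w - w') < 1/2"
    proof -
      have "w - w' = y * (1 - f) + (1 - f) * y * f" by (simp add: w'_def b_def y_def algebra_simps)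
      also have "\<dots> = (1 / r) *\<^sub>R (y * s) + (1 / r) *\<^sub>R (s * y) * f" unfolding f by simp
      finally have "norm (w - w') \<le> norm ((1 / r) *\<^sub>R (y * s)) + norm ((1 / r) *\<^sub>R (s * y) * f)" by (metis norm_triangle_ineq)
      also have "norm ((1 / r) *\<^sub>R (s * y) * f) \<le> norm ((1 / r) *\<^sub>R (s * y)) * 1"
        by (rule order_trans[OF norm_mult_ineq mult_left_mono[OF nf]]) simp
      finally have "norm (w - w') \<le> (norm (y * s) + norm (s * y)) / r" using r by (simp add: add_divide_distrib)
      also have "\<dots> < (4 * s0) / r" using ys sy r by (intro divide_strict_right_mono) auto
      also have "\<dots> \<le> 1/2" using r by (simp add: s0_def)
      finally show ?thesis .
    qed
    define B where "B = {b. Uni b 0 * n = 0 \<and> n * Uni b 0 = 0}"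
    have B: "hereditary B" unfolding B_def by (rule hereditary_annihilator[OF cpos_sa[OF mn(2)]])
    interpret D: ustar_sub_dense "UB B" by (rule UB_dense[OF B dense])
    have IBn: "x * n = 0" if "x \<in> IB B" for x
    proof -
      have "Uni (uvec x) 0 = x" by (rule uni_eqI) (use that in \<open>simp_all add: mem_IB\<close>)
      then show ?thesis using that by (simp add: mem_IB B_def)
    qed
    have bI: "b \<in> IB B"
    proof -
      have "uscal b = 0" by (simp add: b_def y_def w)
      then have "Uni (uvec b) 0 = b" by (intro uni_eqI) simp_all
      moreover have "b * n = 0" "n * b = 0" by (simp_all add: b_def f_def mult.assoc mn(4)) (simp add: mult.assoc[symmetric] mn(5))
      ultimately show ?thesis using \<open>uscal b = 0\<close> by (simp add: mem_IB B_def)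
    qed
    have small: "norm ((x - 1) * h) \<le> norm (x - 1) * r" if "x \<in> UB B" "uscal x = 1" for x
    proof -
      have "x - 1 \<in> IB B" using that by (simp add: mem_IB mem_UB)
      then have "(x - 1) * h = (x - 1) * s" by (simp add: hsn distrib_left IBn)
      then show ?thesis using norm_mult_ineq[of "x - 1" s] mult_left_mono[OF ns norm_ge_zero[of "x - 1"]] by simp
    qed
    have wi: "w \<in> invs" by (rule unitary_invs[OF w(1)])
    have w'i: "w' \<in> invs"
      by (rule perturb_invs(1)[OF wi]) (use ww' in \<open>simp add: unitary_uinv[OF w(1)] norm_unitary[OF w(1)]\<close>)
    have w'U: "w' \<in> UB B" "uscal w' = 1" using bI B by (simp_all add: w'_def mem_IB mem_UB)
    have w'G: "w' \<in> D.GL" using w'i w'U by (intro D.GLI)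
    have nw': "norm w' \<le> 3/2" using ww' norm_unitary[OF w(1)] norm_triangle_ineq3[of w w'] by linarith
    \<comment> \<open>w' need not be unitary; its unitary part w'' is the element to which the
      hypothesis on K_1 applies.\<close>
    define h' where "h' = psqrt (cstar w' * w')"
    have h': "h' * h' = cstar w' * w'" "cpos h'" "h' \<in> D.GL" "unitary (w' * uinv h')"
      using D.polar[OF w'G, of "norm (cstar w' * w') + 1"] by (simp_all add: h'_def psqrt_def norm_cstar_mult add_nonneg_pos)
    have sh': "uscal h' = 1"
      by (rule uscal_cpos_eq_1[OF h'(2)]) (use arg_cong[OF h'(1), of uscal] w'U in simp)
    define w'' where "w'' = w' * uinv h'"
    have w'': "unitary w''" "w' = w'' * h'" "w'' \<in> UB B" using h' w'G by (simp_all add: w''_def mult.assoc)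
    have sw'': "uscal w'' = 1" using arg_cong[OF w''(2), of uscal] sh' w'U by simp
    have nh': "norm h' \<le> 3/2"
    proof -
      have "norm h' * norm h' = norm w' * norm w'"
        using norm_square_sa[OF cpos_sa[OF h'(2)]] h'(1) norm_cstar_mult[of w'] by simp
      then have "(norm h')\<^sup>2 = (norm w')\<^sup>2" by (simp add: power2_eq_square)
      then show ?thesis using nw' by simp
    qed
    define S where "S = {z \<in> invs. norm (z - p) < e}"
    have inS: "u * (x * h) \<in> S" if "x \<in> invs" "norm ((x - 1) * h) < e" for x
    proof -
      have "u * (x * h) - p = u * ((x - 1) * h)" by (simp add: u(2) algebra_simps)
      then have "norm (u * (x * h) - p) \<le> norm ((x - 1) * h)"
        using norm_mult_ineq[of u "(x - 1) * h"] norm_unitary[OF u(1)] by simp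
      moreover have "u * (x * h) \<in> invs" using that h unitary_invs[OF u(1)] by (intro invs_mult)
      ultimately show ?thesis using that by (simp add: S_def)
    qed
    have lift: "path_component S (u * (x * h)) (u * (x' * h))"
      if pc: "path_component {x \<in> invs. norm ((x - 1) * h) < e} x x'" for x x'
    proof -
      obtain g :: "real \<Rightarrow> _" where g: "continuous_on {0..1} g" "\<And>t. 0 \<le> t \<Longrightarrow> t \<le> 1 \<Longrightarrow> g t \<in> {x \<in> invs. norm ((x - 1) * h) < e}" "g 0 = x" "g 1 = x'"
        by (rule path_componentE[OF pc]) blast
      have "path_component S (u * (g 0 * h)) (u * (g 1 * h))"
        by (rule path_componentI[of "\<lambda>t. u * (g t * h)"]) (use g in \<open>auto intro!: continuous_intros inS\<close>)
      then show ?thesis using g by simp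
    qed
    have 1: "path_component {x \<in> invs. norm ((x - 1) * h) < e} 1 w''"
    proof -
      have "path_component D.GL w'' 1"
        by (rule unitary_connected_of_K1_trivial[OF B D.ustar_sub_dense_axioms K1[OF B] w''(3,1)])
      then have "path_component {x \<in> UB B. unitary x \<and> uscal x = 1} w'' 1"
        by (rule unitary_path_one_scal[OF B _ w''(1) sw''])
      moreover have "{x \<in> UB B. unitary x \<and> uscal x = 1} \<subseteq> {x \<in> invs. norm ((x - 1) * h) < e}"
      proof safe
        fix x assume x: "x \<in> UB B" "unitary x" "uscal x = 1"
        then show "x \<in> invs" by (simp add: unitary_invs)
        have "norm (x - 1) \<le> 2" using norm_triangle_ineq4[of x 1] norm_unitary[OF x(2)] by simp
        then have "norm ((x - 1) * h) \<le> 2 * r" using small[OF x(1,3)] mult_right_mono[of "norm (x - 1)" 2 r] r by linarith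
        then show "norm ((x - 1) * h) < e" using e by (simp add: r_def)
      qed
      ultimately show ?thesis by (meson path_component_of_subset path_component_sym)
    qed
    have 2: "path_component {x \<in> invs. norm ((x - 1) * h) < e} w'' w'"
    proof -
      let ?g = "\<lambda>t. w'' * ((1 - t) *\<^sub>R 1 + t *\<^sub>R h')"
      have "path_component {x \<in> invs. norm ((x - 1) * h) < e} (?g 0) (?g 1)"
      proof (rule path_componentI)
        fix t :: real assume t: "0 \<le> t" "t \<le> 1"
        have G: "(1 - t) *\<^sub>R 1 + t *\<^sub>R h' \<in> D.GL" by (rule D.conn_convex_pos) (use h' t in simp_all)
        have g: "?g t \<in> UB B" "uscal (?g t) = 1"
          using w''(3) D.GL_R[OF G] sw'' sh' by (simp_all add: scaleR_conv_of_real)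
        have "norm ((1 - t) *\<^sub>R 1 + t *\<^sub>R h') \<le> (1 - t) * 1 + t * norm h'"
          using norm_triangle_ineq[of "(1 - t) *\<^sub>R 1" "t *\<^sub>R h'"] t by simp
        also have "\<dots> \<le> (1 - t) * (3/2) + t * (3/2)" using t nh' by (intro add_mono mult_left_mono) auto
        also have "\<dots> = 3/2" by argo
        finally have "norm ((1 - t) *\<^sub>R 1 + t *\<^sub>R h') \<le> 3/2" .
        then have "norm (?g t) \<le> 3/2"
          using norm_mult_ineq[of w'' "(1 - t) *\<^sub>R 1 + t *\<^sub>R h'"] norm_unitary[OF w''(1)] by simp
        then have "norm (?g t - 1) \<le> 5/2" using norm_triangle_ineq4[of "?g t" 1] by simp
        then have "norm ((?g t - 1) * h) \<le> 5/2 * r" using small[OF g] mult_right_mono[of "norm (?g t - 1)" "5/2" r] r by linarith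
        then have "norm ((?g t - 1) * h) < e" using e by (simp add: r_def)
        moreover have "?g t \<in> invs" using D.GL_invs[OF G] unitary_invs[OF w''(1)] by (rule invs_mult[rotated])
        ultimately show "?g t \<in> {x \<in> invs. norm ((x - 1) * h) < e}" by simp
      qed (intro continuous_intros)
      then show ?thesis using w''(2) by simp
    qed
    have nw'1: "norm ((w' - 1) * h) \<le> 5/2 * r"
    proof -
      have "norm (w' - 1) \<le> 5/2" using norm_triangle_ineq4[of w' 1] nw' by simp
      then show ?thesis using small[OF w'U] mult_right_mono[of "norm (w' - 1)" "5/2" r] r by linarith
    qed
    have 3: "path_component {x \<in> invs. norm ((x - 1) * h) < e} w' w"
    proof -
      let ?g = "\<lambda>t. (1 - t) *\<^sub>R w' + t *\<^sub>R w"
      have "path_component {x \<in> invs. norm ((x - 1) * h) < e} (?g 0) (?g 1)"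
      proof (rule path_componentI)
        fix t :: real assume t: "0 \<le> t" "t \<le> 1"
        have "w - ?g t = (1 - t) *\<^sub>R (w - w')" by (simp add: algebra_simps)
        then have "norm (w - ?g t) \<le> norm (w - w')" using t by (simp add: mult_left_le_one_le)
        then have gi: "?g t \<in> invs"
          by (intro perturb_invs(1)[OF wi]) (use ww' in \<open>simp add: unitary_uinv[OF w(1)] norm_unitary[OF w(1)]\<close>)
        have "(?g t - 1) * h = (1 - t) *\<^sub>R ((w' - 1) * h) + t *\<^sub>R (y * h)" by (simp add: y_def algebra_simps)
        then have "norm ((?g t - 1) * h) \<le> (1 - t) * norm ((w' - 1) * h) + t * norm (y * h)"
          using norm_triangle_ineq[of "(1 - t) *\<^sub>R ((w' - 1) * h)" "t *\<^sub>R (y * h)"] t by simp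
        also have "\<dots> \<le> (1 - t) * (5/2 * r) + t * (5/2 * r)"
          using t nw'1 yh r by (intro add_mono mult_left_mono) (auto simp: s0_def)
        also have "\<dots> = 5/2 * r" by argo
        also have "\<dots> < e" using e by (simp add: r_def)
        finally show "?g t \<in> {x \<in> invs. norm ((x - 1) * h) < e}" using gi by simp
      qed (intro continuous_intros)
      then show ?thesis by simp
    qed
    \<comment> \<open>The path 1, w'', w', w, multiplied by u on the left and h on the right, leads
      from u h = p to u w h = v h; the remaining segment exchanges h for k.\<close>
    have A: "path_component S (u * (1 * h)) (u * (w * h))"
      using 1 2 3 by (intro lift) (meson path_component_trans)
    have "path_component S (v * h) (v * k)"
    proof -
      let ?g = "\<lambda>t. v * ((1 - t) *\<^sub>R h + t *\<^sub>R k)"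
      have "path_component S (?g 0) (?g 1)"
      proof (rule path_componentI)
        fix t :: real assume t: "0 \<le> t" "t \<le> 1"
        have "(1 - t) *\<^sub>R h + t *\<^sub>R k \<in> invs" using U.conn_convex_pos[of h k t] h k t by (simp add: GLU)
        then have gi: "?g t \<in> invs" using unitary_invs[OF v(1)] by (rule invs_mult[rotated])
        have "?g t - p = u * (y * h) - v * (t *\<^sub>R (h - k))"
          by (simp add: u(2) y_def algebra_simps uw)
        then have "norm (?g t - p) \<le> norm (u * (y * h)) + norm (v * (t *\<^sub>R (h - k)))" by (metis norm_triangle_ineq4)
        also have "\<dots> \<le> norm (y * h) + norm (t *\<^sub>R (h - k))"
          using norm_mult_ineq[of u "y * h"] norm_mult_ineq[of v "t *\<^sub>R (h - k)"] norm_unitary[OF u(1)] norm_unitary[OF v(1)] by simp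
        also have "norm (t *\<^sub>R (h - k)) \<le> norm (h - k)" using t by (simp add: mult_left_le_one_le)
        finally have "norm (?g t - p) < e" using yh hk e by (simp add: s0_def r_def)
        then show "?g t \<in> S" using gi by (simp add: S_def)
      qed (intro continuous_intros)
      then show ?thesis by simp
    qed
    then have "path_component S p q" using A by (simp add: uw flip: u(2) v(2)) (meson path_component_trans)
    then show "path_component {z \<in> invs. norm (z - p) < e} p q" by (simp add: S_def)
  qed
qed

section \<open>Partitions of the unit interval and approximation by invertible paths\<close>

lemma glue_paths:
  fixes P :: "nat \<Rightarrow> 'b::topological_space"
  assumes "\<And>k. k < N \<Longrightarrow> path_component (S k) (P k) (P (Suc k))" "N > 0"
  obtains g where "continuous_on {0..1} g" "\<And>k t. k < N \<Longrightarrow> real k / real N \<le> t \<Longrightarrow> t \<le> real (Suc k) / real N \<Longrightarrow> g t \<in> S k"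
proof -
  have "\<exists>g. continuous_on {0..real m} g \<and> g (real m) = P m \<and> (\<forall>k<m. \<forall>t. real k \<le> t \<longrightarrow> t \<le> real (Suc k) \<longrightarrow> g t \<in> S k)" if "m \<le> N" for m
    using that
  proof (induction m)
    case 0
    show ?case by (rule exI[of _ "\<lambda>_. P 0"]) simp
  next
    case (Suc m)
    then obtain g where g: "continuous_on {0..real m} g" "g (real m) = P m"
      "\<And>k t. k < m \<Longrightarrow> real k \<le> t \<Longrightarrow> t \<le> real (Suc k) \<Longrightarrow> g t \<in> S k"
      by (metis Suc_leD)
    obtain h :: "real \<Rightarrow> 'b" where h: "continuous_on {0..1} h" "\<And>t. 0 \<le> t \<Longrightarrow> t \<le> 1 \<Longrightarrow> h t \<in> S m" "h 0 = P m" "h 1 = P (Suc m)"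
      by (rule path_componentE[OF assms(1)[of m]]) (use Suc.prems in auto)
    define f where "f = (\<lambda>t. if t \<le> real m then g t else h (t - real m))"
    have "continuous_on ({0..real m} \<union> {real m..real (Suc m)}) f"
      unfolding f_def
    proof (rule continuous_on_If)
      show "continuous_on {real m..real (Suc m)} (\<lambda>t. h (t - real m))"
        by (rule continuous_on_compose2[OF h(1)]) (auto intro!: continuous_intros)
    qed (use g h in auto)
    moreover have "{0..real m} \<union> {real m..real (Suc m)} = {0..real (Suc m)}" by auto
    moreover have "f (real (Suc m)) = P (Suc m)" using h by (simp add: f_def)
    moreover have "f t \<in> S k" if k: "k < Suc m" "real k \<le> t" "t \<le> real (Suc k)" for k t
    proof (cases "t \<le> real m")
      case True
      show ?thesis
      proof (cases "k = m")
        case True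
        then have "t = real m" using k \<open>t \<le> real m\<close> by simp
        then show ?thesis using h(2)[of 0] h(3) g(2) True by (simp add: f_def)
      qed (use g(3)[of k t] k True in \<open>auto simp: f_def\<close>)
    next
      case False
      then have "real m < real (Suc k)" using k by linarith
      then have "m < Suc k" by (simp only: of_nat_less_iff)
      then have "k = m" using k(1) by linarith
      moreover have "h (t - real m) \<in> S m" using False k(3) \<open>k = m\<close> by (intro h(2)) auto
      ultimately show ?thesis using False by (simp add: f_def)
    qed
    ultimately show ?case by (intro exI[of _ f]) auto
  qed
  then obtain g where g: "continuous_on {0..real N} g" "\<And>k t. k < N \<Longrightarrow> real k \<le> t \<Longrightarrow> t \<le> real (Suc k) \<Longrightarrow> g t \<in> S k" by blast
  show thesis
  proof (rule that[of "\<lambda>t. g (real N * t)"])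
    show "continuous_on {0..1} (\<lambda>t. g (real N * t))"
      by (rule continuous_on_compose2[OF g(1)]) (auto intro!: continuous_intros simp: mult_left_le)
    fix k and t :: real assume "k < N" "real k / real N \<le> t" "t \<le> real (Suc k) / real N"
    then show "g (real N * t) \<in> S k" using assms(2) by (intro g(2)) (simp_all add: field_simps)
  qed
qed

lemma uniform_partition:
  fixes f :: "real \<Rightarrow> 'b::metric_space"
  assumes "continuous_on {0..1} f" "e > 0"
  obtains N where "N > 0" "\<And>k t. k < N \<Longrightarrow> real k / real N \<le> t \<Longrightarrow> t \<le> real (Suc k) / real N \<Longrightarrow> dist (f t) (f (real k / real N)) < e"
proof -
  have "uniformly_continuous_on {0..1} f" by (rule compact_uniformly_continuous[OF assms(1)]) simp
  then obtain d where d: "d > 0" "\<And>x x'. x \<in> {0..1} \<Longrightarrow> x' \<in> {0..1} \<Longrightarrow> dist x' x < d \<Longrightarrow> dist (f x') (f x) < e"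
    using assms(2) unfolding uniformly_continuous_on_def by metis
  obtain n where n: "1 / real (Suc n) < d" using d(1) nat_approx_posE by blast
  show thesis
  proof (rule that[of "Suc n"])
    fix k t assume k: "k < Suc n" "real k / real (Suc n) \<le> t" "t \<le> real (Suc k) / real (Suc n)"
    have "real (Suc k) / real (Suc n) \<le> 1" using k by simp
    moreover have "0 \<le> real k / real (Suc n)" by simp
    ultimately have "t \<in> {0..1}" "real k / real (Suc n) \<in> {0..1}" using k(2,3) unfolding atLeastAtMost_iff by linarith+
    moreover have "t - real k / real (Suc n) \<le> 1 / real (Suc n)" using k(3) by (simp add: add_divide_distrib)
    then have "dist t (real k / real (Suc n)) < d" using k n by (simp add: dist_real_def)
    ultimately show "dist (f t) (f (real k / real (Suc n))) < e" by (intro d(2))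
  qed simp
qed

lemma partition_index:
  assumes "N > 0" "t \<in> {0..1}"
  obtains k where "k < N" "real k / real N \<le> t" "t \<le> real (Suc k) / real N"
proof (cases "t = 1")
  case True
  \<comment> \<open>At t = 1 the floor of N t would be N, one past the last interval.\<close>
  show thesis by (rule that[of "N - 1"]) (use assms True in \<open>auto simp: field_simps\<close>)
next
  case False
  define k where "k = nat \<lfloor>real N * t\<rfloor>"
  have k: "real k \<le> real N * t" "real N * t \<le> real k + 1"
    using assms by (simp_all add: k_def)
  moreover have "real N * t < real N" using assms False by simp
  ultimately have "k < N" by linarith
  then show thesis using k assms by (intro that[of k]) (simp_all add: field_simps)
qed

text \<open>Multiplying an invertible approximation by a scalar restores the scalar part of x.
  Keeping d below half its modulus bounds the inverse of the approximation's scalar part, so the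
  factor is near 1.\<close>

lemma dense_scal:
  assumes dense: "\<And>(x::'a::cstar_algebra uni) e. e > 0 \<Longrightarrow> \<exists>y\<in>invs. norm (x - y) < e"
    and e: "e > 0" and x: "uscal x \<noteq> 0"
  shows "\<exists>y\<in>invs. uscal y = uscal (x::'a uni) \<and> norm (x - y) < e"
proof -
  define l where "l = uscal x"
  have l: "l \<noteq> 0" "cmod l > 0" using x by (simp_all add: l_def)
  define d where "d = min (cmod l / 2) (min 1 (e / (2 * (norm x + 1) * (2 / cmod l) + 2)))"
  have pos: "2 * (norm x + 1) * (2 / cmod l) + 2 > 0" using l by (intro add_nonneg_pos mult_nonneg_nonneg) auto
  have d: "d > 0" using l e pos by (simp add: d_def)
  obtain y where y: "y \<in> invs" "norm (x - y) < d" using dense[OF d] by blast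
  define s where "s = uscal y"
  have sl: "cmod (l - s) \<le> norm (x - y)" using cmod_scal_le[of "x - y"] by (simp add: l_def s_def)
  have "d \<le> cmod l / 2" "d \<le> 1" unfolding d_def by linarith+
  note dl = this
  have s: "cmod s \<ge> cmod l / 2" using sl y dl norm_triangle_ineq3[of l s] by linarith
  then have s0: "s \<noteq> 0" using l by auto
  have ny: "norm y \<le> norm x + 1" using y(2) dl norm_triangle_ineq3[of x y] by linarith
  let ?z = "Uni 0 (l / s) * y"
  have "?z \<in> invs" using y l s0 by (intro invs_mult Uni_scal_invs) auto
  moreover have "uscal ?z = l" using s0 by (simp add: s_def)
  moreover have "norm (x - ?z) < e"
  proof -
    have "Uni 0 (l / s) - 1 = Uni (0::'a) ((l - s) / s)" by (rule uni_eqI) (use s0 in \<open>simp_all add: field_simps\<close>)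
    moreover have "x - ?z = (x - y) - (Uni 0 (l / s) - 1) * y" by (simp add: algebra_simps)
    ultimately have "norm (x - ?z) \<le> norm (x - y) + norm (Uni (0::'a) ((l - s) / s) * y)" by (metis norm_triangle_ineq4)
    also have "norm (Uni (0::'a) ((l - s) / s) * y) \<le> cmod ((l - s) / s) * norm y"
      using norm_mult_ineq[of "Uni (0::'a) ((l - s) / s)" y] by simp
    also have "cmod ((l - s) / s) \<le> norm (x - y) * (2 / cmod l)"
      using mult_mono[of "cmod (l - s)" "norm (x - y)" "1 / cmod s" "2 / cmod l"] sl s l s0 by (simp add: norm_divide field_simps)
    finally have "norm (x - ?z) \<le> norm (x - y) + norm (x - y) * (2 / cmod l) * norm y" by (simp add: mult_right_mono)
    also have "\<dots> \<le> norm (x - y) + norm (x - y) * (2 / cmod l) * (norm x + 1)"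
      using ny l by (intro add_mono mult_left_mono) auto
    also have "\<dots> = norm (x - y) * (1 + (norm x + 1) * (2 / cmod l))" by (simp add: algebra_simps)
    also have "\<dots> \<le> d * (1 + (norm x + 1) * (2 / cmod l))"
      using y l by (intro mult_right_mono) (auto intro!: add_nonneg_nonneg mult_nonneg_nonneg)
    also have "\<dots> < d * (2 * (norm x + 1) * (2 / cmod l) + 2)"
    proof (rule mult_strict_left_mono[OF _ d])
      have "0 \<le> (norm x + 1) * (2 / cmod l)" by simp
      then show "1 + (norm x + 1) * (2 / cmod l) < 2 * (norm x + 1) * (2 / cmod l) + 2" by (simp only: mult.assoc)
    qed
    also have "\<dots> \<le> e"
    proof -
      have "d \<le> e / (2 * (norm x + 1) * (2 / cmod l) + 2)" unfolding d_def by linarith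
      then show ?thesis by (simp only: pos_le_divide_eq[OF pos])
    qed
    finally show ?thesis .
  qed
  ultimately show ?thesis unfolding l_def[symmetric] by blast
qed

lemma invertible_path_approx:
  fixes f :: "real \<Rightarrow> 'a::cstar_algebra uni"
  assumes dense: "\<And>(x::'a uni) e. e > 0 \<Longrightarrow> \<exists>y\<in>invs. norm (x - y) < e"
    and K1: "\<And>B::'a set. hereditary B \<Longrightarrow> K1_trivial B"
    and f: "continuous_on {0..1} f" "\<And>t. t \<in> {0..1} \<Longrightarrow> uscal (f t) = 1" and e: "e > 0"
  shows "\<exists>g. continuous_on {0..1} g \<and> (\<forall>t\<in>{0..1}. g t \<in> invs \<and> norm (f t - g t) < e)"
proof -
  have "compact (f ` {0..1})" by (rule compact_continuous_image[OF f(1)]) simp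
  then obtain C0 where C0: "\<And>t. t \<in> {0..1} \<Longrightarrow> norm (f t) \<le> C0"
    using compact_imp_bounded bounded_iff by (metis imageI)
  define C where "C = C0 + 1"
  have C: "C > 0" using order_trans[OF norm_ge_zero C0[of 0]] by (simp add: C_def)
  obtain d where d: "d > 0" "\<And>p q :: 'a uni. p \<in> invs \<Longrightarrow> q \<in> invs \<Longrightarrow> uscal p = 1 \<Longrightarrow> uscal q = 1 \<Longrightarrow>
     norm p \<le> C \<Longrightarrow> norm q \<le> C \<Longrightarrow> norm (p - q) < d \<Longrightarrow> path_component {z \<in> invs. norm (z - p) < e / 2} p q"
    using local_connectivity[OF dense K1 _ C, of "e / 2"] e by auto
  \<comment> \<open>Neighbouring points \<open>P k\<close> differ by three errors, hence d/3; the
    total error is e/4 + e/4 + e/2; the bound 1 keeps norms below C = C0 + 1.\<close>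
  define d' where "d' = min (min (d / 3) (e / 4)) 1"
  have d': "d' > 0" "d' \<le> d / 3" "d' \<le> e / 4" "d' \<le> 1" using d e by (auto simp: d'_def)
  obtain N where N: "N > 0" "\<And>k t. k < N \<Longrightarrow> real k / real N \<le> t \<Longrightarrow> t \<le> real (Suc k) / real N \<Longrightarrow> dist (f t) (f (real k / real N)) < d'"
    using uniform_partition[OF f(1) d'(1)] by metis
  let ?x = "\<lambda>k. real k / real N"
  have x01: "?x k \<in> {0..1}" if "k \<le> N" for k using that N(1) by simp
  have "\<exists>y\<in>invs. uscal y = 1 \<and> norm (f (?x k) - y) < d'" if "k \<le> N" for k
    using dense_scal[OF dense d'(1), of "f (?x k)"] f(2)[OF x01[OF that]] by auto
  then obtain P where P: "\<And>k. k \<le> N \<Longrightarrow> P k \<in> invs \<and> uscal (P k) = 1 \<and> norm (f (?x k) - P k) < d'" by metis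
  have nP: "norm (P k) \<le> C" if "k \<le> N" for k
    using P[OF that] C0[OF x01[OF that]] d'(4) norm_triangle_ineq3[of "f (?x k)" "P k"] unfolding C_def by linarith
  have pc: "path_component {z \<in> invs. norm (z - P k) < e / 2} (P k) (P (Suc k))" if "k < N" for k
  proof (rule d(2))
    have "norm (f (?x (Suc k)) - f (?x k)) < d'" using N(2)[of k "?x (Suc k)"] that N(1) by (simp add: dist_norm field_simps)
    moreover have "norm (f (?x k) - P k) < d'" "norm (f (?x (Suc k)) - P (Suc k)) < d'"
      using P[of k] P[of "Suc k"] that by simp_all
    moreover have "norm (P k - P (Suc k)) \<le> norm (f (?x k) - P k) + norm (f (?x (Suc k)) - f (?x k)) + norm (f (?x (Suc k)) - P (Suc k))"
      by norm
    ultimately show "norm (P k - P (Suc k)) < d" using d'(2) by linarith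
  qed (use P nP that in auto)
  obtain g where g: "continuous_on {0..1} g" "\<And>k t. k < N \<Longrightarrow> ?x k \<le> t \<Longrightarrow> t \<le> ?x (Suc k) \<Longrightarrow> g t \<in> {z \<in> invs. norm (z - P k) < e / 2}"
    by (rule glue_paths[of N "\<lambda>k. {z \<in> invs. norm (z - P k) < e / 2}" P, OF pc N(1)]) blast+
  have "g t \<in> invs \<and> norm (f t - g t) < e" if t: "t \<in> {0..1}" for t
  proof -
    obtain k where k: "k < N" "?x k \<le> t" "t \<le> ?x (Suc k)" 
      by (rule partition_index[OF N(1) t])
    have 1: "norm (f t - f (?x k)) < d'" using N(2)[OF k] by (simp add: dist_norm)
    have 2: "norm (f (?x k) - P k) < d'" using P[of k] k by simp
    have 3: "g t \<in> invs" "norm (g t - P k) < e / 2" using g(2)[OF k] by auto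
    have "norm (f t - g t) \<le> norm (f t - f (?x k)) + norm (f (?x k) - P k) + norm (g t - P k)" by norm
    then show ?thesis using 1 2 3 d'(3) by auto
  qed
  then show ?thesis using g(1) by blast
qed

section \<open>Stable rank\<close>

lemma stable_rank_eq_1_iff: "stable_rank sc S d = 1 \<longleftrightarrow> Lg_dense sc S d 1"
proof
  assume *: "stable_rank sc S d = 1"
  then have ex: "\<exists>n\<ge>1. Lg_dense sc S d n" by (auto simp: stable_rank_def split: if_splits)
  then have "(LEAST n. 1 \<le> n \<and> Lg_dense sc S d n) = 1" using * by (simp add: stable_rank_def one_enat_def)
  then show "Lg_dense sc S d 1" using LeastI_ex[OF ex] by simp
next
  assume *: "Lg_dense sc S d 1"
  have "(LEAST n. 1 \<le> n \<and> Lg_dense sc S d n) = 1" by (rule Least_equality) (use * in auto)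
  moreover have "\<exists>n\<ge>1. Lg_dense sc S d n" using * by auto
  ultimately show "stable_rank sc S d = 1" by (simp add: stable_rank_def one_enat_def)
qed

lemma stable_rank_eq_2I:
  assumes "\<not> Lg_dense sc S d 1" "Lg_dense sc S d 2"
  shows "stable_rank sc S d = 2"
proof -
  have "(LEAST n. 1 \<le> n \<and> Lg_dense sc S d n) = 2"
  proof (rule Least_equality)
    fix n assume "1 \<le> n \<and> Lg_dense sc S d n"
    then show "2 \<le> n" using assms(1) by (cases "n = 1") auto
  qed (use assms in auto)
  moreover have "\<exists>n\<ge>1. Lg_dense sc S d n" using assms(2) by (intro exI[of _ 2]) simp
  ultimately show ?thesis by (simp add: stable_rank_def numeral_eq_enat)
qed

text \<open>\<open>Lg\<close> speaks of left inverses only. A left inverse y of z is approximated by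
  a left invertible y' with y' z still invertible; then y' has a right inverse as well, so y' and
  hence z are invertible.\<close>

lemma left_invertible_invs:
  fixes z :: "'u::{real_normed_algebra_1,banach}"
  assumes dense: "\<And>(x::'u) e. e > 0 \<Longrightarrow> \<exists>z. (\<exists>y. y * z = 1) \<and> norm (x - z) < e"
    and z: "y * z = 1"
  shows "z \<in> invs"
proof -
  define K where "K = norm z + 1"
  have K: "K > 0" by (simp add: K_def add_nonneg_pos)
  obtain y' w where y': "w * y' = 1" "norm (y - y') < 1 / K" using dense[of "1 / K" y] K by auto
  have "1 - y' * z = (y - y') * z" using z by (simp add: left_diff_distrib)
  then have "norm (1 - y' * z) \<le> norm (y - y') * norm z" by (simp add: norm_mult_ineq)
  also have "\<dots> \<le> norm (y - y') * K" by (rule mult_left_mono) (auto simp: K_def)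
  also have "\<dots> < 1" using y' K by (simp add: field_simps)
  finally have i: "y' * z \<in> invs" by (rule neumann_invs)
  define v where "v = z * uinv (y' * z)"
  have v: "y' * v = 1" using uinv_right[OF i] by (simp add: v_def mult.assoc)
  have "w = w * (y' * v)" by (simp add: v)
  also have "\<dots> = v" by (simp add: mult.assoc[symmetric] y')
  finally have "y' \<in> invs" using v y' by (intro invsI[of _ v]) auto
  then show ?thesis using i by (rule invs_mult_cancel_left)
qed

lemma left_invertible_dense:
  fixes x :: "'a::cstar_algebra uni"
  assumes "Lg_dense (cscale :: complex \<Rightarrow> 'a \<Rightarrow> 'a) UNIV dist 1" "e > 0"
  shows "\<exists>z. (\<exists>y. y * z = 1) \<and> norm (x - z) < e"
proof -
  obtain z where z: "z \<in> Lg (cscale :: complex \<Rightarrow> 'a \<Rightarrow> 'a) UNIV 1"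
      "dist (uvec x) (fst (z 0)) + cmod (uscal x - snd (z 0)) < e"
    using assms unfolding Lg_dense_def by (elim allE[of _ "\<lambda>_. (uvec x, uscal x)"]) auto
  then obtain y where "uni_mult cscale (y 0) (z 0) = (0, 1)" by (auto simp: Lg_def)
  then have "upair (y 0) * upair (z 0) = 1" by (simp add: upair_mult[symmetric] upair_one)
  moreover have "norm (x - upair (z 0)) < e"
    using norm_uni_le[of "x - upair (z 0)"] z(2) by (simp add: upair_def dist_norm)
  ultimately show ?thesis by blast
qed

lemma sr_1_dense:
  fixes x :: "'a::cstar_algebra uni"
  assumes "sr TYPE('a) = 1" "e > 0"
  shows "\<exists>y\<in>invs. norm (x - y) < e"
proof -
  have L: "Lg_dense (cscale :: complex \<Rightarrow> 'a \<Rightarrow> 'a) UNIV dist 1"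
    using assms(1) by (simp add: sr_def stable_rank_eq_1_iff)
  obtain y z where "y * z = 1" "norm (x - z) < e" using left_invertible_dense[OF L assms(2)] by metis
  then show ?thesis using left_invertible_invs[OF left_invertible_dense[OF L]] by blast
qed

section \<open>Evaluation of the unitization of C([0,1],A)\<close>

text \<open>Evaluation at t as a unital homomorphism to the unitization of A; the scalar part does
  not depend on t.\<close>

definition ev :: "real \<Rightarrow> (real \<Rightarrow> 'a) \<times> complex \<Rightarrow> 'a::cstar_algebra uni" where
  "ev t p = Uni (fst p t) (snd p)"

definition ext :: "(real \<Rightarrow> 'a::zero) \<Rightarrow> real \<Rightarrow> 'a" where
  "ext f = (\<lambda>t. if t \<in> {0..1} then f t else 0)"

lemma ext_C01: "continuous_on {0..1} f \<Longrightarrow> ext f \<in> C01"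
proof -
  assume "continuous_on {0..1} f"
  then have "continuous_on {0..1} (ext f)" by (rule continuous_on_eq) (simp add: ext_def)
  then show ?thesis by (auto simp: C01_def ext_def)
qed

lemma ev_mult: "ev t (uni_mult C01_scale p q) = ev t p * ev t q"
  by (rule uni_eqI) (simp_all add: ev_def uni_mult_def C01_scale_def)

lemma ev_sum: "ev t (sum f I) = (\<Sum>i\<in>I. ev t (f i))"
proof (induction I rule: infinite_finite_induct)
  case (insert i I)
  have "ev t (f i + sum f I) = ev t (f i) + ev t (sum f I)" by (rule uni_eqI) (simp_all add: ev_def)
  then show ?case using insert by simp
qed (simp_all add: ev_def zero_uni_def)

text \<open>Constancy of the scalar parts turns a pointwise identity into one in the unitization of
  C([0,1],A). Outside [0,1] all vector parts vanish, as the extensional representation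
  demands.\<close>

lemma Lg_C01I:
  fixes b y :: "nat \<Rightarrow> real \<Rightarrow> 'a::cstar_algebra uni"
  assumes "\<And>i. i < n \<Longrightarrow> continuous_on {0..1} (b i)" "\<And>i. i < n \<Longrightarrow> continuous_on {0..1} (y i)"
    and l: "\<And>i t. i < n \<Longrightarrow> t \<in> {0..1} \<Longrightarrow> uscal (b i t) = l i"
    and m: "\<And>i t. i < n \<Longrightarrow> t \<in> {0..1} \<Longrightarrow> uscal (y i t) = m i"
    and 1: "\<And>t. t \<in> {0..1} \<Longrightarrow> (\<Sum>i<n. y i t * b i t) = 1"
  shows "(\<lambda>i. (ext (\<lambda>t. uvec (b i t)), l i)) \<in> Lg C01_scale C01 n"
proof -
  define B where "B = (\<lambda>i. (ext (\<lambda>t. uvec (b i t)), l i))"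
  define Y where "Y = (\<lambda>i. (ext (\<lambda>t. uvec (y i t)), m i))"
  let ?S = "\<Sum>i<n. uni_mult C01_scale (Y i) (B i)"
  have evS: "ev t ?S = (\<Sum>i<n. ev t (Y i) * ev t (B i))" for t by (simp add: ev_sum ev_mult)
  have in1: "ev t ?S = 1" if t: "t \<in> {0..1}" for t
  proof -
    have "ev t (Y i) = y i t" "ev t (B i) = b i t" if "i < n" for i
      using that t l m by (auto intro!: uni_eqI simp: ev_def B_def Y_def ext_def)
    then show ?thesis using 1[OF t] by (simp add: evS)
  qed
  have "fst ?S t = 0" for t
  proof (cases "t \<in> {0..1}")
    case True
    then show ?thesis using arg_cong[OF in1[OF True], of uvec] by (simp add: ev_def)
  next
    case False
    have "uvec (ev t (Y i) * ev t (B i)) = 0" for i using False by (auto simp: ev_def B_def Y_def ext_def)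
    then have "uvec (\<Sum>i<k. ev t (Y i) * ev t (B i)) = 0" for k by (induction k) simp_all
    then show ?thesis using arg_cong[OF evS[of t], of uvec] by (simp add: ev_def)
  qed
  moreover have "snd ?S = 1" using arg_cong[OF in1[of 0], of uscal] by (simp add: ev_def)
  ultimately have "?S = (0, 1)" by (auto simp: prod_eq_iff fun_eq_iff)
  moreover have "fst (B i) \<in> C01" "fst (Y i) \<in> C01" if "i < n" for i
    using assms(1,2) that by (auto simp: B_def Y_def intro!: ext_C01 continuous_intros)
  ultimately show ?thesis unfolding Lg_def B_def[symmetric] by blast
qed

lemma C01_dist_upper:
  assumes "f \<in> C01" "g \<in> C01" "t \<in> {0..1}"
  shows "dist (f t) (g t) \<le> C01_dist f g"
  unfolding C01_dist_def
proof (rule cSUP_upper[OF assms(3)])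
  have "continuous_on {0..1} (\<lambda>t. dist (f t) (g t))" using assms by (intro continuous_intros) (auto simp: C01_def)
  then have "compact ((\<lambda>t. dist (f t) (g t)) ` {0..1})" by (rule compact_continuous_image) simp
  then show "bdd_above ((\<lambda>t. dist (f t) (g t)) ` {0..1})" by (simp add: bounded_imp_bdd_above compact_imp_bounded)
qed

lemma C01_dist_le: "(\<And>t. t \<in> {0..1} \<Longrightarrow> dist (f t) (g t) \<le> e) \<Longrightarrow> C01_dist f g \<le> e"
  unfolding C01_dist_def by (rule cSUP_least) auto

text \<open>Evaluating a left inverse gives left inverses at each t, and stable rank one of A makes
  them two-sided.\<close>

lemma C01_dense_paths:
  fixes f :: "real \<Rightarrow> 'a::cstar_algebra uni"
  assumes sr: "sr TYPE('a) = 1" and L: "Lg_dense (C01_scale :: complex \<Rightarrow> (real \<Rightarrow> 'a) \<Rightarrow> real \<Rightarrow> 'a) C01 C01_dist 1"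
    and f: "continuous_on {0..1} f" "\<And>t. uscal (f t) = 1" and e: "e > 0"
  shows "\<exists>g. continuous_on {0..1} g \<and> (\<forall>t\<in>{0..1}. g t \<in> invs \<and> norm (f t - g t) < e)"
proof -
  have Ls: "Lg_dense (cscale :: complex \<Rightarrow> 'a \<Rightarrow> 'a) UNIV dist 1"
    using sr by (simp add: sr_def stable_rank_eq_1_iff)
  define F where "F = ext (\<lambda>t. uvec (f t))"
  have F: "F \<in> C01" unfolding F_def by (intro ext_C01 continuous_intros f)
  obtain z where z: "z \<in> Lg (C01_scale :: complex \<Rightarrow> (real \<Rightarrow> 'a) \<Rightarrow> real \<Rightarrow> 'a) C01 1"
      "C01_dist F (fst (z 0)) + cmod (1 - snd (z 0)) < e"
    using L e F unfolding Lg_dense_def by (elim allE[of _ "\<lambda>_. (F, 1)"]) auto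
  then obtain y where y: "uni_mult C01_scale (y 0) (z 0) = (0, 1)" and zC: "fst (z 0) \<in> C01" by (auto simp: Lg_def)
  define g where "g = (\<lambda>t. ev t (z 0))"
  have "continuous_on {0..1} g"
    unfolding g_def ev_def by (intro continuous_on_Uni continuous_on_const) (use zC in \<open>simp add: C01_def\<close>)
  moreover have "g t \<in> invs \<and> norm (f t - g t) < e" if t: "t \<in> {0..1}" for t
  proof
    have "ev t (y 0) * g t = ev t (0, 1)" unfolding g_def ev_mult[symmetric] y ..
    then have "ev t (y 0) * g t = 1" by (simp add: ev_def one_uni_def)
    then show "g t \<in> invs" using left_invertible_invs[OF left_invertible_dense[OF Ls]] by blast
    have "norm (f t - g t) \<le> dist (F t) (fst (z 0) t) + cmod (1 - snd (z 0))"
      using norm_uni_le[of "f t - g t"] t f(2) by (simp add: g_def ev_def F_def ext_def dist_norm)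
    then show "norm (f t - g t) < e" using C01_dist_upper[OF F zC t] z(2) by linarith
  qed
  ultimately show ?thesis by blast
qed

lemma K1_trivial_of_sr_C01:
  fixes B :: "'a::cstar_algebra set"
  assumes sr: "sr TYPE('a) = 1" and L: "Lg_dense (C01_scale :: complex \<Rightarrow> (real \<Rightarrow> 'a) \<Rightarrow> real \<Rightarrow> 'a) C01 C01_dist 1"
    and B: "hereditary B"
  shows "K1_trivial B"
  by (rule K1_trivial_of_connected[OF B UB_dense[OF B sr_1_dense[OF sr]]
        UB_connected[OF B C01_dense_paths[OF sr L]]])

lemma nonzero_approx:
  fixes l :: complex
  assumes "e > 0" shows "\<exists>l'. l' \<noteq> 0 \<and> cmod (l - l') \<le> e"
proof (cases "l = 0")
  case True
  show ?thesis by (rule exI[of _ "complex_of_real e"]) (use True assms in auto)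
next
  case False
  show ?thesis by (rule exI[of _ l]) (use False assms in auto)
qed

text \<open>\<open>invertible_path_approx\<close> expects scalar part 1 and returns paths whose
  scalar part may vary. So the scalar, perturbed to be nonzero, is divided out first, and the result
  is multiplied by the continuous factor l / \<open>uscal (g t)\<close>.\<close>

lemma Lg_dense_1_C01:
  assumes sr: "sr TYPE('a::cstar_algebra) = 1" and K1: "\<And>B::'a set. hereditary B \<Longrightarrow> K1_trivial B"
  shows "Lg_dense (C01_scale :: complex \<Rightarrow> (real \<Rightarrow> 'a) \<Rightarrow> real \<Rightarrow> 'a) C01 C01_dist 1"
  unfolding Lg_dense_def
proof (intro allI impI)
  fix x :: "nat \<Rightarrow> (real \<Rightarrow> 'a) \<times> complex" and e :: real
  assume x: "\<forall>i<1. fst (x i) \<in> C01" and e: "e > 0"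
  define f where "f = fst (x 0)"
  have f: "continuous_on {0..1} f" using x by (simp add: f_def C01_def)
  obtain l where l: "l \<noteq> 0" "cmod (snd (x 0) - l) \<le> e / 4" using nonzero_approx[of "e / 4" "snd (x 0)"] e by auto
  define F where "F = (\<lambda>t. Uni (cscale (inverse l) (f t)) 1)"
  have F: "continuous_on {0..1} F" "\<And>t. uscal (F t) = 1"
    unfolding F_def by (auto intro!: continuous_on_Uni bounded_linear.continuous_on[OF bounded_linear_cscale] f)
  have "compact (F ` {0..1})" by (rule compact_continuous_image[OF F(1)]) simp
  then obtain K0 where K0: "\<And>t. t \<in> {0..1} \<Longrightarrow> norm (F t) \<le> K0"
    using compact_imp_bounded bounded_iff by (metis imageI)
  define K where "K = K0 + 1"
  have K: "K > 0" using order_trans[OF norm_ge_zero K0[of 0]] by (simp add: K_def)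
  \<comment> \<open>Makes the error cmod l (d + 2 d K) equal to d T / 4, at most e/8; passing to
    vector parts doubles it to e/4.\<close>
  define T where "T = 4 * cmod l * (1 + 2 * K)"
  have T: "T > 0" using l K by (simp add: T_def)
  define d where "d = min (1/2) (e / (2 * T))"
  have d: "d > 0" "d \<le> 1/2" "d \<le> e / (2 * T)" using e T by (auto simp: d_def)
  obtain g where g: "continuous_on {0..1} g" "\<And>t. t \<in> {0..1} \<Longrightarrow> g t \<in> invs \<and> norm (F t - g t) < d"
    using invertible_path_approx[OF sr_1_dense[OF sr] K1 F d(1)] by metis
  have s: "cmod (1 - uscal (g t)) < d" if "t \<in> {0..1}" for t
    using cmod_scal_le[of "F t - g t"] g(2)[OF that] F(2)[of t] by simp
  have s2: "cmod (uscal (g t)) \<ge> 1/2" if "t \<in> {0..1}" for t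
    using s[OF that] d(2) norm_triangle_ineq3[of 1 "uscal (g t)"] by simp
  then have s0: "uscal (g t) \<noteq> 0" if "t \<in> {0..1}" for t using that by force
  define G where "G = (\<lambda>t. Uni 0 (l / uscal (g t)) * g t)"
  have G: "continuous_on {0..1} G" unfolding G_def by (intro continuous_intros g(1) ballI s0)
  have Gi: "G t \<in> invs" if "t \<in> {0..1}" for t
    unfolding G_def using s0[OF that] l(1) g(2)[OF that] by (intro invs_mult Uni_scal_invs) auto
  have Gs: "uscal (G t) = l" if "t \<in> {0..1}" for t using s0[OF that] by (simp add: G_def)
  have dist: "norm (Uni 0 l * F t - G t) \<le> e / 8" if t: "t \<in> {0..1}" for t
  proof -
    let ?s = "uscal (g t)"
    have "Uni 0 l * F t - G t = Uni 0 l * ((F t - g t) - Uni 0 ((1 - ?s) / ?s) * g t)"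
    proof -
      have "Uni 0 l * Uni 0 ((1 - ?s) / ?s) = Uni 0 (l / ?s) - Uni (0::'a) l"
        by (rule uni_eqI) (use s0[OF t] in \<open>simp_all add: field_simps\<close>)
      then have "Uni 0 l * (Uni 0 ((1 - ?s) / ?s) * g t) = G t - Uni 0 l * g t"
        by (simp add: G_def left_diff_distrib mult.assoc[symmetric])
      then show ?thesis by (simp add: right_diff_distrib)
    qed
    then have "norm (Uni 0 l * F t - G t) \<le> cmod l * norm ((F t - g t) - Uni 0 ((1 - ?s) / ?s) * g t)"
      using norm_mult_ineq[of "Uni (0::'a) l" "(F t - g t) - Uni 0 ((1 - ?s) / ?s) * g t"] by simp
    also have "\<dots> \<le> cmod l * (d + (2 * d) * K)"
    proof (rule mult_left_mono)
      have "cmod ((1 - ?s) / ?s) \<le> 2 * d"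
        using s[OF t] s2[OF t] mult_mono[of "cmod (1 - ?s)" d 1 "2 * cmod ?s"] s0[OF t] d by (simp add: norm_divide divide_le_eq mult_ac)
      moreover have "norm (g t) \<le> K" using g(2)[OF t] K0[OF t] d(2) norm_triangle_ineq3[of "F t" "g t"] unfolding K_def by linarith
      ultimately have "norm (Uni (0::'a) ((1 - ?s) / ?s)) * norm (g t) \<le> (2 * d) * K"
        unfolding norm_Uni_scal using d(1) by (intro mult_mono) auto
      then have "norm (Uni 0 ((1 - ?s) / ?s) * g t) \<le> (2 * d) * K" using norm_mult_ineq order_trans by blast
      then show "norm ((F t - g t) - Uni 0 ((1 - ?s) / ?s) * g t) \<le> d + (2 * d) * K"
        using norm_triangle_ineq4[of "F t - g t" "Uni 0 ((1 - ?s) / ?s) * g t"] g(2)[OF t] by linarith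
    qed simp
    also have "\<dots> = d * T / 4" by (simp add: T_def algebra_simps)
    also have "\<dots> \<le> e / 8" using mult_right_mono[OF d(3), of T] T by (simp add: mult_ac)
    finally show ?thesis .
  qed
  let ?z = "\<lambda>i::nat. (ext (\<lambda>t. uvec (G t)), l)"
  have ui: "uscal (uinv (G t)) = inverse l" if "t \<in> {0..1}" for t
  proof -
    have "uscal (G t) * uscal (uinv (G t)) = 1" using arg_cong[OF uinv_right[OF Gi[OF that]], of uscal] by simp
    then show ?thesis using Gs[OF that] l(1) by (simp add: inverse_unique)
  qed
  have "?z \<in> Lg C01_scale C01 1"
    by (rule Lg_C01I[where y = "\<lambda>_ t. uinv (G t)" and m = "\<lambda>_. inverse l"]) (use G Gs ui Gi in \<open>auto intro!: continuous_on_uinv\<close>)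
  moreover have "C01_dist (fst (x 0)) (fst (?z 0)) + cmod (snd (x 0) - snd (?z 0)) < e"
  proof -
    have "C01_dist f (ext (\<lambda>t. uvec (G t))) \<le> e / 4"
    proof (rule C01_dist_le)
      fix t :: real assume t: "t \<in> {0..1}"
      have "uvec (Uni 0 l * F t - G t) = f t - uvec (G t)" using l by (simp add: F_def cscale_assoc)
      then have "norm (f t - uvec (G t)) \<le> 2 * norm (Uni 0 l * F t - G t)" using norm_vec_le by metis
      then show "dist (f t) (ext (\<lambda>t. uvec (G t)) t) \<le> e / 4" using dist[OF t] t by (simp add: dist_norm ext_def)
    qed
    then show ?thesis using l(2) e by (simp add: f_def)
  qed
  ultimately show "\<exists>z\<in>Lg C01_scale C01 1. \<forall>i<1. C01_dist (fst (x i)) (fst (z i)) + cmod (snd (x i) - snd (z i)) < e"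
    by (intro bexI[of _ ?z]) auto
qed

text \<open>Approximate both components by paths that change only in turn, so that at each time one of
  them is constant and invertible.\<close>
lemma Lg_dense_2_C01:
  assumes sr: "sr TYPE('a::cstar_algebra) = 1"
  shows "Lg_dense (C01_scale :: complex \<Rightarrow> (real \<Rightarrow> 'a) \<Rightarrow> real \<Rightarrow> 'a) C01 C01_dist 2"
  unfolding Lg_dense_def
proof (intro allI impI)
  fix x :: "nat \<Rightarrow> (real \<Rightarrow> 'a) \<times> complex" and e :: real
  assume x: "\<forall>i<2. fst (x i) \<in> C01" and e: "e > 0"
  obtain l where l: "\<And>i. l i \<noteq> 0 \<and> cmod (snd (x i) - l i) \<le> e / 4"
  proof -
    have "\<forall>i. \<exists>l'. l' \<noteq> 0 \<and> cmod (snd (x i) - l') \<le> e / 4" using nonzero_approx[of "e / 4"] e by simp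
    then show ?thesis using that by metis
  qed
  define F where "F = (\<lambda>i t. Uni (fst (x i) t) (l i))"
  have F: "continuous_on {0..1} (F i)" if "i < 2" for i
    unfolding F_def using x that by (intro continuous_on_Uni continuous_on_const) (simp add: C01_def)
  have "continuous_on {0..1} (\<lambda>t. (F 0 t, F 1 t))" by (intro continuous_on_Pair F) simp_all
  \<comment> \<open>Five errors of size d, doubled for vector parts, and e/4 for the scalar: 10 d +
    e/4 = 7e/8.\<close>
  define d where "d = e / 16"
  have d: "d > 0" using e by (simp add: d_def)
  obtain N where N: "N > 0" "\<And>k t. k < N \<Longrightarrow> real k / real N \<le> t \<Longrightarrow> t \<le> real (Suc k) / real N \<Longrightarrow>
      dist (F 0 t, F 1 t) (F 0 (real k / real N), F 1 (real k / real N)) < d"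
    using uniform_partition[OF \<open>continuous_on {0..1} (\<lambda>t. (F 0 t, F 1 t))\<close> d] by metis
  let ?x = "\<lambda>k. real k / real N"
  have N': "norm (F i t - F i (?x k)) < d" if "k < N" "?x k \<le> t" "t \<le> ?x (Suc k)" "i < 2" for i k t
  proof -
    have "dist (F i t) (F i (?x k)) \<le> dist (F 0 t, F 1 t) (F 0 (?x k), F 1 (?x k))"
      using that(4) dist_fst_le[of "(F 0 t, F 1 t)" "(F 0 (?x k), F 1 (?x k))"] dist_snd_le[of "(F 0 t, F 1 t)" "(F 0 (?x k), F 1 (?x k))"]
      by (auto simp: numeral_2_eq_2 less_Suc_eq)
    then show ?thesis using N(2)[OF that(1-3)] by (simp add: dist_norm)
  qed
  have "\<exists>y\<in>invs. uscal y = l i \<and> norm (F i (?x k) - y) < d" for i k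
    using dense_scal[OF sr_1_dense[OF sr] d, of "F i (?x k)"] l[of i] by (auto simp: F_def)
  then obtain P where P: "\<And>i k. P i k \<in> invs \<and> uscal (P i k) = l i \<and> norm (F i (?x k) - P i k) < d" by metis
  have step: "norm (P i (Suc k) - P i k) < 3 * d" if "k < N" "i < 2" for i k
  proof -
    have "norm (F i (?x (Suc k)) - F i (?x k)) < d" using N'[OF that(1) _ order_refl that(2)] N(1) by (simp add: divide_right_mono)
    moreover have "norm (F i (?x k) - P i k) < d" "norm (F i (?x (Suc k)) - P i (Suc k)) < d" using P by blast+
    moreover have "norm (P i (Suc k) - P i k) \<le> norm (F i (?x (Suc k)) - P i (Suc k)) + norm (F i (?x (Suc k)) - F i (?x k)) + norm (F i (?x k) - P i k)"
      by norm
    ultimately show ?thesis by linarith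
  qed
  define ok where "ok = (\<lambda>k i z. norm (z - P i k) < 3 * d \<and> uscal z = l i)"
  \<comment> \<open>The coefficients of a left inverse travel along with the two components and are
    therefore continuous by construction.\<close>
  define S where "S = (\<lambda>k. {(b0, b1, y0, y1). y0 * b0 + y1 * b1 = 1 \<and> ok k 0 b0 \<and> ok k 1 b1})"
  have ok0: "ok k i (P i k)" for k i using P d by (simp add: ok_def)
  have okS: "ok k i ((1 - t) *\<^sub>R P i k + t *\<^sub>R P i (Suc k))" if "k < N" "i < 2" "0 \<le> t" "t \<le> 1" for k i t
  proof -
    have "(1 - t) *\<^sub>R P i k + t *\<^sub>R P i (Suc k) - P i k = t *\<^sub>R (P i (Suc k) - P i k)" by (simp add: algebra_simps)
    then have "norm ((1 - t) *\<^sub>R P i k + t *\<^sub>R P i (Suc k) - P i k) \<le> norm (P i (Suc k) - P i k)"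
      using that by (simp add: mult_left_le_one_le)
    moreover have "uscal ((1 - t) *\<^sub>R P i k + t *\<^sub>R P i (Suc k)) = l i" using P by (simp add: algebra_simps)
    ultimately show ?thesis using step[OF that(1,2)] by (simp add: ok_def)
  qed
  have pc: "path_component (S k) (P 0 k, P 1 k, uinv (P 0 k), 0) (P 0 (Suc k), P 1 (Suc k), uinv (P 0 (Suc k)), 0)" if k: "k < N" for k
  proof -
    let ?p = "P 0 k" and ?q = "P 1 k" and ?p' = "P 0 (Suc k)" and ?q' = "P 1 (Suc k)"
    have inv: "?p \<in> invs" "?q \<in> invs" "?p' \<in> invs" "?q' \<in> invs" using P by auto
    have okp': "ok k 0 ?p'" "ok k 1 ?q'" using okS[OF k, of _ 1] by force+
    have sw: "path_component (S k) (a, b, uinv a, 0) (a, b, 0, uinv b)" if "a \<in> invs" "b \<in> invs" "ok k 0 a" "ok k 1 b" for a b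
    proof -
      let ?g = "\<lambda>t. (a, b, (1 - t) *\<^sub>R uinv a, t *\<^sub>R uinv b)"
      have "path_component (S k) (?g 0) (?g 1)"
        by (rule path_componentI) (use that in \<open>auto intro!: continuous_intros simp: S_def algebra_simps\<close>)
      then show ?thesis by simp
    qed
    have m1: "path_component (S k) (?p, ?q, 0, uinv ?q) (?p', ?q, 0, uinv ?q)"
    proof -
      let ?g = "\<lambda>t. ((1 - t) *\<^sub>R ?p + t *\<^sub>R ?p', ?q, 0, uinv ?q)"
      have "path_component (S k) (?g 0) (?g 1)"
        by (rule path_componentI) (use inv okS[OF k, of 0] ok0 in \<open>auto intro!: continuous_intros simp: S_def\<close>)
      then show ?thesis by simp
    qed
    have m2: "path_component (S k) (?p', ?q, uinv ?p', 0) (?p', ?q', uinv ?p', 0)"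
    proof -
      let ?g = "\<lambda>t. (?p', (1 - t) *\<^sub>R ?q + t *\<^sub>R ?q', uinv ?p', 0)"
      have "path_component (S k) (?g 0) (?g 1)"
        by (rule path_componentI) (use inv okS[OF k, of 1] okp' in \<open>auto intro!: continuous_intros simp: S_def\<close>)
      then show ?thesis by simp
    qed
    \<comment> \<open>Switch to the inverse of the second component, move the first, switch back to
      the inverse of the new first component, move the second.\<close>
    show ?thesis
      using sw[OF inv(1,2) ok0 ok0] m1 path_component_sym[OF sw[OF inv(3,2) okp'(1) ok0]] m2 by (meson path_component_trans)
  qed
  obtain g where g: "continuous_on {0..1} g" "\<And>k t. k < N \<Longrightarrow> ?x k \<le> t \<Longrightarrow> t \<le> ?x (Suc k) \<Longrightarrow> g t \<in> S k"
    by (rule glue_paths[of N S "\<lambda>k. (P 0 k, P 1 k, uinv (P 0 k), 0)", OF pc N(1)]) blast+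
  define b where "b = (\<lambda>i t. if i = (0::nat) then fst (g t) else fst (snd (g t)))"
  define y0 where "y0 = (\<lambda>t. fst (snd (snd (g t))))"
  define y1 where "y1 = (\<lambda>t. snd (snd (snd (g t))))"
  \<comment> \<open>The scalar parts of \<open>y0\<close> and \<open>y1\<close> vary with t. Since 1
    - \<mu> b0 has scalar part 0, multiplying both by it and adding \<mu> to the first gives a left
    inverse with constant scalar parts.\<close>
  define \<mu> where "\<mu> = Uni (0::'a) (inverse (l 0))"
  define y where "y = (\<lambda>i t. if i = (0::nat) then \<mu> + (1 - \<mu> * b 0 t) * y0 t else (1 - \<mu> * b 0 t) * y1 t)"
  have main: "(y0 t * b 0 t + y1 t * b 1 t = 1) \<and> (\<forall>i<2. uscal (b i t) = l i \<and> norm (F i t - b i t) < 5 * d)" if t: "t \<in> {0..1}" for t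
  proof -
    obtain k where k: "k < N" "?x k \<le> t" "t \<le> ?x (Suc k)" 
      by (rule partition_index[OF N(1) t])
    have gS: "g t \<in> S k" by (rule g(2)[OF k])
    then have 1: "y0 t * b 0 t + y1 t * b 1 t = 1" and okb: "ok k 0 (b 0 t)" "ok k 1 (b 1 t)"
      by (auto simp: S_def y0_def y1_def b_def split: prod.splits)
    have okb': "ok k i (b i t)" if "i < 2" for i using okb that by (auto simp: numeral_2_eq_2 less_Suc_eq)
    have "norm (F i t - b i t) < 5 * d" if "i < 2" for i
    proof -
      have "norm (F i t - F i (?x k)) < d" by (rule N'[OF k that])
      moreover have "norm (F i (?x k) - P i k) < d" using P by blast
      moreover have "norm (b i t - P i k) < 3 * d" using okb'[OF that] by (simp add: ok_def)
      moreover have "norm (F i t - b i t) \<le> norm (F i t - F i (?x k)) + norm (F i (?x k) - P i k) + norm (b i t - P i k)" by norm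
      ultimately show ?thesis by linarith
    qed
    then show ?thesis using 1 okb' by (auto simp: ok_def)
  qed
  have cg: "continuous_on {0..1} (b i)" "continuous_on {0..1} y0" "continuous_on {0..1} y1" for i
    unfolding b_def y0_def y1_def by (cases "i = 0"; auto intro!: continuous_intros g(1))+
  let ?z = "\<lambda>i. (ext (\<lambda>t. uvec (b i t)), l i)"
  have zL: "?z \<in> Lg C01_scale C01 2"
  proof (rule Lg_C01I[where y = y and m = "\<lambda>i. if i = 0 then inverse (l 0) else 0"])
    show "continuous_on {0..1} (b i)" for i by (rule cg)
    show "continuous_on {0..1} (y i)" for i
      unfolding y_def by (cases "i = 0") (auto intro!: continuous_intros cg)
    fix t :: real assume t: "t \<in> {0..1}"
    have z: "uscal (1 - \<mu> * b 0 t) = 0" using main[OF t] l[of 0] by (simp add: \<mu>_def)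
    show "uscal (b i t) = l i" if "i < 2" for i using main[OF t] that by blast
    show "uscal (y i t) = (if i = 0 then inverse (l 0) else 0)" for i using z by (simp add: y_def) (simp add: \<mu>_def)
    have "y 0 t * b 0 t + y 1 t * b 1 t = \<mu> * b 0 t + (1 - \<mu> * b 0 t) * (y0 t * b 0 t + y1 t * b 1 t)"
      by (simp add: y_def algebra_simps)
    also have "\<dots> = 1" using main[OF t] by simp
    finally show "(\<Sum>i<2. y i t * b i t) = 1" by (simp add: numeral_2_eq_2)
  qed
  have "C01_dist (fst (x i)) (fst (?z i)) + cmod (snd (x i) - snd (?z i)) < e" if i: "i < 2" for i
  proof -
    have "C01_dist (fst (x i)) (ext (\<lambda>t. uvec (b i t))) \<le> 10 * d"
    proof (rule C01_dist_le)
      fix t :: real assume t: "t \<in> {0..1}"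
      have "norm (F i t - b i t) < 5 * d" using main[OF t] i by blast
      moreover have "uvec (F i t - b i t) = fst (x i) t - uvec (b i t)" by (simp add: F_def)
      ultimately have "norm (fst (x i) t - uvec (b i t)) \<le> 10 * d" using norm_vec_le[of "F i t - b i t"] by simp
      then show "dist (fst (x i) t) (ext (\<lambda>t. uvec (b i t)) t) \<le> 10 * d" using t by (simp add: dist_norm ext_def)
    qed
    moreover have "cmod (snd (x i) - l i) \<le> e / 4" using l by blast
    ultimately show ?thesis using e by (simp add: d_def)
  qed
  then show "\<exists>z\<in>Lg C01_scale C01 2. \<forall>i<2. C01_dist (fst (x i)) (fst (z i)) + cmod (snd (x i) - snd (z i)) < e"
    by (intro bexI[OF _ zL] allI impI)
qed

theorem theorem1p3:
  assumes "sr TYPE('a::cstar_algebra) = 1"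
  shows "(no_K1_obstructions TYPE('a) \<longrightarrow> sr_C01 TYPE('a) = 1) \<and>
         (\<not> no_K1_obstructions TYPE('a) \<longrightarrow> sr_C01 TYPE('a) = 2)"
proof (intro conjI impI)
  assume "no_K1_obstructions TYPE('a)"
  then have "\<And>B::'a set. hereditary B \<Longrightarrow> K1_trivial B" by (simp add: no_K1_obstructions_def)
  from Lg_dense_1_C01[OF assms this] show "sr_C01 TYPE('a) = 1"
    by (simp add: sr_C01_def stable_rank_eq_1_iff)
next
  assume "\<not> no_K1_obstructions TYPE('a)"
  then obtain B :: "'a set" where "hereditary B" "\<not> K1_trivial B"
    using assms by (auto simp: no_K1_obstructions_def)
  then have "\<not> Lg_dense (C01_scale :: complex \<Rightarrow> (real \<Rightarrow> 'a) \<Rightarrow> real \<Rightarrow> 'a) C01 C01_dist 1"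
    using K1_trivial_of_sr_C01[OF assms] by blast
  then show "sr_C01 TYPE('a) = 2"
    unfolding sr_C01_def by (rule stable_rank_eq_2I[OF _ Lg_dense_2_C01[OF assms]])
qed

end
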